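(* Let $k$ be an algebraically closed field of characteristic $2$, let $n\geq 3$ be odd and let $m\geq n$. If $m$ is even, then the $m$-linear $SO(n)$-invariant $g=g_{n\times m}$ is an indecomposable element of $R_{n\times m}^{SO(n)}$. If $m$ is odd, then the $m$-linear $SO(n)$-invariant $h=h_{n\times m}$ is an indecomposable element of $R_{n\times m}^{SO(n)}$.
   Context: Write $n=2\nu+1$ and $\mu=\lfloor m/2\rfloor$. **Groups.** Coordinates on $k^n$ are $x_1,y_1,\dots,x_\nu,y_\nu,z$, and $q=x_1y_1+\dots+x_\nu y_\nu+z^2$. $O(n)=O(n,k)$ is the group of linear automorphisms of $k^n$ preserving $q$, and $SO(n)$ is its (Zariski) connected component containing the identity (for odd $n$ in characteristic 2, $SO(n)=O(n)$). **Invariants.** $R=R_{n\times m}$ is the $k$-algebra of polynomials in the coordinates $x_r^{(i)},y_r^{(i)},z^{(i)}$ of indeterminate $n$-dimensional vectors $v^{(1)},\dots,v^{(m)}$; for a group $G$ acting on $k^n$, $R^G$ is the subalgebra of polynomials invariant under the simultaneous action of $G$ on $m$-tuples of vectors. A polynomial is $m$-linear if it is multilinear in $v^{(1)},\dots,v^{(m)}$. An element of $R^G$ is indecomposable if it is not contained in the subalgebra of $R^G$ generated by the elements of $R^G$ of lower degree (i.e. of total degree strictly less than that of the given element). **The polynomials $g$ and $h$.** Over $\mathbb Z$, let $B^{(ij)}=\sum_{r=1}^\nu(x_r^{(i)}y_r^{(j)}+y_r^{(i)}x_r^{(j)})+2z^{(i)}z^{(j)}$ for $1\le i,j\le m$;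 let $D^{(i_1,\dots,i_n)}=\det[v^{(i_1)},\dots,v^{(i_n)}]$ be the determinant of the matrix with the given columns (coordinates in the order $x_1,y_1,\dots,x_\nu,y_\nu,z$); and let $\mathrm{Pf}^{(i_1,\dots,i_{2\lambda})}$ be the Pfaffian of the $2\lambda\times2\lambda$ skew-symmetric matrix whose $(k,l)$ entry for $k<l$ is $B^{(i_ki_l)}$ (the empty Pfaffian is $1$). If $m=2\mu$ is even, $\tilde g=2^{-(\mu-\nu)}\,\mathrm{Pf}^{(1,\dots,2\mu)}$; it has integer coefficients, and $g=g_{n\times m}\in R$ is its reduction modulo 2 (coefficients in the prime field $\mathbb F_2\subset k$). If $m$ is odd, $\tilde h=2^{-(\mu-\nu)}\sum_\pi \mathrm{sgn}\,\pi\cdot D^{(\pi(1),\dots,\pi(n))}\mathrm{Pf}^{(\pi(n+1),\dots,\pi(m))}$, the sum being over permutations $\pi\in\mathfrak S_m$ with $\pi(1)<\dots<\pi(n)$ and $\pi(n+1)<\dots<\pi(m)$; it has integer coefficients, and $h=h_{n\times m}\in R$ is its reduction modulo 2. Both $g$ and $h$ (when defined) are $SO(n)$-invariant. *)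

theory Defs
  imports
    "HOL-Library.Poly_Mapping"
    "HOL-Analysis.Function_Topology"
    "Jordan_Normal_Form.Determinant"
begin

section \<open>Polynomials in the coordinates of several vectors\<close>

text \<open>
  The variable \<open>(i, r)\<close> is the \<open>r\<close>-th coordinate of the \<open>i\<close>-th indeterminate vector; both indices
  start at 0. With \<open>n = 2 * \<nu> + 1\<close>, the coordinates \<open>x\<^sub>1, y\<^sub>1, \<dots>, x\<^sub>\<nu>, y\<^sub>\<nu>, z\<close> have the positions
  \<open>0, 1, \<dots>, 2 * \<nu> - 2, 2 * \<nu> - 1, 2 * \<nu>\<close>. Throughout, \<open>\<nu>\<close> is written \<open>n div 2\<close> (\<open>n\<close> is odd)
  and \<open>\<mu>\<close> is \<open>m div 2\<close>.
\<close>

type_synonym 'a vpoly = "((nat \<times> nat) \<Rightarrow>\<^sub>0 nat) \<Rightarrow>\<^sub>0 'a"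

definition Const :: "'a::comm_ring_1 \<Rightarrow> 'a vpoly" where
  "Const c = Poly_Mapping.single 0 c"

definition Var :: "nat \<Rightarrow> nat \<Rightarrow> 'a::comm_ring_1 vpoly" where
  "Var i r = Poly_Mapping.single (Poly_Mapping.single (i, r) 1) 1"

definition poly_ring :: "nat \<Rightarrow> nat \<Rightarrow> 'a::comm_ring_1 vpoly set" where
  "poly_ring n m = {p. \<forall>t\<in>Poly_Mapping.keys p. Poly_Mapping.keys t \<subseteq> {..<m} \<times> {..<n}}"

text \<open>Coefficients are mapped by \<open>c\<close> and the variables replaced according to \<open>\<phi>\<close>.\<close>

definition eval_vpoly ::
    "('a::comm_ring_1 \<Rightarrow> 'b::comm_ring_1) \<Rightarrow> (nat \<times> nat \<Rightarrow> 'b) \<Rightarrow> 'a vpoly \<Rightarrow> 'b" where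
  "eval_vpoly c \<phi> p =
     (\<Sum>t\<in>Poly_Mapping.keys p. c (Poly_Mapping.lookup p t) *
        (\<Prod>v\<in>Poly_Mapping.keys t. \<phi> v ^ Poly_Mapping.lookup t v))"

text \<open>The zero polynomial has degree 0 here.\<close>

definition total_degree :: "'a::comm_ring_1 vpoly \<Rightarrow> nat" where
  "total_degree p =
     Max (insert 0 ((\<lambda>t. \<Sum>v\<in>Poly_Mapping.keys t. Poly_Mapping.lookup t v) ` Poly_Mapping.keys p))"

text \<open>Linearity in the \<open>i\<close>-th vector: every monomial has degree exactly 1 in its coordinates.\<close>

definition multilinear :: "nat \<Rightarrow> nat \<Rightarrow> 'a::comm_ring_1 vpoly \<Rightarrow> bool" where
  "multilinear n m p \<longleftrightarrow>
     p \<in> poly_ring n m \<and>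
     (\<forall>t\<in>Poly_Mapping.keys p. \<forall>i<m. (\<Sum>r<n. Poly_Mapping.lookup t (i, r)) = 1)"


section \<open>The orthogonal groups\<close>

definition qform :: "nat \<Rightarrow> 'a::comm_ring_1 vec \<Rightarrow> 'a" where
  "qform n v = (\<Sum>r<n div 2. v $ (2 * r) * v $ (2 * r + 1)) + (v $ (2 * (n div 2)))\<^sup>2"

definition orthogonal_group :: "nat \<Rightarrow> 'a::field mat set" where
  "orthogonal_group n =
     {A \<in> carrier_mat n n. invertible_mat A \<and>
        (\<forall>v\<in>carrier_vec n. qform n (A *\<^sub>v v) = qform n v)}"

text \<open>
  The Zariski topology on the affine space of \<open>n \<times> n\<close> matrices: the complements of zero sets of
  single polynomials in the entries are a base.
\<close>

definition zariski_mat :: "nat \<Rightarrow> 'a::field mat topology" where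
  "zariski_mat n = topology_generated_by
     {{A \<in> carrier_mat n n. eval_vpoly (\<lambda>c. c) (\<lambda>ij. A $$ ij) p \<noteq> 0} | p. p \<in> poly_ring n n}"

definition special_orthogonal_group :: "nat \<Rightarrow> 'a::field mat set" where
  "special_orthogonal_group n =
     connected_component_of_set (subtopology (zariski_mat n) (orthogonal_group n)) (1\<^sub>m n)"


section \<open>Invariants and indecomposability\<close>

text \<open>\<open>f\<close> with every vector \<open>v\<^bsup>(i)\<^esup>\<close> replaced by \<open>A v\<^bsup>(i)\<^esup>\<close>.\<close>

definition act :: "nat \<Rightarrow> 'a::comm_ring_1 mat \<Rightarrow> 'a vpoly \<Rightarrow> 'a vpoly" where
  "act n A f = eval_vpoly Const (\<lambda>(i, r). \<Sum>s<n. Const (A $$ (r, s)) * Var i s) f"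

definition invariants :: "nat \<Rightarrow> nat \<Rightarrow> 'a::comm_ring_1 mat set \<Rightarrow> 'a vpoly set" where
  "invariants n m G = {f \<in> poly_ring n m. \<forall>A\<in>G. act n A f = f}"

inductive_set generated_subalgebra :: "'a::comm_ring_1 vpoly set \<Rightarrow> 'a vpoly set"
  for S :: "'a vpoly set" where
  const: "Const c \<in> generated_subalgebra S"
| gen: "f \<in> S \<Longrightarrow> f \<in> generated_subalgebra S"
| add: "\<lbrakk>f \<in> generated_subalgebra S; g \<in> generated_subalgebra S\<rbrakk>
    \<Longrightarrow> f + g \<in> generated_subalgebra S"
| mult: "\<lbrakk>f \<in> generated_subalgebra S; g \<in> generated_subalgebra S\<rbrakk>
    \<Longrightarrow> f * g \<in> generated_subalgebra S"

definition indecomposable :: "'a::comm_ring_1 vpoly set \<Rightarrow> 'a vpoly \<Rightarrow> bool" where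
  "indecomposable A f \<longleftrightarrow>
     f \<in> A \<and> f \<notin> generated_subalgebra {p \<in> A. total_degree p < total_degree f}"


section \<open>The polynomials g and h\<close>

text \<open>
  The sum has one term for each perfect matching of \<open>{0..<2 * l}\<close>, given by the permutation that
  lists its pairs in the standard order.
\<close>

definition pfaffian :: "'a::comm_ring_1 mat \<Rightarrow> 'a" where
  "pfaffian A = (let l = dim_row A div 2 in
     \<Sum>\<pi> | \<pi> permutes {..<2 * l} \<and> (\<forall>i<l. \<pi> (2 * i) < \<pi> (2 * i + 1)) \<and>
            strict_mono_on {..<l} (\<lambda>i. \<pi> (2 * i)).
       of_int (sign \<pi>) * (\<Prod>i<l. A $$ (\<pi> (2 * i), \<pi> (2 * i + 1))))"

definition Bpoly :: "nat \<Rightarrow> nat \<Rightarrow> nat \<Rightarrow> int vpoly" where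
  "Bpoly n i j =
     (\<Sum>r<n div 2. Var i (2 * r) * Var j (2 * r + 1) + Var i (2 * r + 1) * Var j (2 * r)) +
     2 * Var i (2 * (n div 2)) * Var j (2 * (n div 2))"

text \<open>\<open>is\<close> is the list of upper indices.\<close>

definition Dpoly :: "nat \<Rightarrow> nat list \<Rightarrow> int vpoly" where
  "Dpoly n is = det (mat n n (\<lambda>(r, j). Var (is ! j) r))"

definition Pfpoly :: "nat \<Rightarrow> nat list \<Rightarrow> int vpoly" where
  "Pfpoly n is = pfaffian (mat (length is) (length is)
     (\<lambda>(k, l). if k < l then Bpoly n (is ! k) (is ! l)
               else if l < k then - Bpoly n (is ! l) (is ! k)
               else 0))"

text \<open>
  \<open>div_pow2 e P\<close> is \<open>2\<^bsup>-e\<^esup> P\<close>, specified only if \<open>P\<close> is divisible by \<open>2\<^bsup>e\<^esup>\<close>; for the polynomials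
  below this is the assertion that \<open>2\<^bsup>-(\<mu> - \<nu>)\<^esup> P\<close> has integer coefficients.
\<close>

definition div_pow2 :: "nat \<Rightarrow> int vpoly \<Rightarrow> int vpoly" where
  "div_pow2 e P = (THE Q. Const (2 ^ e) * Q = P)"

lemma div_pow2_eqI:
  assumes "Const (2 ^ e) * Q = P"
  shows "div_pow2 e P = Q"
  unfolding div_pow2_def
proof (rule the_equality[where P = "\<lambda>Q. Const (2 ^ e) * Q = P", OF assms])
  fix Q' :: "int vpoly"
  assume "Const (2 ^ e) * Q' = P"
  then have eq: "Poly_Mapping.map ((*) (2 ^ e)) Q' = Poly_Mapping.map ((*) (2 ^ e)) Q"
    using assms by (simp add: Const_def mult_map_scale_conv_mult)
  show "Q' = Q"
  proof (rule poly_mapping_eqI)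
    fix t
    have "2 ^ e * Poly_Mapping.lookup Q' t = 2 ^ e * Poly_Mapping.lookup Q t"
      using arg_cong[OF eq, of "\<lambda>p. Poly_Mapping.lookup p t"]
      by (simp add: Poly_Mapping.map.rep_eq when_def split: if_splits)
    then show "Poly_Mapping.lookup Q' t = Poly_Mapping.lookup Q t"
      by simp
  qed
qed

definition gtilde :: "nat \<Rightarrow> nat \<Rightarrow> int vpoly" where
  "gtilde n m = div_pow2 (m div 2 - n div 2) (Pfpoly n [0..<m])"

definition htilde :: "nat \<Rightarrow> nat \<Rightarrow> int vpoly" where
  "htilde n m = div_pow2 (m div 2 - n div 2)
     (\<Sum>\<pi> | \<pi> permutes {..<m} \<and> strict_mono_on {..<n} \<pi> \<and> strict_mono_on {n..<m} \<pi>.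
        of_int (sign \<pi>) * Dpoly n (map \<pi> [0..<n]) * Pfpoly n (map \<pi> [n..<m]))"

text \<open>In characteristic 2 the coefficient map \<open>of_int\<close> is reduction modulo 2.\<close>

definition gpoly :: "nat \<Rightarrow> nat \<Rightarrow> 'a::field vpoly" where
  "gpoly n m = Poly_Mapping.map of_int (gtilde n m)"

definition hpoly :: "nat \<Rightarrow> nat \<Rightarrow> 'a::field vpoly" where
  "hpoly n m = Poly_Mapping.map of_int (htilde n m)"

end

theory Submission
  imports Defs "HOL-Library.Multiset"
begin

text \<open>
  Let \<open>\<rho>\<close> be the spin representation of the Clifford algebra of \<open>q\<close>: a vector \<open>v\<close> acts on a free
  module of rank \<open>2\<^sup>\<nu>\<close> by a matrix with \<open>\<rho>(v)\<^sup>2 = q(v)\<close>. The form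
  \<open>T(v\<^sub>1, \<dots>, v\<^sub>m) = tr(\<rho>(v\<^sub>1) \<cdots> \<rho>(v\<^sub>m))\<close> has integer coefficients. By Wick's formula
  \<open>2\<^sup>\<mu> T\<close> is \<open>2\<^sup>\<nu>\<close> times the Pfaffian if \<open>m\<close> is even (\<open>spin_trace_pfaffian_list\<close>), and \<open>2\<^sup>\<nu>\<close> times the
  alternating sum of the products \<open>D Pf\<close> if \<open>m\<close> is odd (\<open>spin_trace_det_pf_sum\<close>). So the
  divisibility by \<open>2\<^bsup>\<mu> - \<nu>\<^esup>\<close> is explained by \<open>T\<close>, and \<open>g\<close> and \<open>h\<close> are both the reduction of \<open>T\<close> modulo 2.

  Invariance. As a function on words in the basis vectors, \<open>T\<close> satisfies
  \<open>T(\<dots> v w \<dots>) + T(\<dots> w v \<dots>) = B(v, w) T(\<dots> \<dots>)\<close> and \<open>T(\<dots> v v \<dots>) = q(v) T(\<dots> \<dots>)\<close>, it is cyclic, and in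
  characteristic 2 the letter \<open>e\<^sub>z\<close> may be dropped. These rules determine a function by its value
  at the word \<open>x\<^sub>1 y\<^sub>1 \<dots> x\<^sub>\<nu> y\<^sub>\<nu>\<close> (\<open>char2_vanish\<close>). An orthogonal \<open>A\<close> fixes \<open>e\<^sub>z\<close>, which spans the radical
  of \<open>B\<close>, so \<open>T(A v\<^sub>1, \<dots>, A v\<^sub>m)\<close> obeys the same rules and equals \<open>c\<^sub>A T\<close>. The scalar \<open>c\<^sub>A\<close> is
  multiplicative in \<open>A\<close>, hence invertible, and idempotent because \<open>tr(M\<^sup>2) = tr(M)\<^sup>2\<close> in characteristic 2.
  So \<open>c\<^sub>A = 1\<close>.

  Indecomposability. Fix the monomial that takes the coordinates
  \<open>x\<^sub>1, y\<^sub>1, \<dots>, x\<^sub>\<nu>, y\<^sub>\<nu>, z, \<dots>, z\<close> from \<open>v\<^bsup>(1)\<^esup>, \<dots>, v\<^bsup>(m)\<^esup>\<close>, and for a set \<open>S\<close> of upper indices let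
  \<open>M\<^sub>S\<close> be its part with upper indices in \<open>S\<close>. The coefficient of the full monomial in \<open>T\<close> is 1. The
  unipotent transformations \<open>e\<^sub>y \<mapsto> e\<^sub>y + t e\<^sub>z + t\<^sup>2 e\<^sub>x\<close> lie in \<open>SO(n)\<close>; comparing powers of \<open>t\<close> shows that
  an invariant has coefficient 0 at \<open>M\<^sub>S\<close> unless \<open>M\<^sub>S\<close> involves all \<open>x\<^sub>r\<close> and \<open>y\<^sub>r\<close>, or consists of
  complete pairs \<open>x\<^sub>r, y\<^sub>r\<close> without any \<open>z\<close> (\<open>invariant_coefficient_not_admissible\<close>). If the full index
  set is the disjoint union of two such sets, the one that contains a \<open>z\<close> (there is one as \<open>m \<ge> n\<close>) contains
  all pairs, so the other one is empty. Hence products of invariants of lower degree do not contain the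
  full monomial.
\<close>


section \<open>The spin representation and its trace\<close>

text \<open>
  Vectors are coordinate functions on \<open>nat\<close>, of which only the values at \<open>0, \<dots>, 2 * \<nu>\<close> matter. This lets
  lists of vectors of all lengths over all coefficient rings be treated alike, and the generic vectors
  are the partial applications \<open>Var i\<close>.
\<close>

definition basis_vec :: "nat \<Rightarrow> nat \<Rightarrow> 'a::comm_ring_1" where
  "basis_vec s = (\<lambda>r. if r = s then 1 else 0)"

definition polar :: "nat \<Rightarrow> (nat \<Rightarrow> 'a::comm_ring_1) \<Rightarrow> (nat \<Rightarrow> 'a) \<Rightarrow> 'a" where
  "polar \<nu> v w = (\<Sum>r<\<nu>. v (2 * r) * w (2 * r + 1) + v (2 * r + 1) * w (2 * r)) +
     2 * v (2 * \<nu>) * w (2 * \<nu>)"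

definition quad :: "nat \<Rightarrow> (nat \<Rightarrow> 'a::comm_ring_1) \<Rightarrow> 'a" where
  "quad \<nu> v = (\<Sum>r<\<nu>. v (2 * r) * v (2 * r + 1)) + (v (2 * \<nu>))\<^sup>2"

text \<open>
  The spin representation of a sum of \<open>k\<close> hyperbolic planes and the line with form \<open>z\<^sup>2\<close>. Each plane doubles
  the size; the sign in the lower right block makes the new plane anticommute with the previous ones. The
  last coordinate \<open>z\<close> is a separate argument because its position in the vector depends on the final
  number of planes, not on \<open>k\<close>.
\<close>

primrec spin_block :: "'a::comm_ring_1 \<Rightarrow> nat \<Rightarrow> (nat \<Rightarrow> 'a) \<Rightarrow> 'a mat" where
  "spin_block z 0 v = z \<cdot>\<^sub>m 1\<^sub>m 1"
| "spin_block z (Suc k) v =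
     four_block_mat (spin_block z k v) (v (2 * k) \<cdot>\<^sub>m 1\<^sub>m (2 ^ k))
       (v (2 * k + 1) \<cdot>\<^sub>m 1\<^sub>m (2 ^ k)) (- spin_block z k v)"

definition spin :: "nat \<Rightarrow> (nat \<Rightarrow> 'a::comm_ring_1) \<Rightarrow> 'a mat" where
  "spin \<nu> v = spin_block (v (2 * \<nu>)) \<nu> v"

text \<open>
  The coordinate \<open>c\<close> of each vector is used as its \<open>z\<close>. Keeping \<open>c\<close> fixed while \<open>k\<close> varies is what permits
  inductions on the number of planes.
\<close>

definition spin_block_prod :: "nat \<Rightarrow> nat \<Rightarrow> (nat \<Rightarrow> 'a::comm_ring_1) list \<Rightarrow> 'a mat" where
  "spin_block_prod c k vs = foldr (\<lambda>v M. spin_block (v c) k v * M) vs (1\<^sub>m (2 ^ k))"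

definition spin_prod :: "nat \<Rightarrow> (nat \<Rightarrow> 'a::comm_ring_1) list \<Rightarrow> 'a mat" where
  "spin_prod \<nu> vs = spin_block_prod (2 * \<nu>) \<nu> vs"

definition mat_trace :: "'a::comm_ring_1 mat \<Rightarrow> 'a" where
  "mat_trace M = (\<Sum>i<dim_row M. M $$ (i, i))"

definition spin_trace :: "nat \<Rightarrow> (nat \<Rightarrow> 'a::comm_ring_1) list \<Rightarrow> 'a" where
  "spin_trace \<nu> vs = mat_trace (spin_prod \<nu> vs)"

lemma spin_block_carrier [simp]: "spin_block z k v \<in> carrier_mat (2 ^ k) (2 ^ k)"
  by (induction k) auto

lemma dim_spin_block [simp]:
  "dim_row (spin_block z k v) = 2 ^ k" "dim_col (spin_block z k v) = 2 ^ k"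
  using spin_block_carrier[of z k v] by (auto simp del: spin_block_carrier)

lemma spin_carrier [simp]: "spin \<nu> v \<in> carrier_mat (2 ^ \<nu>) (2 ^ \<nu>)"
  by (simp add: spin_def)

lemma spin_block_prod_simps [simp]:
  "spin_block_prod c k [] = 1\<^sub>m (2 ^ k)"
  "spin_block_prod c k (v # vs) = spin_block (v c) k v * spin_block_prod c k vs"
  by (simp_all add: spin_block_prod_def)

lemma spin_block_prod_carrier [simp]: "spin_block_prod c k vs \<in> carrier_mat (2 ^ k) (2 ^ k)"
  by (induction vs) (simp_all add: mult_carrier_mat[OF spin_block_carrier])

lemma spin_block_prod_append:
  "spin_block_prod c k (us @ vs) = spin_block_prod c k us * spin_block_prod c k vs"
proof (induction us)
  case Nil
  show ?case by (simp add: left_mult_one_mat[OF spin_block_prod_carrier])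
next
  case (Cons u us)
  then show ?case
    by (simp add: assoc_mult_mat[OF spin_block_carrier spin_block_prod_carrier spin_block_prod_carrier])
qed

lemma spin_prod_Nil [simp]: "spin_prod \<nu> [] = 1\<^sub>m (2 ^ \<nu>)"
  and spin_prod_Cons [simp]: "spin_prod \<nu> (v # vs) = spin \<nu> v * spin_prod \<nu> vs"
  and spin_prod_carrier [simp]: "spin_prod \<nu> vs \<in> carrier_mat (2 ^ \<nu>) (2 ^ \<nu>)"
  by (simp_all add: spin_prod_def spin_def)

lemma spin_prod_append: "spin_prod \<nu> (us @ vs) = spin_prod \<nu> us * spin_prod \<nu> vs"
  unfolding spin_prod_def by (rule spin_block_prod_append)

lemma scalar_four_block:
  "c \<cdot>\<^sub>m 1\<^sub>m (k + k) =
     four_block_mat (c \<cdot>\<^sub>m 1\<^sub>m k) (0\<^sub>m k k) (0\<^sub>m k k) (c \<cdot>\<^sub>m (1\<^sub>m k :: 'a::comm_ring_1 mat))"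
  by (rule eq_matI) auto

lemma mult_scalar_left:
  "M \<in> carrier_mat k l \<Longrightarrow> (c \<cdot>\<^sub>m 1\<^sub>m k) * M = c \<cdot>\<^sub>m (M :: 'a::comm_ring_1 mat)"
  by (metis left_mult_one_mat one_carrier_mat smult_carrier_mat mult_smult_assoc_mat)

lemma mult_scalar_right:
  "M \<in> carrier_mat l k \<Longrightarrow> M * (c \<cdot>\<^sub>m 1\<^sub>m k) = c \<cdot>\<^sub>m (M :: 'a::comm_ring_1 mat)"
  by (metis right_mult_one_mat one_carrier_mat mult_smult_distrib)

lemma spin_block_mult:
  "spin_block z (Suc k) v * spin_block z' (Suc k) w =
     four_block_mat (spin_block z k v * spin_block z' k w + (v (2*k) * w (2*k+1)) \<cdot>\<^sub>m 1\<^sub>m (2^k))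
       (w (2*k) \<cdot>\<^sub>m spin_block z k v + (- v (2*k)) \<cdot>\<^sub>m spin_block z' k w)
       (v (2*k+1) \<cdot>\<^sub>m spin_block z' k w + (- w (2*k+1)) \<cdot>\<^sub>m spin_block z k v)
       (spin_block z k v * spin_block z' k w + (v (2*k+1) * w (2*k)) \<cdot>\<^sub>m 1\<^sub>m (2^k))"
  (is "?l = ?r")
proof -
  let ?A = "spin_block z k v" and ?B = "spin_block z' k w"
  have c [simp]: "?A \<in> carrier_mat (2^k) (2^k)" "?B \<in> carrier_mat (2^k) (2^k)" by simp_all
  have m: "M * (- ?B) = - (M * ?B)" "(- ?A) * M = - (?A * M)"
    if "M \<in> carrier_mat (2^k) (2^k)" for M
    using carrier_matD[OF that] carrier_matD[OF c(1)] carrier_matD[OF c(2)] by simp_all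
  have "?l = four_block_mat (?A * ?B + (v (2*k) \<cdot>\<^sub>m 1\<^sub>m (2^k)) * (w (2*k+1) \<cdot>\<^sub>m 1\<^sub>m (2^k)))
       (?A * (w (2*k) \<cdot>\<^sub>m 1\<^sub>m (2^k)) + (v (2*k) \<cdot>\<^sub>m 1\<^sub>m (2^k)) * (- ?B))
       ((v (2*k+1) \<cdot>\<^sub>m 1\<^sub>m (2^k)) * ?B + (- ?A) * (w (2*k+1) \<cdot>\<^sub>m 1\<^sub>m (2^k)))
       ((v (2*k+1) \<cdot>\<^sub>m 1\<^sub>m (2^k)) * (w (2*k) \<cdot>\<^sub>m 1\<^sub>m (2^k)) + (- ?A) * (- ?B))"
    unfolding spin_block.simps
    by (rule mult_four_block_mat[of _ "2^k" "2^k" _ "2^k" _ "2^k" _ _ "2^k" _ "2^k"]) simp_all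
  also have "\<dots> = ?r"
  proof (rule cong_four_block_mat)
    show "?A * ?B + (v (2*k) \<cdot>\<^sub>m 1\<^sub>m (2^k)) * (w (2*k+1) \<cdot>\<^sub>m 1\<^sub>m (2^k)) =
      ?A * ?B + (v (2*k) * w (2*k+1)) \<cdot>\<^sub>m 1\<^sub>m (2^k)"
      by (subst mult_scalar_left[of _ _ "2^k"]) (auto intro!: eq_matI)
    show "?A * (w (2*k) \<cdot>\<^sub>m 1\<^sub>m (2^k)) + (v (2*k) \<cdot>\<^sub>m 1\<^sub>m (2^k)) * (- ?B) =
      w (2*k) \<cdot>\<^sub>m ?A + (- v (2*k)) \<cdot>\<^sub>m ?B"
      by (subst mult_scalar_left[of _ _ "2^k"], simp, subst mult_scalar_right[of _ "2^k"], simp)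
        (use c in \<open>auto intro!: eq_matI\<close>)
    show "(v (2*k+1) \<cdot>\<^sub>m 1\<^sub>m (2^k)) * ?B + (- ?A) * (w (2*k+1) \<cdot>\<^sub>m 1\<^sub>m (2^k)) =
      v (2*k+1) \<cdot>\<^sub>m ?B + (- w (2*k+1)) \<cdot>\<^sub>m ?A"
      by (subst mult_scalar_left[of _ _ "2^k"], simp, subst mult_scalar_right[of _ "2^k"], simp)
        (use c in \<open>auto intro!: eq_matI\<close>)
    have "(- ?A) * (- ?B) = ?A * ?B"
      using c by (simp add: m)
    moreover have "(v (2*k+1) \<cdot>\<^sub>m 1\<^sub>m (2^k)) * (w (2*k) \<cdot>\<^sub>m 1\<^sub>m (2^k)) =
        (v (2*k+1) * w (2*k)) \<cdot>\<^sub>m 1\<^sub>m (2^k)"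
      by (subst mult_scalar_left[of _ _ "2^k"]) (auto intro!: eq_matI)
    moreover have "(v (2*k+1) * w (2*k)) \<cdot>\<^sub>m 1\<^sub>m (2^k) + ?A * ?B =
        ?A * ?B + (v (2*k+1) * w (2*k)) \<cdot>\<^sub>m 1\<^sub>m (2^k)"
      by (rule comm_add_mat[of _ "2^k" "2^k"]) auto
    ultimately show "(v (2*k+1) \<cdot>\<^sub>m 1\<^sub>m (2^k)) * (w (2*k) \<cdot>\<^sub>m 1\<^sub>m (2^k)) + (- ?A) * (- ?B) =
      ?A * ?B + (v (2*k+1) * w (2*k)) \<cdot>\<^sub>m 1\<^sub>m (2^k)"
      by simp
  qed
  finally show ?thesis .
qed

lemma spin_block_anticommute:
  "spin_block z k v * spin_block z' k w + spin_block z' k w * spin_block z k v =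
     ((\<Sum>r<k. v (2*r) * w (2*r+1) + v (2*r+1) * w (2*r)) + 2 * z * z') \<cdot>\<^sub>m 1\<^sub>m (2 ^ k)"
proof (induction k)
  case 0
  show ?case by (rule eq_matI) (auto simp: scalar_prod_def)
next
  case (Suc k)
  let ?A = "spin_block z k v" and ?B = "spin_block z' k w"
  let ?S = "(\<Sum>r<k. v (2*r) * w (2*r+1) + v (2*r+1) * w (2*r)) + 2 * z * z'"
  have c: "?A \<in> carrier_mat (2^k) (2^k)" "?B \<in> carrier_mat (2^k) (2^k)" by simp_all
  have ent: "(?A * ?B) $$ (i, j) + (?B * ?A) $$ (i, j) = (?S \<cdot>\<^sub>m 1\<^sub>m (2 ^ k)) $$ (i, j)"
    if "i < 2^k" "j < 2^k" for i j
  proof -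
    have "(?A * ?B) $$ (i, j) + (?B * ?A) $$ (i, j) = (?A * ?B + ?B * ?A) $$ (i, j)"
      using that carrier_matD[OF c(1)] carrier_matD[OF c(2)] by (simp del: index_mult_mat(1))
    then show ?thesis unfolding Suc.IH .
  qed
  have diag: "(?A * ?B + x \<cdot>\<^sub>m 1\<^sub>m (2^k)) + (?B * ?A + y \<cdot>\<^sub>m 1\<^sub>m (2^k)) = e \<cdot>\<^sub>m 1\<^sub>m (2^k)"
    if "?S + x + y = e" for x y e
  proof (rule eq_matI)
    fix i j assume "i < dim_row (e \<cdot>\<^sub>m 1\<^sub>m (2^k))" "j < dim_col (e \<cdot>\<^sub>m 1\<^sub>m (2^k))"
    then have ij: "i < 2^k" "j < 2^k" by auto
    show "((?A * ?B + x \<cdot>\<^sub>m 1\<^sub>m (2^k)) + (?B * ?A + y \<cdot>\<^sub>m 1\<^sub>m (2^k))) $$ (i, j) =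
        (e \<cdot>\<^sub>m 1\<^sub>m (2^k)) $$ (i, j)"
      using ent[OF ij] ij c that by (auto simp del: index_mult_mat(1) simp: algebra_simps)
  qed (use c in auto)
  have "spin_block z (Suc k) v * spin_block z' (Suc k) w +
      spin_block z' (Suc k) w * spin_block z (Suc k) v =
      four_block_mat
       ((?A * ?B + (v (2*k) * w (2*k+1)) \<cdot>\<^sub>m 1\<^sub>m (2^k)) + (?B * ?A + (w (2*k) * v (2*k+1)) \<cdot>\<^sub>m 1\<^sub>m (2^k)))
       ((w (2*k) \<cdot>\<^sub>m ?A + (- v (2*k)) \<cdot>\<^sub>m ?B) + (v (2*k) \<cdot>\<^sub>m ?B + (- w (2*k)) \<cdot>\<^sub>m ?A))
       ((v (2*k+1) \<cdot>\<^sub>m ?B + (- w (2*k+1)) \<cdot>\<^sub>m ?A) + (w (2*k+1) \<cdot>\<^sub>m ?A + (- v (2*k+1)) \<cdot>\<^sub>m ?B))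
       ((?A * ?B + (v (2*k+1) * w (2*k)) \<cdot>\<^sub>m 1\<^sub>m (2^k)) + (?B * ?A + (w (2*k+1) * v (2*k)) \<cdot>\<^sub>m 1\<^sub>m (2^k)))"
    unfolding spin_block_mult 
    by (rule add_four_block_mat[of _ "2^k" "2^k" _ "2^k" _ "2^k"]) (use c in auto)
  also have "\<dots> = four_block_mat
       ((?S + v (2*k) * w (2*k+1) + v (2*k+1) * w (2*k)) \<cdot>\<^sub>m 1\<^sub>m (2^k)) (0\<^sub>m (2^k) (2^k)) (0\<^sub>m (2^k) (2^k))
       ((?S + v (2*k) * w (2*k+1) + v (2*k+1) * w (2*k)) \<cdot>\<^sub>m 1\<^sub>m (2^k))"
  proof (rule cong_four_block_mat)
    show "(?A * ?B + (v (2*k) * w (2*k+1)) \<cdot>\<^sub>m 1\<^sub>m (2^k)) + (?B * ?A + (w (2*k) * v (2*k+1)) \<cdot>\<^sub>m 1\<^sub>m (2^k))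
       = (?S + v (2*k) * w (2*k+1) + v (2*k+1) * w (2*k)) \<cdot>\<^sub>m 1\<^sub>m (2^k)"
      by (rule diag) (simp add: algebra_simps)
    show "(?A * ?B + (v (2*k+1) * w (2*k)) \<cdot>\<^sub>m 1\<^sub>m (2^k)) + (?B * ?A + (w (2*k+1) * v (2*k)) \<cdot>\<^sub>m 1\<^sub>m (2^k))
       = (?S + v (2*k) * w (2*k+1) + v (2*k+1) * w (2*k)) \<cdot>\<^sub>m 1\<^sub>m (2^k)"
      by (rule diag) (simp add: algebra_simps)
  qed (use c in \<open>auto intro!: eq_matI\<close>)
  also have "\<dots> = ((\<Sum>r<Suc k. v (2*r) * w (2*r+1) + v (2*r+1) * w (2*r)) + 2 * z * z') \<cdot>\<^sub>m 1\<^sub>m (2 ^ Suc k)"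
    by (simp add: scalar_four_block[symmetric] mult_2 algebra_simps)
  finally show ?case .
qed

text \<open>
  Not a special case of \<open>spin_block_anticommute\<close>, which for \<open>v = w\<close> only gives twice this identity.
\<close>

lemma spin_block_square:
  "spin_block z k v * spin_block z k v = ((\<Sum>r<k. v (2*r) * v (2*r+1)) + z\<^sup>2) \<cdot>\<^sub>m 1\<^sub>m (2 ^ k)"
proof (induction k)
  case 0
  show ?case by (rule eq_matI) (auto simp: scalar_prod_def power2_eq_square)
next
  case (Suc k)
  let ?A = "spin_block z k v"
  let ?S = "(\<Sum>r<k. v (2*r) * v (2*r+1)) + z\<^sup>2"
  have c: "?A \<in> carrier_mat (2^k) (2^k)" by simp
  have "spin_block z (Suc k) v * spin_block z (Suc k) v = four_block_mat
       ((?S + v (2*k) * v (2*k+1)) \<cdot>\<^sub>m 1\<^sub>m (2^k)) (0\<^sub>m (2^k) (2^k)) (0\<^sub>m (2^k) (2^k))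
       ((?S + v (2*k) * v (2*k+1)) \<cdot>\<^sub>m 1\<^sub>m (2^k))"
    unfolding spin_block_mult Suc.IH
    by (rule cong_four_block_mat) (use c in \<open>auto intro!: eq_matI simp: algebra_simps\<close>)
  also have "\<dots> = ((\<Sum>r<Suc k. v (2*r) * v (2*r+1)) + z\<^sup>2) \<cdot>\<^sub>m 1\<^sub>m (2 ^ Suc k)"
    by (simp add: scalar_four_block[symmetric] mult_2 algebra_simps)
  finally show ?case .
qed

lemma spin_anticommute:
  "spin \<nu> v * spin \<nu> w + spin \<nu> w * spin \<nu> v = polar \<nu> v w \<cdot>\<^sub>m 1\<^sub>m (2 ^ \<nu>)"
  by (simp only: spin_def polar_def spin_block_anticommute)

lemma spin_square: "spin \<nu> v * spin \<nu> v = quad \<nu> v \<cdot>\<^sub>m 1\<^sub>m (2 ^ \<nu>)"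
  by (simp only: spin_def quad_def spin_block_square)

lemma mat_trace_add:
  "A \<in> carrier_mat k k \<Longrightarrow> B \<in> carrier_mat k k \<Longrightarrow> mat_trace (A + B) = mat_trace A + mat_trace B"
  by (auto simp: mat_trace_def sum.distrib)

lemma mat_trace_smult: "A \<in> carrier_mat k k \<Longrightarrow> mat_trace (c \<cdot>\<^sub>m A) = c * mat_trace A"
  by (auto simp: mat_trace_def sum_distrib_left)

lemma mat_trace_mult:
  assumes "A \<in> carrier_mat k k" "B \<in> carrier_mat k k"
  shows "mat_trace (A * B) = (\<Sum>i<k. \<Sum>j<k. A $$ (i, j) * B $$ (j, i))"
  using assms by (auto simp: mat_trace_def scalar_prod_def atLeast0LessThan intro!: sum.cong)

lemma mat_trace_commute:
  assumes "A \<in> carrier_mat k k" "B \<in> carrier_mat k k"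
  shows "mat_trace (A * B) = mat_trace (B * A)"
  unfolding mat_trace_mult[OF assms] mat_trace_mult[OF assms(2,1)]
  by (subst sum.swap) (simp add: mult.commute)

lemmas square_mat_simps =
  mult_carrier_mat[where nr = k and n = k and nc = k for k]
  assoc_mult_mat[where n\<^sub>1 = k and n\<^sub>2 = k and n\<^sub>3 = k and n\<^sub>4 = k for k]
  add_mult_distrib_mat[where nr = k and n = k and nc = k for k]
  mult_add_distrib_mat[where nr = k and n = k and nc = k for k]

lemma spin_trace_swap:
  "spin_trace \<nu> (us @ v # w # ys) + spin_trace \<nu> (us @ w # v # ys) =
     polar \<nu> v w * spin_trace \<nu> (us @ ys)"
proof -
  let ?N = "2 ^ \<nu> :: nat"
  let ?U = "spin_prod \<nu> us" and ?Y = "spin_prod \<nu> ys" and ?v = "spin \<nu> v" and ?w = "spin \<nu> w"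
  have c: "?U \<in> carrier_mat ?N ?N" "?Y \<in> carrier_mat ?N ?N" "?v \<in> carrier_mat ?N ?N"
    "?w \<in> carrier_mat ?N ?N" by simp_all
  have "?U * (?v * (?w * ?Y)) + ?U * (?w * (?v * ?Y)) = ?U * (?v * ?w + ?w * ?v) * ?Y"
    using c by (simp add: square_mat_simps[where k = ?N])
  also have "\<dots> = polar \<nu> v w \<cdot>\<^sub>m (?U * ?Y)"
    unfolding spin_anticommute mult_scalar_right[OF c(1)] using c by (metis mult_smult_assoc_mat)
  finally show ?thesis
    using c by (simp add: spin_trace_def spin_prod_append mat_trace_smult[of _ ?N]
        square_mat_simps[where k = ?N] flip: mat_trace_add[of _ ?N])
qed

lemma spin_trace_square:
  "spin_trace \<nu> (us @ v # v # ys) = quad \<nu> v * spin_trace \<nu> (us @ ys)"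
proof -
  let ?N = "2 ^ \<nu> :: nat"
  let ?U = "spin_prod \<nu> us" and ?Y = "spin_prod \<nu> ys" and ?v = "spin \<nu> v"
  have c: "?U \<in> carrier_mat ?N ?N" "?Y \<in> carrier_mat ?N ?N" "?v \<in> carrier_mat ?N ?N" by simp_all
  have "?U * (?v * (?v * ?Y)) = ?U * (?v * ?v) * ?Y"
    using c by (simp add: square_mat_simps[where k = ?N])
  also have "\<dots> = quad \<nu> v \<cdot>\<^sub>m (?U * ?Y)"
    unfolding spin_square mult_scalar_right[OF c(1)] using c by (metis mult_smult_assoc_mat)
  finally show ?thesis
    using c by (simp add: spin_trace_def spin_prod_append mat_trace_smult[of _ ?N]
        square_mat_simps[where k = ?N])
qed

lemma spin_trace_rotate: "spin_trace \<nu> (us @ ys) = spin_trace \<nu> (ys @ us)"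
  unfolding spin_trace_def spin_prod_append by (rule mat_trace_commute[of _ "2 ^ \<nu>"]) simp_all

lemma spin_block_expand:
  assumes "k \<le> \<nu>" "i < 2 ^ k" "j < 2 ^ k"
  shows "spin_block (v (2*\<nu>)) k v $$ (i, j) =
    (\<Sum>s<2*\<nu>+1. v s * spin_block (basis_vec s (2*\<nu>)) k (basis_vec s) $$ (i, j))"
  using assms
proof (induction k arbitrary: i j)
  case 0
  then show ?case by (simp add: basis_vec_def if_distrib[of "\<lambda>x. _ * x"] cong: if_cong)
next
  case (Suc k)
  have ext: "v t = (\<Sum>s<2*\<nu>+1. v s * basis_vec s t)" if "t \<le> 2 * \<nu>" for t
    using that by (simp add: basis_vec_def if_distrib[of "\<lambda>x. _ * x"] cong: if_cong)
  have car: "dim_row (spin_block z k u) = 2^k" "dim_col (spin_block z k u) = 2^k" for z :: 'a and u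
    using spin_block_carrier[of z k u] by auto
  have e1: "v (2*k) = (\<Sum>s<2*\<nu>+1. v s * basis_vec s (2*k))"
    and e2: "v (2*k+1) = (\<Sum>s<2*\<nu>+1. v s * basis_vec s (2*k+1))"
    by (rule ext; use Suc.prems(1) in simp)+
  show ?case
  proof (cases "i < 2^k"; cases "j < 2^k")
    assume ij: "i < 2^k" "j < 2^k"
    then show ?thesis using Suc.IH[OF _ ij] Suc.prems by (simp add: car del: sum.lessThan_Suc)
  next
    assume ij: "i < 2^k" "\<not> j < 2^k"
    then show ?thesis using Suc.prems e1 by (cases "i = j - 2^k") (simp_all add: car del: sum.lessThan_Suc)
  next
    assume ij: "\<not> i < 2^k" "j < 2^k"
    then show ?thesis using Suc.prems e2 by (cases "j = i - 2^k") (simp_all add: car del: sum.lessThan_Suc)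
  next
    assume ij: "\<not> i < 2^k" "\<not> j < 2^k"
    then show ?thesis using Suc.IH[of "i - 2^k" "j - 2^k"] Suc.prems
      by (simp add: car sum_negf del: sum.lessThan_Suc)
  qed
qed

text \<open>
  Multilinearity in the form that is used throughout: any argument may be expanded in basis vectors.
\<close>

lemma spin_trace_expand:
  "spin_trace \<nu> (us @ v # ys) = (\<Sum>s<2*\<nu>+1. v s * spin_trace \<nu> (us @ basis_vec s # ys))"
proof -
  let ?N = "2 ^ \<nu> :: nat" and ?M = "spin_prod \<nu> (ys @ us)"
  have tr: "spin_trace \<nu> (us @ u # ys) = (\<Sum>i<?N. \<Sum>j<?N. spin \<nu> u $$ (i, j) * ?M $$ (j, i))" for u
  proof -
    have "spin_trace \<nu> (us @ u # ys) = mat_trace (spin \<nu> u * ?M)"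
      using spin_trace_rotate[of \<nu> us "u # ys"] by (simp add: spin_trace_def)
    then show ?thesis by (simp add: mat_trace_mult[of _ ?N])
  qed
  have "spin_trace \<nu> (us @ v # ys) = (\<Sum>i<?N. \<Sum>j<?N. \<Sum>s<2*\<nu>+1. v s * (spin \<nu> (basis_vec s) $$ (i, j)
      * ?M $$ (j, i)))"
    unfolding tr spin_def
    by (intro sum.cong refl, subst spin_block_expand[OF le_refl])
      (simp_all add: sum_distrib_right mult.assoc del: sum.lessThan_Suc Suc_eq_plus1 add_2_eq_Suc')
  also have "\<dots> = (\<Sum>s<2*\<nu>+1. v s * (\<Sum>i<?N. \<Sum>j<?N. spin \<nu> (basis_vec s) $$ (i, j) * ?M $$ (j, i)))"
    unfolding sum_distrib_left
    by (subst (2) sum.swap, subst sum.swap) (rule refl)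
  finally show ?thesis by (simp only: tr)
qed

lemma spin_trace_Nil: "spin_trace \<nu> [] = 2 ^ \<nu>"
  by (simp add: spin_trace_def mat_trace_def)

context comm_ring_hom
begin

lemma map_spin_block: "map_mat hom (spin_block z k v) = spin_block (hom z) k (\<lambda>r. hom (v r))"
proof (induction k)
  case 0
  show ?case by (rule eq_matI) (auto simp: hom_distribs)
next
  case (Suc k)
  have e: "map_mat hom (c \<cdot>\<^sub>m 1\<^sub>m (2 ^ k)) = hom c \<cdot>\<^sub>m 1\<^sub>m (2 ^ k)" for c
    by (rule eq_matI) (auto simp: hom_distribs)
  have "map_mat hom (- spin_block z k v) = - map_mat hom (spin_block z k v)"
    by (rule eq_matI) (auto simp: hom_distribs)
  then show ?case
    by (simp add: Suc.IH e map_four_block_mat[of _ "2^k" "2^k" _ "2^k" _ "2^k"])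
qed

lemma map_spin_prod: "map_mat hom (spin_prod \<nu> vs) = spin_prod \<nu> (map (\<lambda>v r. hom (v r)) vs)"
proof (induction vs)
  case Nil
  show ?case by (simp add: mat_hom_one)
next
  case (Cons v vs)
  then show ?case
    by (simp add: mat_hom_mult[of _ "2^\<nu>" "2^\<nu>" _ "2^\<nu>"] spin_def map_spin_block)
qed

lemma hom_spin_trace: "hom (spin_trace \<nu> vs) = spin_trace \<nu> (map (\<lambda>v r. hom (v r)) vs)"
  using carrier_matD[OF spin_prod_carrier[of \<nu> vs]]
  by (simp add: spin_trace_def mat_trace_def hom_distribs flip: map_spin_prod)

end

text \<open>
  With vanishing planes the matrix is diagonal with entries \<open>z\<close> and \<open>- z\<close>. The hypothesis \<open>- z =
      z\<close> covers both
  uses: \<open>z = 0\<close>, and \<open>z = 1\<close> in characteristic 2.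
\<close>

lemma spin_block_eq_scalar:
  assumes "\<And>r. r < 2 * k \<Longrightarrow> v r = 0" and "- z = z"
  shows "spin_block z k v = z \<cdot>\<^sub>m 1\<^sub>m (2 ^ k)"
  using assms
proof (induction k)
  case 0
  then show ?case by simp
next
  case (Suc k)
  have "spin_block z k v = z \<cdot>\<^sub>m 1\<^sub>m (2 ^ k)" "v (2 * k) = 0" "v (2 * k + 1) = 0"
    using Suc by simp_all
  then show ?case
    using Suc.prems(2) by (auto intro!: eq_matI)
qed

lemma spin_trace_drop_z:
  assumes "(1 :: 'a::comm_ring_1) + 1 = 0"
  shows "spin_trace \<nu> (us @ (basis_vec (2*\<nu>) :: nat \<Rightarrow> 'a) # ys) = spin_trace \<nu> (us @ ys)"
proof -
  have "- (1 :: 'a) = 1" using assms by (simp add: eq_neg_iff_add_eq_0 minus_equation_iff)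
  then have "spin \<nu> (basis_vec (2*\<nu>) :: nat \<Rightarrow> 'a) = 1 \<cdot>\<^sub>m 1\<^sub>m (2 ^ \<nu>)"
    unfolding spin_def by (subst spin_block_eq_scalar) (auto simp: basis_vec_def)
  then have "spin \<nu> (basis_vec (2*\<nu>) :: nat \<Rightarrow> 'a) * spin_prod \<nu> ys = spin_prod \<nu> ys"
    by (simp add: mult_scalar_left[of _ "2^\<nu>" "2^\<nu>"]) (auto intro!: eq_matI)
  then show ?thesis by (simp add: spin_trace_def spin_prod_append)
qed

lemma char2_sum_symmetric:
  fixes f :: "nat \<Rightarrow> nat \<Rightarrow> 'a::comm_ring_1"
  assumes "(1 :: 'a) + 1 = 0" and "\<And>i j. f i j = f j i"
  shows "(\<Sum>i<N. \<Sum>j<N. f i j) = (\<Sum>i<N. f i i)"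
proof (induction N)
  case (Suc N)
  have "(\<Sum>j<N. f j N) + (\<Sum>j<N. f N j) = (1 + 1) * (\<Sum>j<N. f j N)"
    by (subst (2) assms(2)) (simp add: algebra_simps)
  then show ?case using Suc assms(1) by (simp add: sum.distrib add.assoc)
qed simp

text \<open>
  The Frobenius identity \<open>tr(M\<^sup>2) = tr(M)\<^sup>2\<close> of characteristic 2: the off-diagonal terms cancel in pairs on
  both sides.
\<close>

lemma spin_trace_double:
  fixes vs :: "(nat \<Rightarrow> 'a::comm_ring_1) list"
  assumes "(1 :: 'a) + 1 = 0"
  shows "spin_trace \<nu> (vs @ vs) = (spin_trace \<nu> vs)\<^sup>2"
proof -
  let ?N = "2 ^ \<nu> :: nat" and ?M = "spin_prod \<nu> vs"
  have "spin_trace \<nu> (vs @ vs) = (\<Sum>i<?N. \<Sum>j<?N. ?M $$ (i, j) * ?M $$ (j, i))"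
    by (simp add: spin_trace_def spin_prod_append mat_trace_mult[of _ ?N])
  also have "\<dots> = (\<Sum>i<?N. ?M $$ (i, i) * ?M $$ (i, i))"
    by (rule char2_sum_symmetric[OF assms]) (rule mult.commute)
  also have "\<dots> = (\<Sum>i<?N. \<Sum>j<?N. ?M $$ (i, i) * ?M $$ (j, j))"
    by (rule char2_sum_symmetric[OF assms, symmetric]) (rule mult.commute)
  also have "\<dots> = (spin_trace \<nu> vs)\<^sup>2"
    using carrier_matD[OF spin_prod_carrier[of \<nu> vs]]
    by (simp add: spin_trace_def mat_trace_def power2_eq_square sum_product)
  finally show ?thesis .
qed

text \<open>
  A vector without components in the last plane acts block diagonally, by \<open>\<rho>(v)\<close> and \<open>- \<rho>(v)\<close>.
\<close>

lemma spin_block_prod_Suc: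
  assumes "\<forall>v\<in>set vs. v (2 * k) = 0 \<and> v (2 * k + 1) = 0"
  shows "spin_block_prod t (Suc k) vs =
    four_block_mat (spin_block_prod t k vs) (0\<^sub>m (2^k) (2^k)) (0\<^sub>m (2^k) (2^k))
      ((- 1) ^ length vs \<cdot>\<^sub>m spin_block_prod t k vs)"
  using assms
proof (induction vs)
  case Nil
  show ?case by (auto intro!: eq_matI)
next
  case (Cons v vs)
  let ?M = "spin_block_prod t k vs" and ?S = "spin_block (v t) k v" and ?O = "0\<^sub>m (2^k) (2^k)"
  have v: "v (2 * k) = 0" "v (Suc (2 * k)) = 0" using Cons.prems by auto
  have d: "dim_row ?M = 2^k" "dim_col ?M = 2^k"
    using carrier_matD[OF spin_block_prod_carrier[of t k vs]] by auto
  have s: "spin_block (v t) (Suc k) v = four_block_mat ?S ?O ?O (- ?S)"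
    by (rule eq_matI) (auto simp: v)
  have "spin_block_prod t (Suc k) (v # vs) =
      four_block_mat ?S ?O ?O (- ?S) * four_block_mat ?M ?O ?O ((- 1) ^ length vs \<cdot>\<^sub>m ?M)"
    using Cons s by simp
  also have "\<dots> = four_block_mat (?S * ?M + ?O * ?O) (?S * ?O + ?O * ((- 1) ^ length vs \<cdot>\<^sub>m ?M))
      (?O * ?M + (- ?S) * ?O) (?O * ?O + (- ?S) * ((- 1) ^ length vs \<cdot>\<^sub>m ?M))"
    by (rule mult_four_block_mat[of _ "2^k" "2^k" _ "2^k" _ "2^k" _ _ "2^k" _ "2^k"]) simp_all
  also have "\<dots> = four_block_mat (?S * ?M) ?O ?O ((- 1) ^ length (v # vs) \<cdot>\<^sub>m (?S * ?M))"
    by (rule cong_four_block_mat) (auto intro!: eq_matI simp: d)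
  finally show ?case by simp
qed

lemma mat_trace_corner_block:
  fixes A :: "'a::comm_ring_1 mat"
  assumes "A \<in> carrier_mat N N"
  shows "mat_trace (four_block_mat A (0\<^sub>m N N) (0\<^sub>m N N) (0\<^sub>m N N)) = mat_trace A"
proof -
  let ?F = "four_block_mat A (0\<^sub>m N N) (0\<^sub>m N N) (0\<^sub>m N N)"
  note d = carrier_matD[OF assms]
  have "(\<Sum>i<N + N. ?F $$ (i, i)) = (\<Sum>i<N. ?F $$ (i, i))"
    by (rule sum.mono_neutral_right) (auto simp: d)
  then show ?thesis by (simp add: mat_trace_def d)
qed

text \<open>
  In the last plane \<open>x y\<close> acts as the projection onto the upper left block, so the trace of the word
  reduces to that of the shorter word.
\<close>

lemma spin_block_full_trace:
  assumes "2 * k \<le> t"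
  shows "mat_trace (spin_block_prod t k
    (map basis_vec [0..<2*k] @ replicate j (basis_vec t :: nat \<Rightarrow> 'a::comm_ring_1))) = 1"
  using assms
proof (induction k)
  case 0
  have "spin_block_prod t 0 (replicate j (basis_vec t :: nat \<Rightarrow> 'a)) = 1\<^sub>m 1"
    by (induction j) (auto simp: basis_vec_def)
  then show ?case by (simp add: mat_trace_def)
next
  case (Suc k)
  let ?b = "basis_vec :: nat \<Rightarrow> nat \<Rightarrow> 'a" and ?I = "1\<^sub>m (2^k) :: 'a mat" and ?O = "0\<^sub>m (2^k) (2^k)"
  let ?us = "map ?b [0..<2*k]" and ?zs = "replicate j (?b t)"
  let ?U = "spin_block_prod t k ?us" and ?Z = "spin_block_prod t k ?zs"
  let ?s = "(- 1) ^ j :: 'a"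
  have d: "dim_row ?U = 2^k" "dim_col ?U = 2^k" "dim_row ?Z = 2^k" "dim_col ?Z = 2^k"
    using carrier_matD[OF spin_block_prod_carrier[of t k ?us]]
      carrier_matD[OF spin_block_prod_carrier[of t k ?zs]] by auto
  have U: "spin_block_prod t (Suc k) ?us = four_block_mat ?U ?O ?O ?U"
  proof -
    have "even (length ?us)" by simp
    then have "(- 1 :: 'a) ^ length ?us \<cdot>\<^sub>m ?U = ?U" by (auto intro!: eq_matI)
    then show ?thesis by (subst spin_block_prod_Suc) (auto simp: basis_vec_def)
  qed
  have Z: "spin_block_prod t (Suc k) ?zs = four_block_mat ?Z ?O ?O (?s \<cdot>\<^sub>m ?Z)"
    using Suc.prems by (subst spin_block_prod_Suc) (auto simp: basis_vec_def)
  have zero: "spin_block (?b s t) k (?b s) = 0 \<cdot>\<^sub>m ?I" if "2 * k \<le> s" "s < t" for s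
    using that by (subst spin_block_eq_scalar) (auto simp: basis_vec_def)
  have x: "spin_block (?b (2*k) t) (Suc k) (?b (2*k)) = four_block_mat ?O ?I ?O ?O"
    unfolding spin_block.simps using Suc.prems
    by (subst zero, simp, simp, subst zero, simp, simp)
      (rule cong_four_block_mat, auto intro!: eq_matI simp: basis_vec_def)
  have y: "spin_block (?b (2*k+1) t) (Suc k) (?b (2*k+1)) = four_block_mat ?O ?O ?I ?O"
    unfolding spin_block.simps using Suc.prems
    by (subst zero, simp, simp, subst zero, simp, simp)
      (rule cong_four_block_mat, auto intro!: eq_matI simp: basis_vec_def)
  have YZ: "four_block_mat ?O ?O ?I ?O * four_block_mat ?Z ?O ?O (?s \<cdot>\<^sub>m ?Z) = four_block_mat ?O ?O ?Z ?O"
    by (subst mult_four_block_mat[of _ "2^k" "2^k" _ "2^k" _ "2^k" _ _ "2^k" _ "2^k"])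
      (auto simp: d intro!: cong_four_block_mat eq_matI)
  have XYZ: "four_block_mat ?O ?I ?O ?O * four_block_mat ?O ?O ?Z ?O = four_block_mat ?Z ?O ?O ?O"
    by (subst mult_four_block_mat[of _ "2^k" "2^k" _ "2^k" _ "2^k" _ _ "2^k" _ "2^k"])
      (auto simp: d intro!: cong_four_block_mat eq_matI)
  have UXYZ: "four_block_mat ?U ?O ?O ?U * four_block_mat ?Z ?O ?O ?O = four_block_mat (?U * ?Z) ?O ?O ?O"
    by (subst mult_four_block_mat[of _ "2^k" "2^k" _ "2^k" _ "2^k" _ _ "2^k" _ "2^k"])
      (auto simp: d intro!: cong_four_block_mat eq_matI)
  have word: "map ?b [0..<2 * Suc k] @ ?zs = ?us @ ?b (2*k) # ?b (2*k+1) # ?zs"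
    by simp
  have "mat_trace (spin_block_prod t (Suc k) (map ?b [0..<2 * Suc k] @ ?zs)) =
      mat_trace (four_block_mat (?U * ?Z) ?O ?O ?O)"
    unfolding word spin_block_prod_append spin_block_prod_simps U x y Z YZ XYZ UXYZ ..
  also have "\<dots> = mat_trace (?U * ?Z)"
    by (rule mat_trace_corner_block[of _ "2^k"]) (simp add: square_mat_simps[where k = "2^k"])
  also have "\<dots> = 1"
    using Suc by (simp add: spin_block_prod_append)
  finally show ?case .
qed

lemma spin_trace_full_word:
  "spin_trace \<nu> (map basis_vec [0..<2*\<nu>] @ replicate j (basis_vec (2*\<nu>))) = 1"
  using spin_block_full_trace[of \<nu> "2*\<nu>" j, where 'a = 'a]
  by (simp add: spin_trace_def spin_prod_def)

section \<open>Functions on words with Clifford relations\<close>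

text \<open>
  Adjacent transpositions generate all rearrangements of a list. The invariant of the induction on the
  target list is that an arbitrary prefix has already been put in place.
\<close>

lemma mset_eq_adjacent_swaps:
  assumes "mset xs = mset ys" "P xs"
    and swap: "\<And>us a b vs. mset (us @ a # b # vs) = mset xs \<Longrightarrow> P (us @ a # b # vs) \<Longrightarrow> P (us @ b # a # vs)"
  shows "P ys"
proof -
  have front: "P (us @ y # as @ bs)"
    if "P (us @ as @ y # bs)" "mset (us @ as @ y # bs) = mset xs" for us as bs y
    using that
  proof (induction as arbitrary: bs rule: rev_induct)
    case (snoc a as)
    have "P ((us @ as) @ y # a # bs)"
      by (rule swap) (use snoc.prems in simp_all)
    then show ?case using snoc.IH[of "a # bs"] snoc.prems by (simp add: add_mset_commute)
  qed simp
  have "P (us @ zs')" if "P (us @ zs)" "mset zs = mset zs'" "mset (us @ zs) = mset xs" for us zs zs'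
    using that
  proof (induction zs' arbitrary: us zs)
    case (Cons y zs')
    then have "y \<in> set zs" by (metis list.set_intros(1) mset_eq_setD)
    then obtain as bs where zs: "zs = as @ y # bs" by (meson split_list)
    have "P (us @ y # as @ bs)"
      using Cons.prems unfolding zs by (intro front) auto
    then show ?case
      using Cons.IH[of "us @ [y]" "as @ bs"] Cons.prems zs by auto
  qed simp
  from this[of "[]"] assms show ?thesis by auto
qed

text \<open>
  Sorting a word preserves the vanishing of \<open>F\<close>, and two equal letters can be made adjacent.
\<close>

lemma alternating_words_vanish:
  fixes F :: "'b::linorder list \<Rightarrow> 'a::comm_ring_1"
  assumes anti: "\<And>us a b ys. length (us @ a # b # ys) = m \<Longrightarrow> set (us @ a # b # ys) \<subseteq> L \<Longrightarrow>
      F (us @ b # a # ys) = - F (us @ a # b # ys)"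
    and rep: "\<And>us a ys. length (us @ a # a # ys) = m \<Longrightarrow> set (us @ a # a # ys) \<subseteq> L \<Longrightarrow>
      F (us @ a # a # ys) = 0"
    and srt: "\<And>w. length w = m \<Longrightarrow> set w \<subseteq> L \<Longrightarrow> distinct w \<Longrightarrow> sorted w \<Longrightarrow> F w = 0"
    and w: "length w = m" "set w \<subseteq> L"
  shows "F w = 0"
proof -
  have transfer: "F w = 0" if "F w' = 0" "mset w' = mset w" for w'
  proof (rule mset_eq_adjacent_swaps[where P = "\<lambda>w. F w = 0", OF that(2,1)])
    fix us a b vs
    assume "mset (us @ a # b # vs) = mset w'" "F (us @ a # b # vs) = 0"
    then have "mset (us @ a # b # vs) = mset w" using that(2) by metis
    from mset_eq_length[OF this] mset_eq_setD[OF this]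
    have "length (us @ a # b # vs) = m" "set (us @ a # b # vs) \<subseteq> L" using w by auto
    then have "F (us @ b # a # vs) = - F (us @ a # b # vs)" by (rule anti)
    then show "F (us @ b # a # vs) = 0" using \<open>F (us @ a # b # vs) = 0\<close> by simp
  qed
  show ?thesis
  proof (cases "distinct w")
    case True
    then show ?thesis
      using w by (intro transfer[of "sort w"] srt) auto
  next
    case False
    then obtain as bs cs a where ws: "w = as @ [a] @ bs @ [a] @ cs"
      using not_distinct_decomp by blast
    show ?thesis
      using w ws by (intro transfer[of "[] @ a # a # as @ bs @ cs"] rep[of "[]"]) auto
  qed
qed

lemma polar_commute: "polar \<nu> v w = polar \<nu> w v"
  by (simp add: polar_def algebra_simps)

lemma polar_basis_left:
  fixes v :: "nat \<Rightarrow> 'a::comm_ring_1"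
  assumes "r < \<nu>"
  shows "polar \<nu> (basis_vec (2*r)) v = v (2*r+1)" "polar \<nu> (basis_vec (2*r+1)) v = v (2*r)"
proof -
  have e: "(2*s+1 = 2*r) = False" "(2*r+1 = 2*s) = False" "(2*s = 2*r+1) = False" for s :: nat
    by presburger+
  show "polar \<nu> (basis_vec (2*r)) v = v (2*r+1)" "polar \<nu> (basis_vec (2*r+1)) v = v (2*r)"
    unfolding polar_def basis_vec_def using assms e
    by (simp_all add: if_distrib[where f = "\<lambda>x. x * _"] eq_commute[of r] cong: if_cong)
qed

lemma polar_basis_last: "polar \<nu> (basis_vec (2*\<nu>)) v = 2 * v (2*\<nu>)"
  unfolding polar_def by (simp add: basis_vec_def)

lemma quad_basis: "s < 2 * \<nu> \<Longrightarrow> quad \<nu> (basis_vec s) = 0"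
proof -
  assume "s < 2 * \<nu>"
  moreover have "\<not> (2 * r = s \<and> 2 * r + 1 = s)" for r by simp
  ultimately show ?thesis unfolding quad_def basis_vec_def by (auto intro!: sum.neutral)
qed

text \<open>
  The rules that the trace of a product of basis vectors obeys. They are linear in \<open>F\<close>, which makes
  it possible to compare two such functions by looking at their difference.
\<close>

locale clifford_trace =
  fixes \<nu> :: nat and F :: "nat list \<Rightarrow> 'a::comm_ring_1"
  assumes swap: "set (us @ a # b # ys) \<subseteq> {..2*\<nu>} \<Longrightarrow> F (us @ a # b # ys) + F (us @ b # a # ys) =
      polar \<nu> (basis_vec a) (basis_vec b) * F (us @ ys)"
    and square: "set (us @ a # a # ys) \<subseteq> {..2*\<nu>} \<Longrightarrow>
      F (us @ a # a # ys) = quad \<nu> (basis_vec a) * F (us @ ys)"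
    and rotate: "F (us @ ys) = F (ys @ us)"
begin

lemma move:
  assumes "\<And>c. c \<in> set w \<Longrightarrow> polar \<nu> (basis_vec x) (basis_vec c) = (0 :: 'a)"
    and "set (us @ x # w @ ys) \<subseteq> {..2*\<nu>}"
  shows "F (us @ x # w @ ys) = (- 1) ^ length w * F (us @ w @ x # ys)"
  using assms
proof (induction w arbitrary: us)
  case (Cons c w)
  have "F (us @ x # c # w @ ys) + F (us @ c # x # w @ ys) = 0"
    using swap[of us x c "w @ ys"] Cons.prems by simp
  moreover have "F ((us @ [c]) @ x # w @ ys) = (- 1) ^ length w * F ((us @ [c]) @ w @ x # ys)"
    using Cons.prems by (intro Cons.IH) auto
  ultimately show ?case by (simp add: eq_neg_iff_add_eq_0)
qed simp

lemma polar_basis_zero: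
  assumes "r < \<nu>" "x \<in> {2*r, 2*r+1}" "c \<notin> {2*r, 2*r+1}"
  shows "polar \<nu> (basis_vec x) (basis_vec c) = (0 :: 'a)"
  using assms polar_basis_left[OF assms(1), of "basis_vec c"] by (auto simp: basis_vec_def)

text \<open>
  Insert \<open>x y + y x = 1\<close>. By cyclicity \<open>w y x\<close> has the same value as \<open>x w y\<close>, and \<open>x\<close> anticommutes with all
  of \<open>w\<close>, so the two terms are \<open>F(w x y)\<close> and \<open>(- 1)\<^bsup>|w|\<^esup> F(w x y)\<close>.
\<close>

lemma missing_pair_zero:
  assumes r: "r < \<nu>" and w: "set w \<subseteq> {..2*\<nu>}" "2*r \<notin> set w" "2*r+1 \<notin> set w"
    and odd: "odd (length w) \<or> (1 :: 'a) + 1 = 0"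
  shows "F w = 0"
proof -
  let ?x = "2*r" and ?y = "2*r+1"
  have sub: "set (w @ ?x # ?y # []) \<subseteq> {..2*\<nu>}" using w r by auto
  have "F (w @ [?x, ?y]) + F (w @ [?y, ?x]) = polar \<nu> (basis_vec ?x) (basis_vec ?y) * F (w @ [])"
    by (rule swap[OF sub])
  also have "polar \<nu> (basis_vec ?x) (basis_vec ?y) = (1 :: 'a)"
    by (subst polar_basis_left(1)[OF r]) (simp add: basis_vec_def)
  finally have 1: "F w = F (w @ [?x, ?y]) + F (w @ [?y, ?x])" by simp
  have 2: "F (w @ [?y, ?x]) = F ([] @ ?x # w @ [?y])"
    using rotate[of "w @ [?y]" "[?x]"] by simp
  have 3: "F ([] @ ?x # w @ [?y]) = (- 1) ^ length w * F ([] @ w @ ?x # [?y])"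
  proof (rule move)
    show "polar \<nu> (basis_vec ?x) (basis_vec c) = (0 :: 'a)" if "c \<in> set w" for c
      using that w r by (intro polar_basis_zero[OF r]) auto
  qed (use sub in auto)
  have 4: "(- 1 :: 'a) ^ length w = - 1"
    using odd
  proof
    assume c: "(1 :: 'a) + 1 = 0"
    then have "(- 1 :: 'a) = 1" by (simp add: eq_neg_iff_add_eq_0 minus_equation_iff)
    then show ?thesis by (metis power_one)
  qed simp
  show ?thesis using 1 2 3 4 by simp
qed

text \<open>
  By \<open>x\<^sup>2 = 0\<close> and \<open>x y + y x = 1\<close>, the letter \<open>x\<close> may be replaced
      by \<open>x y x\<close>. Moving the last \<open>x\<close> cyclically
  to the front and then through the remaining letters produces \<open>x x = 0\<close>.
\<close>

lemma unpaired_letter_zero: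
  assumes r: "r < \<nu>" and w: "set w \<subseteq> {..2*\<nu>}" "distinct w" "x \<in> set w" "y \<notin> set w"
    and xy: "(x = 2*r \<and> y = 2*r+1) \<or> (x = 2*r+1 \<and> y = 2*r)"
  shows "F w = 0"
proof -
  obtain w1 w2 where w12: "w = w1 @ x # w2" using w(3) by (meson split_list)
  define u where "u = w2 @ w1"
  have Fw: "F w = F (u @ [x])"
    using rotate[of "w1 @ [x]" w2] by (simp add: w12 u_def)
  have sub: "set ((u @ [x]) @ y # x # []) \<subseteq> {..2*\<nu>}" and nx: "x \<notin> set u" and ny: "y \<notin> set u"
    using w r xy by (auto simp: w12 u_def)
  have xlt: "x < 2 * \<nu>" using xy r by auto
  have pol: "polar \<nu> (basis_vec y) (basis_vec x) = (1 :: 'a)"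
    using xy polar_basis_left[OF r, of "basis_vec x"] by (auto simp: basis_vec_def)
  have sq: "F (u @ x # x # [y]) = 0"
    using square[of u x "[y]"] sub quad_basis[OF xlt, where 'a = 'a] by simp
  have "F ((u @ [x]) @ y # x # []) + F ((u @ [x]) @ x # y # []) = F ((u @ [x]) @ [])"
    using swap[OF sub] pol by simp
  then have "F (u @ [x]) = F (u @ [x, y, x])" using sq by simp
  also have "\<dots> = F ([] @ x # u @ [x, y])" using rotate[of "u @ [x, y]" "[x]"] by simp
  also have "\<dots> = (- 1) ^ length u * F ([] @ u @ x # [x, y])"
  proof (rule move)
    show "polar \<nu> (basis_vec x) (basis_vec c) = (0 :: 'a)" if "c \<in> set u" for c
      using that nx ny xy by (intro polar_basis_zero[OF r]) auto
  qed (use sub in auto)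
  also have "\<dots> = 0" using sq by simp
  finally show ?thesis using Fw by simp
qed

lemma incomplete_word_zero:
  assumes "set w \<subseteq> {..2*\<nu>}" "distinct w" "\<not> {..<2*\<nu>} \<subseteq> set w"
    and "odd (length w) \<or> (1 :: 'a) + 1 = 0"
  shows "F w = 0"
proof -
  obtain s where s: "s < 2 * \<nu>" "s \<notin> set w" using assms(3) by auto
  have r: "s div 2 < \<nu>" using s by auto
  consider "2 * (s div 2) \<notin> set w" "2 * (s div 2) + 1 \<notin> set w"
    | "2 * (s div 2) \<in> set w" "2 * (s div 2) + 1 \<notin> set w"
    | "2 * (s div 2) + 1 \<in> set w" "2 * (s div 2) \<notin> set w"
    using s by (cases "even s") auto
  then show ?thesis
  proof cases
    case 1
    then show ?thesis by (intro missing_pair_zero[OF r assms(1)] assms(4))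
  next
    case 2
    then show ?thesis by (intro unpaired_letter_zero[OF r assms(1,2)]) auto
  next
    case 3
    then show ?thesis by (intro unpaired_letter_zero[OF r assms(1,2)]) auto
  qed
qed

text \<open>
  Induction on the length: if \<open>F\<close> vanishes on shorter words, it is alternating on words without
      \<open>e\<^sub>z\<close>, so only
  increasing words remain. An incomplete increasing word gives 0 by \<open>incomplete_word_zero\<close>, and the
  complete one by hypothesis.
\<close>

lemma char2_vanish:
  assumes two: "(1 :: 'a) + 1 = 0"
    and drop: "\<And>us ys. F (us @ (2*\<nu>) # ys) = F (us @ ys)"
    and full: "F [0..<2*\<nu>] = 0"
    and "set w \<subseteq> {..2*\<nu>}"
  shows "F w = 0"
  using assms(4)
proof (induction w rule: length_induct)
  case (1 w)
  have neg: "- (c :: 'a) = c" for c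
  proof -
    have "c + c = (1 + 1) * c" by (simp add: algebra_simps)
    then have "c + c = 0" using two by simp
    then show ?thesis by (simp add: eq_neg_iff_add_eq_0 minus_equation_iff)
  qed
  show ?case
  proof (cases "2*\<nu> \<in> set w")
    case True
    then obtain us ys where "w = us @ (2*\<nu>) # ys" by (meson split_list)
    then show ?thesis using 1 by (auto simp: drop)
  next
    case False
    have lt: "A \<subseteq> {..<2*\<nu>} \<Longrightarrow> A \<subseteq> {..2*\<nu>}" for A by auto
    from False have sub: "set w \<subseteq> {..<2*\<nu>}" using 1(2) by (auto simp: order_le_less)
    show ?thesis
    proof (rule alternating_words_vanish[where m = "length w" and L = "{..<2*\<nu>}" and F = F])
      fix us a b ys
      assume a: "length (us @ a # b # ys) = length w" "set (us @ a # b # ys) \<subseteq> {..<2*\<nu>}"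
      then have "F (us @ ys) = 0"
        using 1(1)[rule_format, of "us @ ys"] lt by auto
      then have "F (us @ a # b # ys) + F (us @ b # a # ys) = 0"
        using swap[of us a b ys] a lt[OF a(2)] by auto
      then show "F (us @ b # a # ys) = - F (us @ a # b # ys)" by (simp add: eq_neg_iff_add_eq_0 add.commute)
    next
      fix us a ys
      assume a: "length (us @ a # a # ys) = length w" "set (us @ a # a # ys) \<subseteq> {..<2*\<nu>}"
      then have "F (us @ ys) = 0"
        using 1(1)[rule_format, of "us @ ys"] lt by auto
      then show "F (us @ a # a # ys) = 0" using square[of us a ys] a lt[OF a(2)] by auto
    next
      fix w' assume w': "set w' \<subseteq> {..<2*\<nu>}" "distinct w'" "sorted w'"
      show "F w' = 0"
      proof (cases "{..<2*\<nu>} \<subseteq> set w'")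
        case True
        with w'(1) have "set w' = {..<2*\<nu>}" by blast
        then have "w' = [0..<2*\<nu>]"
          using w' by (intro sorted_distinct_set_unique) (simp_all add: lessThan_atLeast0)
        then show ?thesis using full by simp
      next
        case False
        then show ?thesis using w'(2) two lt[OF w'(1)] by (intro incomplete_word_zero) simp_all
      qed
    qed (use sub in auto)
  qed
qed

end

text \<open>
  Multilinearity on lists of length \<open>m\<close>, together with the independence of the coordinates from \<open>n\<close> on.
\<close>

definition expands :: "nat \<Rightarrow> nat \<Rightarrow> ((nat \<Rightarrow> 'a::comm_ring_1) list \<Rightarrow> 'a) \<Rightarrow> bool" where
  "expands n m F \<longleftrightarrow> (\<forall>us v ys. length (us @ v # ys) = m \<longrightarrow>
     F (us @ v # ys) = (\<Sum>s<n. v s * F (us @ basis_vec s # ys)))"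

lemma expands_vanish:
  assumes "expands n m F"
    and "\<And>w. length w = m \<Longrightarrow> set w \<subseteq> {..<n} \<Longrightarrow> F (map basis_vec w) = 0"
    and "length vs = m"
  shows "F vs = 0"
proof -
  have "F (map basis_vec w @ vs) = 0" if "length w + length vs = m" "set w \<subseteq> {..<n}" for w
    using that
  proof (induction vs arbitrary: w)
    case Nil
    then show ?case using assms(2) by simp
  next
    case (Cons v vs)
    have "F (map basis_vec w @ basis_vec s # vs) = 0" if "s < n" for s
      using Cons.IH[of "w @ [s]"] Cons.prems that by simp
    moreover have "F (map basis_vec w @ v # vs) =
        (\<Sum>s<n. v s * F (map basis_vec w @ basis_vec s # vs))"
      using assms(1) Cons.prems by (auto simp: expands_def)
    ultimately show ?case by simp
  qed
  from this[of "[]"] assms(3) show ?thesis by simp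
qed

lemma spin_trace_expands: "expands (2*\<nu>+1) m (spin_trace \<nu>)"
  unfolding expands_def by (intro allI impI) (rule spin_trace_expand)

section \<open>Pfaffians and shuffle sums by recursion\<close>

text \<open>
  The permutations over which the Pfaffian is summed, one for each perfect matching of \<open>{0..<2 * l}\<close>.
\<close>

definition matchings :: "nat \<Rightarrow> (nat \<Rightarrow> nat) set" where
  "matchings l = {\<pi>. \<pi> permutes {0..<2*l} \<and> (\<forall>i<l. \<pi> (2*i) < \<pi> (2*i+1)) \<and>
     strict_mono_on {..<l} (\<lambda>i. \<pi> (2*i))}"

text \<open>
  Adds to a matching the pair of \<open>0\<close> and \<open>Suc j\<close>, in front of the other pairs, whose points are renumbered
  monotonically.
\<close>

definition insert_pair :: "nat \<Rightarrow> (nat \<Rightarrow> nat) \<Rightarrow> nat \<Rightarrow> nat" where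
  "insert_pair j \<sigma> = permutation_insert 0 0 (permutation_insert 0 j \<sigma>)"

lemma insert_pair_simps:
  "insert_pair j \<sigma> 0 = 0" "insert_pair j \<sigma> (Suc 0) = Suc j"
  "insert_pair j \<sigma> (Suc (Suc i)) = Suc (insert_index j (\<sigma> i))"
  by (simp_all add: insert_pair_def permutation_insert_def insert_dom_def insert_ran_def insert_index_def)

lemma insert_index_less_iff: "insert_index j p < insert_index j q \<longleftrightarrow> p < q"
  by (auto simp: insert_index_def)

lemma all_less_Suc_shift: "(\<forall>i<Suc n. P i) \<longleftrightarrow> P 0 \<and> (\<forall>i<n. P (Suc i))"
  by (metis less_Suc_eq_0_disj)

lemma strict_mono_on_Suc:
  "strict_mono_on {..<Suc n} f \<longleftrightarrow> (\<forall>i<n. f 0 < (f (Suc i) :: nat)) \<and> strict_mono_on {..<n} (\<lambda>i. f (Suc i))"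
proof
  assume "strict_mono_on {..<Suc n} f"
  then show "(\<forall>i<n. f 0 < f (Suc i)) \<and> strict_mono_on {..<n} (\<lambda>i. f (Suc i))"
    by (auto simp: strict_mono_on_def)
next
  assume a: "(\<forall>i<n. f 0 < f (Suc i)) \<and> strict_mono_on {..<n} (\<lambda>i. f (Suc i))"
  show "strict_mono_on {..<Suc n} f"
  proof (rule strict_mono_onI)
    fix r s assume "r \<in> {..<Suc n}" "s \<in> {..<Suc n}" "r < s"
    moreover from this obtain s' where "s = Suc s'" by (cases s) auto
    ultimately show "f r < f s"
      using a by (cases r) (auto simp: strict_mono_on_def)
  qed
qed

lemma insert_pair_matchings_iff:
  assumes "\<sigma> permutes {0..<2*l}" "j < 2*l+1"
  shows "insert_pair j \<sigma> \<in> matchings (Suc l) \<longleftrightarrow> \<sigma> \<in> matchings l"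
proof -
  have "permutation_insert 0 j \<sigma> permutes {0..<Suc (2*l)}"
    using assms by (intro permutation_insert_permutes) auto
  then have "insert_pair j \<sigma> permutes {0..<Suc (Suc (2*l))}"
    unfolding insert_pair_def by (rule permutation_insert_permutes) auto
  moreover have "strict_mono_on {..<l} (\<lambda>i. Suc (insert_index j (\<sigma> (2*i)))) \<longleftrightarrow>
      strict_mono_on {..<l} (\<lambda>i. \<sigma> (2*i))"
    by (simp add: strict_mono_on_def insert_index_less_iff)
  ultimately show ?thesis
    using assms
    by (simp add: matchings_def all_less_Suc_shift strict_mono_on_Suc insert_pair_simps
        insert_index_less_iff)
qed

text \<open>
  In the standard order of pairs the first entry \<open>\<pi> 0\<close> is always \<open>0\<close>, so a matching is given
      by the partner of
  \<open>0\<close> and a matching of the remaining points.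
\<close>

lemma matchings_Suc: "matchings (Suc l) = (\<lambda>(j, \<sigma>). insert_pair j \<sigma>) ` ({..<2*l+1} \<times> matchings l)"
proof (intro equalityI subsetI)
  fix \<pi> assume \<pi>: "\<pi> \<in> matchings (Suc l)"
  then have perm: "\<pi> permutes {0..<Suc (Suc (2*l))}"
    and lt: "\<And>i. i < Suc l \<Longrightarrow> \<pi> (2*i) < \<pi> (2*i+1)"
    and mono: "strict_mono_on {..<Suc l} (\<lambda>i. \<pi> (2*i))" by (auto simp: matchings_def)
  have "0 \<in> {0..<Suc (Suc (2*l))}" by simp
  then have "0 \<in> \<pi> ` {0..<Suc (Suc (2*l))}" using permutes_image[OF perm] by simp
  then obtain k where k: "k < Suc (Suc (2*l))" "\<pi> k = 0" by auto
  have "k = 0"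
  proof (rule ccontr)
    assume "k \<noteq> 0"
    show False
    proof (cases "even k")
      case True
      then obtain i where i: "k = 2 * i" by blast
      then have "\<pi> (2 * 0) < \<pi> (2 * i)"
        using k \<open>k \<noteq> 0\<close> by (intro strict_mono_onD[OF mono]) auto
      then show False using k i by simp
    next
      case False
      then obtain i where "k = 2 * i + 1" by (elim oddE)
      then show False using lt[of i] k by auto
    qed
  qed
  then have \<pi>0: "\<pi> 0 = 0" using k by simp
  define q where "q = permutation_delete \<pi> 0"
  define \<sigma> where "\<sigma> = permutation_delete q 0"
  have q: "q permutes {0..<Suc (2*l)}"
    unfolding q_def by (rule permutation_delete_permutes[OF perm]) simp
  have \<sigma>: "\<sigma> permutes {0..<2*l}"
    unfolding \<sigma>_def by (rule permutation_delete_permutes[OF q]) simp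
  have q0: "q 0 < 2*l+1" using permutes_in_image[OF q, of 0] by simp
  have "permutation_insert 0 (q 0) \<sigma> = q"
    unfolding \<sigma>_def by (rule permutation_insert_delete[OF q]) simp
  moreover have "permutation_insert 0 (\<pi> 0) q = \<pi>"
    unfolding q_def by (rule permutation_insert_delete[OF perm]) simp
  ultimately have eq: "insert_pair (q 0) \<sigma> = \<pi>" by (simp add: insert_pair_def \<pi>0)
  then have "\<sigma> \<in> matchings l" using insert_pair_matchings_iff[OF \<sigma> q0] \<pi> by simp
  then show "\<pi> \<in> (\<lambda>(j, \<sigma>). insert_pair j \<sigma>) ` ({..<2*l+1} \<times> matchings l)"
    using q0 eq by force
next
  fix \<pi> assume "\<pi> \<in> (\<lambda>(j, \<sigma>). insert_pair j \<sigma>) ` ({..<2*l+1} \<times> matchings l)"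
  then obtain j \<sigma> where "j < 2*l+1" "\<sigma> \<in> matchings l" "\<pi> = insert_pair j \<sigma>" by auto
  then show "\<pi> \<in> matchings (Suc l)"
    using insert_pair_matchings_iff[of \<sigma> l j] by (simp add: matchings_def)
qed

lemma inj_on_insert_pair: "inj_on (\<lambda>(j, \<sigma>). insert_pair j \<sigma>) ({..<2*l+1} \<times> matchings l)"
proof (rule inj_onI, clarify)
  fix j \<sigma> j' \<sigma>'
  assume a: "\<sigma> \<in> matchings l" "\<sigma>' \<in> matchings l" "insert_pair j \<sigma> = insert_pair j' \<sigma>'"
  have j: "j = j'" using fun_cong[OF a(3), of "Suc 0"] by (simp add: insert_pair_simps)
  have "\<sigma> i = \<sigma>' i" for i
    using fun_cong[OF a(3), of "Suc (Suc i)"] j insert_index_less_iff[of j]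
    by (simp add: insert_pair_simps) (metis linorder_neqE_nat less_irrefl)
  with j show "j = j' \<and> \<sigma> = \<sigma>'" by auto
qed

lemma sign_insert_pair:
  assumes "\<sigma> permutes {0..<2*l}" "j < 2*l+1"
  shows "of_int (sign (insert_pair j \<sigma>)) = (- 1 :: 'a::comm_ring_1) ^ j * of_int (sign \<sigma>)"
proof -
  have "permutation_insert 0 j \<sigma> permutes {0..<Suc (2*l)}"
    using assms by (intro permutation_insert_permutes) auto
  then show ?thesis
    unfolding insert_pair_def
    using signof_permutation_insert[of "permutation_insert 0 j \<sigma>" "Suc (2*l)" 0 0, where 'a = 'a]
      signof_permutation_insert[OF assms(1), of 0 j, where 'a = 'a] assms(2)
    by simp
qed

definition matching_sum :: "nat \<Rightarrow> (nat \<Rightarrow> nat \<Rightarrow> 'a::comm_ring_1) \<Rightarrow> 'a" where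
  "matching_sum l a =
     (\<Sum>\<pi>\<in>matchings l. of_int (sign \<pi>) * (\<Prod>i<l. a (\<pi> (2*i)) (\<pi> (2*i+1))))"

lemma matching_sum_Suc:
  "matching_sum (Suc l) a = (\<Sum>j<2*l+1. (- 1) ^ j * a 0 (Suc j) *
     matching_sum l (\<lambda>p q. a (Suc (insert_index j p)) (Suc (insert_index j q))))"
proof -
  have "matching_sum (Suc l) a = (\<Sum>(j, \<sigma>)\<in>{..<2*l+1} \<times> matchings l.
      of_int (sign (insert_pair j \<sigma>)) *
      (\<Prod>i<Suc l. a (insert_pair j \<sigma> (2*i)) (insert_pair j \<sigma> (2*i+1))))"
    unfolding matching_sum_def matchings_Suc sum.reindex[OF inj_on_insert_pair]
    by (simp add: case_prod_unfold)
  also have "\<dots> = (\<Sum>(j, \<sigma>)\<in>{..<2*l+1} \<times> matchings l. (- 1) ^ j * a 0 (Suc j) *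
      (of_int (sign \<sigma>) * (\<Prod>i<l. a (Suc (insert_index j (\<sigma> (2*i)))) (Suc (insert_index j (\<sigma> (2*i+1)))))))"
  proof (rule sum.cong[OF refl], clarify)
    fix j \<sigma> assume "j < 2*l+1" "\<sigma> \<in> matchings l"
    then have "of_int (sign (insert_pair j \<sigma>)) = (- 1 :: 'a) ^ j * of_int (sign \<sigma>)"
      by (intro sign_insert_pair) (auto simp: matchings_def)
    moreover have "(\<Prod>i<Suc l. a (insert_pair j \<sigma> (2*i)) (insert_pair j \<sigma> (2*i+1))) =
      a 0 (Suc j) * (\<Prod>i<l. a (Suc (insert_index j (\<sigma> (2*i)))) (Suc (insert_index j (\<sigma> (2*i+1)))))"
      unfolding prod.lessThan_Suc_shift by (simp add: insert_pair_simps)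
    ultimately show "of_int (sign (insert_pair j \<sigma>)) *
      (\<Prod>i<Suc l. a (insert_pair j \<sigma> (2*i)) (insert_pair j \<sigma> (2*i+1))) = (- 1) ^ j * a 0 (Suc j) *
      (of_int (sign \<sigma>) * (\<Prod>i<l. a (Suc (insert_index j (\<sigma> (2*i)))) (Suc (insert_index j (\<sigma> (2*i+1))))))"
      by (simp add: ac_simps)
  qed
  finally show ?thesis
    unfolding matching_sum_def sum_distrib_left by (simp add: sum.cartesian_product)
qed

lemma matching_sum_0: "matching_sum 0 a = 1"
proof -
  have "matchings 0 = {id}" by (auto simp: matchings_def strict_mono_on_def)
  then show ?thesis by (simp add: matching_sum_def)
qed

lemma matching_sum_cong:
  assumes "\<And>p q. p < q \<Longrightarrow> q < 2*l \<Longrightarrow> a p q = b p q"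
  shows "matching_sum l a = matching_sum l b"
  unfolding matching_sum_def
proof (rule sum.cong[OF refl], rule arg_cong2[where f = "(*)", OF refl], rule prod.cong[OF refl])
  fix \<pi> i assume "\<pi> \<in> matchings l" "i \<in> {..<l}"
  moreover from this have "\<pi> (2*i+1) < 2*l"
    using permutes_in_image[of \<pi> "{0..<2*l}" "2*i+1"] by (auto simp: matchings_def)
  ultimately show "a (\<pi> (2*i)) (\<pi> (2*i+1)) = b (\<pi> (2*i)) (\<pi> (2*i+1))"
    by (intro assms) (auto simp: matchings_def)
qed

text \<open>
  Expansion of the Pfaffian along its first row, with the list entries as row and column labels. Unlike the
  sum over permutations this makes sense for all lists and is 0 on those of odd length.
\<close>

fun pfaffian_list :: "('i \<Rightarrow> 'i \<Rightarrow> 'a::comm_ring_1) \<Rightarrow> 'i list \<Rightarrow> 'a" where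
  "pfaffian_list b [] = 1"
| "pfaffian_list b (x # xs) =
     (\<Sum>j<length xs. (- 1) ^ j * b x (xs ! j) * pfaffian_list b (take j xs @ drop (Suc j) xs))"

lemma nth_take_drop_insert_index:
  assumes "p < length xs - 1" "j < length xs"
  shows "(take j xs @ drop (Suc j) xs) ! p = xs ! insert_index j p"
  using assms by (auto simp: nth_append insert_index_def min_def)

lemma matching_sum_eq_pfaffian_list:
  "length xs = 2 * l \<Longrightarrow> matching_sum l (\<lambda>p q. b (xs ! p) (xs ! q)) = pfaffian_list b xs"
proof (induction l arbitrary: xs)
  case 0
  then show ?case by (simp add: matching_sum_0)
next
  case (Suc l)
  then obtain x ys where xs: "xs = x # ys" by (cases xs) auto
  then have len: "length ys = 2 * l + 1" using Suc.prems by simp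
  have "matching_sum l (\<lambda>p q. b (ys ! insert_index j p) (ys ! insert_index j q)) =
      pfaffian_list b (take j ys @ drop (Suc j) ys)" if "j < 2 * l + 1" for j
  proof -
    have "matching_sum l (\<lambda>p q. b (ys ! insert_index j p) (ys ! insert_index j q)) =
        matching_sum l (\<lambda>p q. b ((take j ys @ drop (Suc j) ys) ! p) ((take j ys @ drop (Suc j) ys) ! q))"
      using that len by (intro matching_sum_cong) (simp add: nth_take_drop_insert_index)
    also have "\<dots> = pfaffian_list b (take j ys @ drop (Suc j) ys)"
      using that len by (intro Suc.IH) simp
    finally show ?thesis .
  qed
  then show ?case
    unfolding matching_sum_Suc xs by (simp add: len del: sum.lessThan_Suc)
qed

lemma Pfpoly_eq_pfaffian_list:
  assumes "even (length is)"
  shows "Pfpoly n is = pfaffian_list (Bpoly n) is"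
proof -
  let ?l = "length is div 2"
  let ?A = "mat (length is) (length is) (\<lambda>(k, l). if k < l then Bpoly n (is ! k) (is ! l)
               else if l < k then - Bpoly n (is ! l) (is ! k) else 0)"
  have l: "2 * ?l = length is" using assms by simp
  have "Pfpoly n is = matching_sum ?l (\<lambda>p q. ?A $$ (p, q))"
    unfolding Pfpoly_def pfaffian_def Let_def matching_sum_def matchings_def
    by (simp add: lessThan_atLeast0)
  also have "\<dots> = matching_sum ?l (\<lambda>p q. Bpoly n (is ! p) (is ! q))"
    by (rule matching_sum_cong) (use l in auto)
  also have "\<dots> = pfaffian_list (Bpoly n) is"
    using l by (intro matching_sum_eq_pfaffian_list) simp
  finally show ?thesis .
qed

text \<open>
  The signed sum of \<open>G a b\<close> over all ways to divide a list into a sublist \<open>a\<close> of length \<open>d\<close> and the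
  complementary sublist \<open>b\<close>, computed from the front: an entry that goes to \<open>b\<close> has to pass the \<open>d\<close>
      entries that
  are still to be chosen for \<open>a\<close>.
\<close>

primrec shuffle_sum :: "nat \<Rightarrow> ('i list \<Rightarrow> 'i list \<Rightarrow> 'a::comm_ring_1) \<Rightarrow> 'i list \<Rightarrow> 'a" where
  "shuffle_sum d G [] = (if d = 0 then G [] [] else 0)"
| "shuffle_sum d G (x # xs) =
     (case d of 0 \<Rightarrow> 0 | Suc d' \<Rightarrow> shuffle_sum d' (\<lambda>a. G (x # a)) xs) +
     (- 1) ^ d * shuffle_sum d (\<lambda>a b. G a (x # b)) xs"

definition shuffle_perms :: "nat \<Rightarrow> nat \<Rightarrow> (nat \<Rightarrow> nat) set" where
  "shuffle_perms d m =
     {\<pi>. \<pi> permutes {0..<m} \<and> strict_mono_on {..<d} \<pi> \<and> strict_mono_on {d..<m} \<pi>}"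

lemma insert_zero_simps:
  "i < d \<Longrightarrow> permutation_insert d 0 \<sigma> i = Suc (\<sigma> i)"
  "permutation_insert d 0 \<sigma> d = 0"
  "i \<ge> d \<Longrightarrow> permutation_insert d 0 \<sigma> (Suc i) = Suc (\<sigma> i)"
  by (simp_all add: permutation_insert_def insert_dom_def insert_ran_def)

lemma insert_zero_first_iff:
  assumes "\<sigma> permutes {0..<m}"
  shows "permutation_insert 0 0 \<sigma> \<in> shuffle_perms (Suc d) (Suc m) \<longleftrightarrow> \<sigma> \<in> shuffle_perms d m"
proof -
  have p: "permutation_insert 0 0 \<sigma> permutes {0..<Suc m}"
    using assms by (intro permutation_insert_permutes) auto
  have e: "permutation_insert 0 0 \<sigma> (Suc i) = Suc (\<sigma> i)" "permutation_insert 0 0 \<sigma> 0 = 0" for i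
    by (simp_all add: insert_zero_simps)
  have "strict_mono_on (Suc ` {d..<m}) (permutation_insert 0 0 \<sigma>) \<longleftrightarrow> strict_mono_on {d..<m} \<sigma>"
    by (simp del: image_Suc_atLeastLessThan add: strict_mono_on_def imp_conjL image_iff Bex_def)
      (metis Suc_less_eq e(1))
  then have "strict_mono_on {Suc d..<Suc m} (permutation_insert 0 0 \<sigma>) \<longleftrightarrow> strict_mono_on {d..<m} \<sigma>"
    by simp
  then show ?thesis
    using assms p by (simp add: shuffle_perms_def strict_mono_on_Suc e)
      (simp add: strict_mono_on_def)
qed

lemma insert_zero_second_iff:
  assumes "\<sigma> permutes {0..<m}" "d \<le> m"
  shows "permutation_insert d 0 \<sigma> \<in> shuffle_perms d (Suc m) \<longleftrightarrow> \<sigma> \<in> shuffle_perms d m"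
proof -
  let ?\<pi> = "permutation_insert d 0 \<sigma>"
  have p: "?\<pi> permutes {0..<Suc m}"
    using assms by (intro permutation_insert_permutes) auto
  have 1: "strict_mono_on {..<d} ?\<pi> \<longleftrightarrow> strict_mono_on {..<d} \<sigma>"
    by (auto simp: strict_mono_on_def insert_zero_simps)
  have 2: "strict_mono_on {d..<Suc m} ?\<pi> \<longleftrightarrow> strict_mono_on {d..<m} \<sigma>"
  proof
    assume a: "strict_mono_on {d..<Suc m} ?\<pi>"
    show "strict_mono_on {d..<m} \<sigma>"
    proof (rule strict_mono_onI)
      fix r s assume "r \<in> {d..<m}" "s \<in> {d..<m}" "r < s"
      then show "\<sigma> r < \<sigma> s"
        using strict_mono_onD[OF a, of "Suc r" "Suc s"] by (simp add: insert_zero_simps)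
    qed
  next
    assume a: "strict_mono_on {d..<m} \<sigma>"
    show "strict_mono_on {d..<Suc m} ?\<pi>"
    proof (rule strict_mono_onI)
      fix r s assume rs: "r \<in> {d..<Suc m}" "s \<in> {d..<Suc m}" "r < s"
      then obtain s' where s': "s = Suc s'" "s' \<ge> d" "s' < m" by (cases s) auto
      show "?\<pi> r < ?\<pi> s"
      proof (cases "r = d")
        case True
        then show ?thesis using s' by (simp add: insert_zero_simps)
      next
        case False
        then obtain r' where "r = Suc r'" "r' \<ge> d" "r' < m" using rs by (cases r) auto
        then show ?thesis
          using s' rs strict_mono_onD[OF a, of r' s'] by (simp add: insert_zero_simps)
      qed
    qed
  qed
  show ?thesis using p assms 1 2 by (simp add: shuffle_perms_def)
qed

text \<open>
  Both monotone parts of a shuffle can take the value \<open>0\<close> only at their first place, so \<open>0\<close> is the image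
  of \<open>0\<close> or of \<open>d\<close>.
\<close>

lemma shuffle_perms_Suc:
  assumes "d \<le> Suc m"
  shows "shuffle_perms d (Suc m) =
    (if d = 0 then {} else permutation_insert 0 0 ` shuffle_perms (d - 1) m) \<union>
    (if d \<le> m then permutation_insert d 0 ` shuffle_perms d m else {})"
proof (intro equalityI subsetI)
  fix \<pi> assume \<pi>: "\<pi> \<in> shuffle_perms d (Suc m)"
  then have perm: "\<pi> permutes {0..<Suc m}" and m1: "strict_mono_on {..<d} \<pi>"
    and m2: "strict_mono_on {d..<Suc m} \<pi>" by (auto simp: shuffle_perms_def)
  have "0 \<in> {0..<Suc m}" by simp
  then have "0 \<in> \<pi> ` {0..<Suc m}" using permutes_image[OF perm] by simp
  then obtain k where k: "k < Suc m" "\<pi> k = 0" by auto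
  define \<sigma> where "\<sigma> = permutation_delete \<pi> k"
  have \<sigma>: "\<sigma> permutes {0..<m}"
    unfolding \<sigma>_def by (rule permutation_delete_permutes[OF perm k(1)])
  have eq: "permutation_insert k 0 \<sigma> = \<pi>"
    using permutation_insert_delete[OF perm k(1)] by (simp add: \<sigma>_def k)
  show "\<pi> \<in> (if d = 0 then {} else permutation_insert 0 0 ` shuffle_perms (d - 1) m) \<union>
    (if d \<le> m then permutation_insert d 0 ` shuffle_perms d m else {})"
  proof (cases "k < d")
    case True
    have "k = 0"
    proof (rule ccontr)
      assume "k \<noteq> 0"
      then have "\<pi> 0 < \<pi> k" using True by (intro strict_mono_onD[OF m1]) auto
      then show False using k by simp
    qed
    then have "\<sigma> \<in> shuffle_perms (d - 1) m"
      using insert_zero_first_iff[OF \<sigma>, of "d - 1"] True eq \<pi> by simp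
    then show ?thesis using True eq \<open>k = 0\<close> by auto
  next
    case False
    have "k = d"
    proof (rule ccontr)
      assume "k \<noteq> d"
      then have "\<pi> d < \<pi> k" using False k by (intro strict_mono_onD[OF m2]) auto
      then show False using k by simp
    qed
    then have "\<sigma> \<in> shuffle_perms d m"
      using insert_zero_second_iff[OF \<sigma>, of d] eq \<pi> k by simp
    then show ?thesis using \<open>k = d\<close> k eq by auto
  qed
next
  fix \<pi> assume "\<pi> \<in> (if d = 0 then {} else permutation_insert 0 0 ` shuffle_perms (d - 1) m) \<union>
    (if d \<le> m then permutation_insert d 0 ` shuffle_perms d m else {})"
  then consider \<sigma> where "d > 0" "\<sigma> \<in> shuffle_perms (d - 1) m" "\<pi> = permutation_insert 0 0 \<sigma>"
    | \<sigma> where "d \<le> m" "\<sigma> \<in> shuffle_perms d m" "\<pi> = permutation_insert d 0 \<sigma>"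
    by (auto split: if_splits)
  then show "\<pi> \<in> shuffle_perms d (Suc m)"
  proof cases
    case 1
    then show ?thesis
      using insert_zero_first_iff[of \<sigma> m "d - 1"] by (simp add: shuffle_perms_def)
  next
    case 2
    then show ?thesis
      using insert_zero_second_iff[of \<sigma> m d] by (simp add: shuffle_perms_def)
  qed
qed

lemma shuffle_sum_too_short: "length xs < d \<Longrightarrow> shuffle_sum d G xs = 0"
  by (induction xs arbitrary: d G) (auto split: nat.split)

lemma shuffle_sum_all_first: "shuffle_sum (length xs) G xs = G xs []"
proof (induction xs arbitrary: G)
  case (Cons x xs)
  then show ?case by (simp add: shuffle_sum_too_short)
qed simp

lemma map_upt_nth_shift:
  "(\<And>i. a \<le> i \<Longrightarrow> i < b \<Longrightarrow> f (Suc i) = g i) \<Longrightarrow> map f [Suc a..<Suc b] = map g [a..<b]"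
  unfolding map_Suc_upt[symmetric] map_map by simp

lemma sum_shuffle_perms:
  assumes "d \<le> length xs"
  shows "(\<Sum>\<pi>\<in>shuffle_perms d (length xs). of_int (sign \<pi>) *
      G (map (\<lambda>i. xs ! \<pi> i) [0..<d]) (map (\<lambda>i. xs ! \<pi> i) [d..<length xs])) = shuffle_sum d G xs"
  using assms
proof (induction xs arbitrary: d G)
  case Nil
  have "shuffle_perms 0 0 = {id}" by (auto simp: shuffle_perms_def strict_mono_on_def)
  then show ?case using Nil by simp
next
  case (Cons x xs)
  let ?m = "length xs"
  let ?t = "\<lambda>d (G :: 'a list \<Rightarrow> 'a list \<Rightarrow> 'b) xs \<pi>. of_int (sign \<pi>) *
      G (map (\<lambda>i. xs ! \<pi> i) [0..<d]) (map (\<lambda>i. xs ! \<pi> i) [d..<length xs])"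
  let ?A = "if d = 0 then {} else permutation_insert 0 0 ` shuffle_perms (d - 1) ?m"
  let ?B = "if d \<le> ?m then permutation_insert d 0 ` shuffle_perms d ?m else {}"
  have perms: "shuffle_perms c ?m \<subseteq> {\<sigma>. \<sigma> permutes {0..<?m}}" for c
    by (auto simp: shuffle_perms_def)
  then have fin: "finite (shuffle_perms c ?m)" for c
    using finite_permutations[of "{0..<?m}"] by (rule finite_subset) simp
  have disj: "?A \<inter> ?B = {}"
  proof -
    have False if \<pi>: "\<pi> \<in> ?A" "\<pi> \<in> ?B" for \<pi>
    proof (cases "d = 0")
      case True
      then show False using \<pi>(1) by simp
    next
      case False
      then obtain \<sigma> where "\<pi> = permutation_insert 0 0 \<sigma>" using \<pi>(1) by auto
      moreover obtain \<sigma>' where "\<pi> = permutation_insert d 0 \<sigma>'" using \<pi>(2) by (auto split: if_splits)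
      ultimately show False
        using False insert_zero_simps(1)[of 0 d \<sigma>'] insert_zero_simps(2)[of 0 \<sigma>] by simp
    qed
    then show ?thesis by blast
  qed
  have inj: "inj_on (permutation_insert c 0) (shuffle_perms e ?m)" if "c < Suc ?m" for c e
    using permutation_insert_inj_on[of c ?m 0] that inj_on_subset[OF _ perms] by blast
  have A: "(\<Sum>\<pi>\<in>?A. ?t d G (x # xs) \<pi>) =
      (case d of 0 \<Rightarrow> 0 | Suc d' \<Rightarrow> shuffle_sum d' (\<lambda>a. G (x # a)) xs)"
  proof (cases d)
    case (Suc d')
    have "(\<Sum>\<pi>\<in>?A. ?t d G (x # xs) \<pi>) =
        (\<Sum>\<sigma>\<in>shuffle_perms d' ?m. ?t d G (x # xs) (permutation_insert 0 0 \<sigma>))"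
      using Suc by (simp add: sum.reindex[OF inj])
    also have "\<dots> = (\<Sum>\<sigma>\<in>shuffle_perms d' ?m. ?t d' (\<lambda>a. G (x # a)) xs \<sigma>)"
    proof (rule sum.cong[OF refl])
      fix \<sigma> assume \<sigma>: "\<sigma> \<in> shuffle_perms d' ?m"
      let ?\<pi> = "permutation_insert 0 0 \<sigma>"
      have s: "of_int (sign ?\<pi>) = (of_int (sign \<sigma>) :: 'b)"
        using signof_permutation_insert[of \<sigma> ?m 0 0, where 'a = 'b] \<sigma> by (simp add: shuffle_perms_def)
      have "map (\<lambda>i. (x # xs) ! ?\<pi> i) [0..<d] = x # map (\<lambda>i. xs ! \<sigma> i) [0..<d']"
        unfolding Suc by (subst upt_conv_Cons)
            (simp_all add: insert_zero_simps map_upt_nth_shift del: upt_Suc)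
      moreover have "map (\<lambda>i. (x # xs) ! ?\<pi> i) [d..<length (x # xs)] = map (\<lambda>i. xs ! \<sigma> i) [d'..<?m]"
        unfolding Suc list.size by (simp add: map_upt_nth_shift insert_zero_simps del: upt_Suc)
      ultimately show "?t d G (x # xs) ?\<pi> = ?t d' (\<lambda>a. G (x # a)) xs \<sigma>"
        by (simp add: s del: upt_Suc)
    qed
    also have "\<dots> = shuffle_sum d' (\<lambda>a. G (x # a)) xs"
      using Cons.prems Suc by (intro Cons.IH) simp
    finally show ?thesis using Suc by simp
  qed simp
  have B: "(\<Sum>\<pi>\<in>?B. ?t d G (x # xs) \<pi>) = (- 1) ^ d * shuffle_sum d (\<lambda>a b. G a (x # b)) xs"
  proof (cases "d \<le> ?m")
    case True
    have "(\<Sum>\<pi>\<in>?B. ?t d G (x # xs) \<pi>) =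
        (\<Sum>\<sigma>\<in>shuffle_perms d ?m. ?t d G (x # xs) (permutation_insert d 0 \<sigma>))"
      using True by (simp add: sum.reindex[OF inj])
    also have "\<dots> = (\<Sum>\<sigma>\<in>shuffle_perms d ?m. (- 1) ^ d * ?t d (\<lambda>a b. G a (x # b)) xs \<sigma>)"
    proof (rule sum.cong[OF refl])
      fix \<sigma> assume \<sigma>: "\<sigma> \<in> shuffle_perms d ?m"
      let ?\<pi> = "permutation_insert d 0 \<sigma>"
      have s: "of_int (sign ?\<pi>) = (- 1) ^ d * (of_int (sign \<sigma>) :: 'b)"
        using signof_permutation_insert[of \<sigma> ?m d 0, where 'a = 'b] \<sigma> True by (simp add: shuffle_perms_def)
      have 1: "map (\<lambda>i. (x # xs) ! ?\<pi> i) [0..<d] = map (\<lambda>i. xs ! \<sigma> i) [0..<d]"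
        by (rule map_cong) (simp_all add: insert_zero_simps)
      have 2: "map (\<lambda>i. (x # xs) ! ?\<pi> i) [d..<length (x # xs)] = x # map (\<lambda>i. xs ! \<sigma> i) [d..<?m]"
        using True by (subst upt_conv_Cons) (simp_all add: insert_zero_simps map_upt_nth_shift del: upt_Suc)
      show "?t d G (x # xs) ?\<pi> = (- 1) ^ d * ?t d (\<lambda>a b. G a (x # b)) xs \<sigma>"
        unfolding 1 2 s by (simp add: mult.assoc)
    qed
    also have "\<dots> = (- 1) ^ d * shuffle_sum d (\<lambda>a b. G a (x # b)) xs"
      using Cons.IH[OF True, of "\<lambda>a b. G a (x # b)"] by (simp flip: sum_distrib_left)
    finally show ?thesis .
  next
    case False
    then show ?thesis by (simp add: shuffle_sum_too_short)
  qed
  have "(\<Sum>\<pi>\<in>shuffle_perms d (length (x # xs)). ?t d G (x # xs) \<pi>) =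
      (\<Sum>\<pi>\<in>?A. ?t d G (x # xs) \<pi>) + (\<Sum>\<pi>\<in>?B. ?t d G (x # xs) \<pi>)"
  proof -
    have "shuffle_perms d (length (x # xs)) = ?A \<union> ?B"
      using Cons.prems by (simp add: shuffle_perms_Suc)
    moreover have "finite ?A" "finite ?B" using fin by auto
    ultimately show ?thesis using disj by (simp only: sum.union_disjoint)
  qed
  then show ?case using A B by simp
qed

section \<open>The Wick formula\<close>

text \<open>
  Moving one vector to the end by the Clifford relations; every step past a vector leaves a contraction.
\<close>

lemma spin_trace_commute_past:
  "spin_trace \<nu> (us @ v # ws) =
     (\<Sum>j<length ws. (- 1) ^ j * polar \<nu> v (ws ! j) * spin_trace \<nu> (us @ take j ws @ drop (Suc j) ws)) +
     (- 1) ^ length ws * spin_trace \<nu> (us @ ws @ [v])"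
proof (induction ws arbitrary: us)
  case (Cons w ws)
  have "spin_trace \<nu> (us @ v # w # ws) =
      polar \<nu> v w * spin_trace \<nu> (us @ ws) - spin_trace \<nu> ((us @ [w]) @ v # ws)"
    using spin_trace_swap[of \<nu> us v w ws] by (simp add: eq_diff_eq)
  also have "\<dots> = polar \<nu> v w * spin_trace \<nu> (us @ ws) -
      ((\<Sum>j<length ws. (- 1) ^ j * polar \<nu> v (ws ! j) *
        spin_trace \<nu> ((us @ [w]) @ take j ws @ drop (Suc j) ws)) +
      (- 1) ^ length ws * spin_trace \<nu> ((us @ [w]) @ ws @ [v]))"
    by (simp only: Cons.IH)
  also have "\<dots> = (\<Sum>j<length (w # ws). (- 1) ^ j * polar \<nu> v ((w # ws) ! j) *
        spin_trace \<nu> (us @ take j (w # ws) @ drop (Suc j) (w # ws))) +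
      (- 1) ^ length (w # ws) * spin_trace \<nu> (us @ (w # ws) @ [v])"
    unfolding list.size add_Suc_right add_0_right sum.lessThan_Suc_shift by (simp add: sum_negf)
  finally show ?case .
qed simp

lemma spin_trace_wick:
  assumes "odd (length vs)"
  shows "2 * spin_trace \<nu> (v # vs) =
    (\<Sum>j<length vs. (- 1) ^ j * polar \<nu> v (vs ! j) * spin_trace \<nu> (take j vs @ drop (Suc j) vs))"
    (is "_ = ?S")
proof -
  have "spin_trace \<nu> (v # vs) = ?S + (- 1) ^ length vs * spin_trace \<nu> (vs @ [v])"
    using spin_trace_commute_past[of \<nu> "[]" v vs] by simp
  also have "spin_trace \<nu> (vs @ [v]) = spin_trace \<nu> (v # vs)"
    using spin_trace_rotate[of \<nu> vs "[v]"] by simp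
  finally have "spin_trace \<nu> (v # vs) + spin_trace \<nu> (v # vs) =
      ?S + (- 1) ^ length vs * spin_trace \<nu> (v # vs) + spin_trace \<nu> (v # vs)"
    by (rule arg_cong[where f = "\<lambda>t. t + spin_trace \<nu> (v # vs)"])
  also have "\<dots> = ?S" using assms by simp
  finally show ?thesis by (simp only: mult_2)
qed

text \<open>
  The recursion of \<open>spin_trace_wick\<close> is, up to the factor 2, the expansion of the Pfaffian along
  its first row. Powers of 2 are kept on both sides since they cannot be inverted.
\<close>

lemma spin_trace_pfaffian_list:
  "even (length vs) \<Longrightarrow>
    2 ^ (length vs div 2) * spin_trace \<nu> vs = 2 ^ \<nu> * pfaffian_list (polar \<nu>) vs"
proof (induction vs rule: length_induct)
  case (1 vs)
  show ?case
  proof (cases vs)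
    case Nil
    then show ?thesis by (simp add: spin_trace_Nil)
  next
    case (Cons v ws)
    then have odd: "odd (length ws)" using 1(2) by simp
    define e where "e = length ws div 2"
    have e: "length vs div 2 = Suc e" using Cons odd by (simp add: e_def)
    have IH: "2 ^ e * spin_trace \<nu> (take j ws @ drop (Suc j) ws) =
        2 ^ \<nu> * pfaffian_list (polar \<nu>) (take j ws @ drop (Suc j) ws)" if "j < length ws" for j
    proof -
      have len: "length (take j ws @ drop (Suc j) ws) = length ws - 1" using that by simp
      moreover have "(length ws - 1) div 2 = e" using odd by (auto simp: e_def elim!: oddE)
      ultimately show ?thesis
        using 1(1)[rule_format, of "take j ws @ drop (Suc j) ws"] odd Cons by simp
    qed
    have "2 ^ (length vs div 2) * spin_trace \<nu> vs = 2 ^ e * (2 * spin_trace \<nu> (v # ws))"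
      unfolding e by (simp add: Cons ac_simps)
    also have "\<dots> = (\<Sum>j<length ws. (- 1) ^ j * polar \<nu> v (ws ! j) *
        (2 ^ e * spin_trace \<nu> (take j ws @ drop (Suc j) ws)))"
      unfolding spin_trace_wick[OF odd] sum_distrib_left by (simp add: ac_simps)
    also have "\<dots> = 2 ^ \<nu> * pfaffian_list (polar \<nu>) vs"
      unfolding Cons pfaffian_list.simps sum_distrib_left
      by (intro sum.cong refl) (simp add: IH ac_simps)
    finally show ?thesis .
  qed
qed

lemma pfaffian_list_odd: "odd (length xs) \<Longrightarrow> pfaffian_list b xs = 0"
proof (induction xs rule: length_induct)
  case (1 xs)
  show ?case
  proof (cases xs)
    case Nil
    then show ?thesis using 1(2) by simp
  next
    case (Cons x ys)
    have "pfaffian_list b (take j ys @ drop (Suc j) ys) = 0" if "j < length ys" for j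
      using 1 that Cons by (intro 1(1)[rule_format]) auto
    then show ?thesis by (simp add: Cons)
  qed
qed

lemma pfaffian_list_map: "pfaffian_list b (map f xs) = pfaffian_list (\<lambda>x y. b (f x) (f y)) xs"
proof (induction xs rule: length_induct)
  case (1 xs)
  show ?case
  proof (cases xs)
    case (Cons x ys)
    have "pfaffian_list b (take j (map f ys) @ drop (Suc j) (map f ys)) =
        pfaffian_list (\<lambda>x y. b (f x) (f y)) (take j ys @ drop (Suc j) ys)" if "j < length ys" for j
      using 1[rule_format, of "take j ys @ drop (Suc j) ys"] that Cons
      by (simp add: take_map drop_map)
    then show ?thesis by (simp add: Cons)
  qed simp
qed

lemma cancel_two_power:
  assumes "\<forall>x :: 'a::comm_ring_1. 2 * x = 0 \<longrightarrow> x = 0" and "2 ^ k * x = 2 ^ k * (y :: 'a)"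
  shows "x = y"
proof -
  have "2 ^ k * z = 0 \<Longrightarrow> z = 0" for z :: 'a
    by (induction k) (auto simp: mult.assoc intro: assms(1)[rule_format])
  from this[of "x - y"] assms(2) show ?thesis by (simp add: right_diff_distrib)
qed

text \<open>
  Inherited from the trace, after division by a power of 2. This is why the coefficient ring is assumed to
  have no 2-torsion in this section.
\<close>

lemma pfaffian_list_polar_swap:
  assumes tf: "\<forall>x :: 'a::comm_ring_1. 2 * x = 0 \<longrightarrow> x = 0"
  shows "pfaffian_list (polar \<nu>) (us @ v # w # ys) + pfaffian_list (polar \<nu>) (us @ w # v # ys) =
    2 * polar \<nu> v w * pfaffian_list (polar \<nu>) (us @ ys :: (nat \<Rightarrow> 'a) list)"
proof (cases "even (length (us @ ys))")
  case True
  define e where "e = length (us @ ys) div 2"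
  have e: "length (us @ v # w # ys) div 2 = Suc e" "length (us @ w # v # ys) div 2 = Suc e"
    by (simp_all add: e_def)
  have "2 ^ \<nu> * (pfaffian_list (polar \<nu>) (us @ v # w # ys) + pfaffian_list (polar \<nu>) (us @ w # v # ys)) =
      2 ^ Suc e * (spin_trace \<nu> (us @ v # w # ys) + spin_trace \<nu> (us @ w # v # ys))"
    using spin_trace_pfaffian_list[of "us @ v # w # ys" \<nu>] spin_trace_pfaffian_list[of "us @ w # v # ys" \<nu>]
      True unfolding e by (simp add: distrib_left)
  also have "\<dots> = 2 * polar \<nu> v w * (2 ^ e * spin_trace \<nu> (us @ ys))"
    unfolding spin_trace_swap by (simp add: ac_simps)
  also have "\<dots> = 2 ^ \<nu> * (2 * polar \<nu> v w * pfaffian_list (polar \<nu>) (us @ ys))"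
    using spin_trace_pfaffian_list[OF True, of \<nu>] by (simp add: e_def ac_simps)
  finally show ?thesis by (rule cancel_two_power[OF tf])
next
  case False
  then show ?thesis by (simp add: pfaffian_list_odd)
qed

lemma pfaffian_list_polar_expands:
  assumes tf: "\<forall>x :: 'a::comm_ring_1. 2 * x = 0 \<longrightarrow> x = 0"
  shows "pfaffian_list (polar \<nu>) (us @ v # ys) =
    (\<Sum>s<2*\<nu>+1. v s * pfaffian_list (polar \<nu>) (us @ basis_vec s # ys :: (nat \<Rightarrow> 'a) list))"
proof (cases "even (length (us @ v # ys))")
  case True
  define e where "e = length (us @ v # ys) div 2"
  have t: "2 ^ e * spin_trace \<nu> (us @ u # ys) = 2 ^ \<nu> * pfaffian_list (polar \<nu>) (us @ u # ys)" for u
    using spin_trace_pfaffian_list[of "us @ u # ys" \<nu>] True by (simp add: e_def)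
  have "2 ^ \<nu> * pfaffian_list (polar \<nu>) (us @ v # ys) =
      (\<Sum>s<2*\<nu>+1. v s * (2 ^ e * spin_trace \<nu> (us @ basis_vec s # ys)))"
    unfolding t[symmetric] by (subst spin_trace_expand) (simp only: sum_distrib_left mult.left_commute)
  also have "\<dots> = 2 ^ \<nu> * (\<Sum>s<2*\<nu>+1. v s * pfaffian_list (polar \<nu>) (us @ basis_vec s # ys))"
    unfolding t by (simp only: sum_distrib_left mult.left_commute)
  finally show ?thesis by (rule cancel_two_power[OF tf])
next
  case False
  then show ?thesis by (simp add: pfaffian_list_odd)
qed

text \<open>
  The value 0 on lists of the wrong length makes the function alternating without a condition on lengths.
\<close>

definition det_list :: "nat \<Rightarrow> (nat \<Rightarrow> 'a::comm_ring_1) list \<Rightarrow> 'a" where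
  "det_list n vs = (if length vs = n then det (mat n n (\<lambda>(r, j). (vs ! j) r)) else 0)"

lemma det_list_swap: "det_list n (us @ v # w # ys) + det_list n (us @ w # v # ys) = 0"
proof (cases "length (us @ v # w # ys) = n")
  case True
  let ?k = "length us" and ?A = "mat n n (\<lambda>(r, j). ((us @ v # w # ys) ! j) r)"
  have "mat n n (\<lambda>(r, j). ((us @ w # v # ys) ! j) r) = swapcols ?k (Suc ?k) ?A"
    using True by (auto intro!: eq_matI simp: nth_append nth_Cons split: nat.split)
  also have "det \<dots> = - det ?A"
    using True by (intro det_swapcols[of _ n]) auto
  finally show ?thesis using True by (simp add: det_list_def)
qed (simp add: det_list_def)

lemma det_list_expands:
  "det_list n (us @ v # ys) = (\<Sum>s<n. v s * det_list n (us @ basis_vec s # ys))"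
proof (cases "length (us @ v # ys) = n")
  case True
  let ?k = "length us"
  let ?A = "\<lambda>v. mat n n (\<lambda>(r, j). ((us @ v # ys) ! j) r)"
  have cof: "cofactor (?A u) i ?k = cofactor (?A v) i ?k" for u i
    unfolding cofactor_def mat_delete_def
    by (intro arg_cong2[where f = "(*)"] refl arg_cong[where f = det] eq_matI)
      (auto simp: nth_append nth_Cons split: nat.split)
  have lap: "det (?A u) = (\<Sum>i<n. u i * cofactor (?A v) i ?k)" for u
  proof -
    have "det (?A u) = (\<Sum>i<n. ?A u $$ (i, ?k) * cofactor (?A u) i ?k)"
      using True by (intro laplace_expansion_column) auto
    also have "\<dots> = (\<Sum>i<n. u i * cofactor (?A v) i ?k)"
      unfolding cof[of u] using True by (intro sum.cong refl) simp
    finally show ?thesis .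
  qed
  have "det (?A (basis_vec s)) = cofactor (?A v) s ?k" if "s < n" for s
    unfolding lap[of "basis_vec s"] using that
    by (simp add: basis_vec_def if_distrib[where f = "\<lambda>x. x * _"] cong: if_cong)
  then show ?thesis
    using True lap[of v] by (simp add: det_list_def)
qed (simp add: det_list_def)

lemma shuffle_sum_add:
  "shuffle_sum d (\<lambda>a b. G a b + G' a b) xs = shuffle_sum d G xs + shuffle_sum d G' xs"
  by (induction xs arbitrary: d G G') (auto split: nat.split simp: algebra_simps)

lemma shuffle_sum_mult: "shuffle_sum d (\<lambda>a b. c * G a b) xs = c * shuffle_sum d G xs"
  by (induction xs arbitrary: d G) (auto split: nat.split simp: algebra_simps)

lemma shuffle_sum_zero: "shuffle_sum d (\<lambda>a b. 0) xs = 0"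
  using shuffle_sum_mult[of d 0 "\<lambda>_ _. 0" xs] by simp

lemma shuffle_sum_linear:
  fixes n :: nat
  shows "shuffle_sum d (\<lambda>a b. \<Sum>s<n. c s * G s a b) xs = (\<Sum>s<n. c s * shuffle_sum d (G s) xs)"
  by (induction n) (simp_all add: shuffle_sum_zero shuffle_sum_add shuffle_sum_mult)

text \<open>
  If both adjacent entries go to the first part, the two terms cancel as \<open>G\<close> is alternating there; if they
  go to different parts, the terms cancel because of the signs of the shuffles; if both go to the second
  part, the rule for \<open>G\<close> gives the right-hand side.
\<close>

lemma shuffle_sum_swap:
  assumes "\<And>us v w ys b. G (us @ v # w # ys) b + G (us @ w # v # ys) b = 0"
    and "\<And>a us v w ys. G a (us @ v # w # ys) + G a (us @ w # v # ys) = \<kappa> v w * G a (us @ ys)"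
  shows "shuffle_sum d G (us @ v # w # ys) + shuffle_sum d G (us @ w # v # ys) =
    \<kappa> v w * shuffle_sum d G (us @ ys)"
  using assms
proof (induction us arbitrary: d G)
  case Nil
  have second: "shuffle_sum d (\<lambda>a b. G a (v # w # b)) ys + shuffle_sum d (\<lambda>a b. G a (w # v # b)) ys =
      \<kappa> v w * shuffle_sum d G ys" for d
    unfolding shuffle_sum_add[symmetric] using Nil.prems(2)[of _ "[]"]
    by (simp add: shuffle_sum_mult)
  have first: "shuffle_sum d (\<lambda>a. G (v # w # a)) ys + shuffle_sum d (\<lambda>a. G (w # v # a)) ys = 0" for d
    unfolding shuffle_sum_add[symmetric] using Nil.prems(1)[of "[]"]
    by (simp add: shuffle_sum_zero)
  show ?case
  proof (cases d)
    case 0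
    then show ?thesis using second[of 0] by simp
  next
    case (Suc d')
    have s: "(- 1) ^ d * ((- 1) ^ d * (x :: 'b)) = x" for x
      by (simp flip: mult.assoc power_mult_distrib)
    show ?thesis
    proof (cases d')
      case 0
      then show ?thesis using Suc second[of d] by (simp add: algebra_simps)
    next
      case (Suc d'')
      have "shuffle_sum d G ([] @ v # w # ys) + shuffle_sum d G ([] @ w # v # ys) =
        (shuffle_sum d'' (\<lambda>a. G (v # w # a)) ys + shuffle_sum d'' (\<lambda>a. G (w # v # a)) ys) +
        (shuffle_sum d (\<lambda>a b. G a (v # w # b)) ys + shuffle_sum d (\<lambda>a b. G a (w # v # b)) ys)"
        using Suc \<open>d = Suc d'\<close> s by (simp add: algebra_simps)
      then show ?thesis unfolding first second by simp
    qed
  qed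
next
  case (Cons u us)
  have 1: "shuffle_sum d' (\<lambda>a. G (u # a)) (us @ v # w # ys) + shuffle_sum d' (\<lambda>a. G (u # a))
      (us @ w # v # ys) =
      \<kappa> v w * shuffle_sum d' (\<lambda>a. G (u # a)) (us @ ys)" for d'
    by (rule Cons.IH) (use Cons.prems(1)[of "u # _"] Cons.prems(2) in simp_all)
  have 2: "shuffle_sum d (\<lambda>a b. G a (u # b)) (us @ v # w # ys) + shuffle_sum d (\<lambda>a b. G a (u # b))
      (us @ w # v # ys) =
      \<kappa> v w * shuffle_sum d (\<lambda>a b. G a (u # b)) (us @ ys)"
    by (rule Cons.IH) (use Cons.prems(2)[of _ "u # _"] Cons.prems(1) in simp_all)
  have "(case d of 0 \<Rightarrow> 0 | Suc d' \<Rightarrow> shuffle_sum d' (\<lambda>a. G (u # a)) (us @ v # w # ys)) +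
      (case d of 0 \<Rightarrow> 0 | Suc d' \<Rightarrow> shuffle_sum d' (\<lambda>a. G (u # a)) (us @ w # v # ys)) =
      \<kappa> v w * (case d of 0 \<Rightarrow> 0 | Suc d' \<Rightarrow> shuffle_sum d' (\<lambda>a. G (u # a)) (us @ ys))"
    using 1 by (simp split: nat.split)
  moreover have "(- 1) ^ d * shuffle_sum d (\<lambda>a b. G a (u # b)) (us @ v # w # ys) +
      (- 1) ^ d * shuffle_sum d (\<lambda>a b. G a (u # b)) (us @ w # v # ys) =
      \<kappa> v w * ((- 1) ^ d * shuffle_sum d (\<lambda>a b. G a (u # b)) (us @ ys))"
    using 2 by (simp add: mult.left_commute flip: distrib_left)
  ultimately show ?case
    by (simp only: append_Cons shuffle_sum.simps distrib_left) (simp add: algebra_simps)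
qed

lemma shuffle_sum_expands:
  assumes "\<And>us v ys b. G (us @ v # ys) b = (\<Sum>s<n. v s * G (us @ basis_vec s # ys) b)"
    and "\<And>a us v ys. G a (us @ v # ys) = (\<Sum>s<n. v s * G a (us @ basis_vec s # ys))"
  shows "shuffle_sum d G (us @ v # ys) = (\<Sum>s<n. v s * shuffle_sum d G (us @ basis_vec s # ys))"
  using assms
proof (induction us arbitrary: d G)
  case Nil
  have 1: "shuffle_sum d' (\<lambda>a. G (v # a)) ys = (\<Sum>s<n. v s * shuffle_sum d' (\<lambda>a. G
      (basis_vec s # a)) ys)" for d'
  proof -
    have "(\<lambda>a. G (v # a)) = (\<lambda>a b. \<Sum>s<n. v s * G (basis_vec s # a) b)"
      by (intro ext) (rule Nil.prems(1)[of "[]", simplified])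
    then show ?thesis by (simp only: shuffle_sum_linear)
  qed
  have 2: "shuffle_sum d (\<lambda>a b. G a (v # b)) ys =
      (\<Sum>s<n. v s * shuffle_sum d (\<lambda>a b. G a (basis_vec s # b)) ys)" for d
  proof -
    have "(\<lambda>a b. G a (v # b)) = (\<lambda>a b. \<Sum>s<n. v s * G a (basis_vec s # b))"
      by (intro ext) (rule Nil.prems(2)[of _ "[]", simplified])
    then show ?thesis by (simp only: shuffle_sum_linear)
  qed
  show ?case
    by (cases d) (simp_all add: 1 2 sum.distrib distrib_left sum_distrib_left right_diff_distrib
        sum_subtractf sum_negf mult.left_commute)
next
  case (Cons u us)
  have 1: "shuffle_sum d' (\<lambda>a. G (u # a)) (us @ v # ys) =
      (\<Sum>s<n. v s * shuffle_sum d' (\<lambda>a. G (u # a)) (us @ basis_vec s # ys))" for d'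
    by (rule Cons.IH, rule Cons.prems(1)[of "u # _", simplified], rule Cons.prems(2))
  have 2: "shuffle_sum d (\<lambda>a b. G a (u # b)) (us @ v # ys) =
      (\<Sum>s<n. v s * shuffle_sum d (\<lambda>a b. G a (u # b)) (us @ basis_vec s # ys))" for d
    by (rule Cons.IH, rule Cons.prems(1), rule Cons.prems(2)[of _ "u # _", simplified])
  show ?case
    by (cases d) (simp_all add: 1 2 sum.distrib distrib_left sum_distrib_left right_diff_distrib
        sum_subtractf sum_negf mult.left_commute)
qed


lemma clifford_trace_spin_trace:
  "clifford_trace \<nu> (\<lambda>w. spin_trace \<nu> (map basis_vec w) :: 'a::comm_ring_1)"
proof unfold_locales
  fix us ys a b
  show "spin_trace \<nu> (map basis_vec (us @ a # b # ys)) + spin_trace \<nu> (map basis_vec (us @ b # a # ys))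
      = polar \<nu> (basis_vec a) (basis_vec b) * (spin_trace \<nu> (map basis_vec (us @ ys)) :: 'a)"
    by (simp add: spin_trace_swap)
  show "spin_trace \<nu> (map basis_vec (us @ a # a # ys)) =
      quad \<nu> (basis_vec a) * (spin_trace \<nu> (map basis_vec (us @ ys)) :: 'a)"
    by (simp add: spin_trace_square)
  show "(spin_trace \<nu> (map basis_vec (us @ ys)) :: 'a) = spin_trace \<nu> (map basis_vec (ys @ us))"
    by (simp add: spin_trace_rotate[of \<nu> "map basis_vec us"])
qed

text \<open>
  The alternating sum of the \<open>D Pf\<close> that defines \<open>h\<close>, before division by a power of 2.
\<close>

definition det_pf_sum :: "nat \<Rightarrow> (nat \<Rightarrow> 'a::comm_ring_1) list \<Rightarrow> 'a" where
  "det_pf_sum \<nu> = shuffle_sum (2*\<nu>+1) (\<lambda>a b. det_list (2*\<nu>+1) a * pfaffian_list (polar \<nu>) b)"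

lemma det_pf_sum_swap:
  assumes tf: "\<forall>x :: 'a::comm_ring_1. 2 * x = 0 \<longrightarrow> x = 0"
  shows "det_pf_sum \<nu> (us @ v # w # ys) + det_pf_sum \<nu> (us @ w # v # ys) =
    2 * polar \<nu> v w * det_pf_sum \<nu> (us @ ys :: (nat \<Rightarrow> 'a) list)"
  unfolding det_pf_sum_def
proof (rule shuffle_sum_swap)
  fix us v w ys and b :: "(nat \<Rightarrow> 'a) list"
  show "det_list (2*\<nu>+1) (us @ v # w # ys) * pfaffian_list (polar \<nu>) b +
      det_list (2*\<nu>+1) (us @ w # v # ys) * pfaffian_list (polar \<nu>) b = 0"
    unfolding distrib_right[symmetric] det_list_swap by simp
next
  fix a us v w and ys :: "(nat \<Rightarrow> 'a) list"
  show "det_list (2*\<nu>+1) a * pfaffian_list (polar \<nu>) (us @ v # w # ys) +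
      det_list (2*\<nu>+1) a * pfaffian_list (polar \<nu>) (us @ w # v # ys) =
      2 * polar \<nu> v w * (det_list (2*\<nu>+1) a * pfaffian_list (polar \<nu>) (us @ ys))"
    unfolding distrib_left[symmetric] pfaffian_list_polar_swap[OF tf] by (simp only: ac_simps)
qed

lemma det_pf_sum_expands:
  assumes tf: "\<forall>x :: 'a::comm_ring_1. 2 * x = 0 \<longrightarrow> x = 0"
  shows "det_pf_sum \<nu> (us @ v # ys) =
    (\<Sum>s<2*\<nu>+1. v s * det_pf_sum \<nu> (us @ basis_vec s # ys :: (nat \<Rightarrow> 'a) list))"
  unfolding det_pf_sum_def
proof (rule shuffle_sum_expands)
  fix us v ys and b :: "(nat \<Rightarrow> 'a) list"
  show "det_list (2*\<nu>+1) (us @ v # ys) * pfaffian_list (polar \<nu>) b =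
      (\<Sum>s<2*\<nu>+1. v s * (det_list (2*\<nu>+1) (us @ basis_vec s # ys) * pfaffian_list (polar \<nu>) b))"
    by (subst det_list_expands) (simp only: sum_distrib_right mult.assoc)
next
  fix a us v and ys :: "(nat \<Rightarrow> 'a) list"
  show "det_list (2*\<nu>+1) a * pfaffian_list (polar \<nu>) (us @ v # ys) =
      (\<Sum>s<2*\<nu>+1. v s * (det_list (2*\<nu>+1) a * pfaffian_list (polar \<nu>) (us @ basis_vec s # ys)))"
    by (subst pfaffian_list_polar_expands[OF tf]) (simp only: sum_distrib_left mult.left_commute)
qed

lemma det_list_standard_basis: "det_list n (map basis_vec [0..<n]) = (1 :: 'a::comm_ring_1)"
proof -
  have "mat n n (\<lambda>(r, j). (map basis_vec [0..<n] ! j) r) = (1\<^sub>m n :: 'a mat)"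
    by (auto intro!: eq_matI simp: basis_vec_def)
  moreover have "det_list n (map basis_vec [0..<n]) =
      (det (mat n n (\<lambda>(r, j). (map basis_vec [0..<n] ! j) r)) :: 'a)"
    by (simp add: det_list_def)
  ultimately show ?thesis by (simp only: det_one)
qed

text \<open>
  Induction on the length. Both sides obey the same swap rule, whose right-hand side only involves shorter
  lists, so their difference is alternating, and it suffices to evaluate it at increasing words of odd
  length. For the complete word both trace and sum are 1. For shorter words the determinants are missing
  and the trace vanishes by \<open>incomplete_word_zero\<close>.
\<close>

lemma spin_trace_det_pf_sum:
  fixes vs :: "(nat \<Rightarrow> 'a::comm_ring_1) list"
  assumes tf: "\<forall>x :: 'a. 2 * x = 0 \<longrightarrow> x = 0"
  shows "odd (length vs) \<Longrightarrow>
    2 ^ (length vs div 2) * spin_trace \<nu> vs = 2 ^ \<nu> * det_pf_sum \<nu> vs"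
proof (induction vs rule: length_induct)
  case (1 vs)
  define m where "m = length vs"
  \<comment> \<open>the difference of the two sides, with the exponent fixed to the one for length \<open>m\<close>\<close>
  define F where "F vs = 2 ^ (m div 2) * spin_trace \<nu> vs - 2 ^ \<nu> * det_pf_sum \<nu> vs"
    for vs :: "(nat \<Rightarrow> 'a) list"
  have swap: "F (us @ w # v # ys) = - F (us @ v # w # ys)" if "length (us @ v # w # ys) = m" for us v w ys
  proof -
    have m: "m div 2 = Suc (length (us @ ys) div 2)" using that by auto
    have "2 ^ (length (us @ ys) div 2) * spin_trace \<nu> (us @ ys) = 2 ^ \<nu> * det_pf_sum \<nu> (us @ ys)"
    proof -
      have len: "length vs = Suc (Suc (length (us @ ys)))" using that m_def by simp
      then have "odd (length (us @ ys))" using 1(2) by simp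
      then show ?thesis using 1(1)[rule_format, of "us @ ys"] len by simp
    qed
    then have "2 * polar \<nu> v w * (2 ^ (length (us @ ys) div 2) * spin_trace \<nu> (us @ ys)) =
        2 * polar \<nu> v w * (2 ^ \<nu> * det_pf_sum \<nu> (us @ ys))" by (rule arg_cong)
    then have "2 ^ (m div 2) * (polar \<nu> v w * spin_trace \<nu> (us @ ys)) =
        2 ^ \<nu> * (2 * polar \<nu> v w * det_pf_sum \<nu> (us @ ys))"
      unfolding m power_Suc by (simp only: ac_simps)
    then have "F (us @ v # w # ys) + F (us @ w # v # ys) = 0"
      unfolding spin_trace_swap[symmetric] det_pf_sum_swap[OF tf, symmetric] F_def
      by (simp add: algebra_simps)
    then show ?thesis by (simp add: eq_neg_iff_add_eq_0 add.commute)
  qed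
  have "F vs = 0"
  proof (rule expands_vanish)
    show "expands (2*\<nu>+1) m F"
      unfolding expands_def
    proof (intro allI impI)
      fix us v ys
      show "F (us @ v # ys) = (\<Sum>s<2*\<nu>+1. v s * F (us @ basis_vec s # ys))"
        unfolding F_def
        by (subst spin_trace_expand, subst det_pf_sum_expands[OF tf])
          (simp only: sum_distrib_left sum_subtractf right_diff_distrib mult.left_commute)
    qed
    show "length vs = m" by (simp add: m_def)
  next
    fix w :: "nat list" assume w: "length w = m" "set w \<subseteq> {..<2*\<nu>+1}"
    show "F (map basis_vec w) = 0"
    proof (rule alternating_words_vanish[where m = m and L = "{..<2*\<nu>+1}" and F =
        "\<lambda>w. F (map basis_vec w)"])
      fix us ys :: "nat list" and a b assume "length (us @ a # b # ys) = m"
      then show "F (map basis_vec (us @ b # a # ys)) = - F (map basis_vec (us @ a # b # ys))"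
        using swap[of "map basis_vec us" "basis_vec a" "basis_vec b" "map basis_vec ys"] by simp
    next
      fix us ys :: "nat list" and a assume "length (us @ a # a # ys) = m"
      then have "F (map basis_vec us @ basis_vec a # basis_vec a # map basis_vec ys) =
          - F (map basis_vec us @ basis_vec a # basis_vec a # map basis_vec ys)"
        by (intro swap) simp
      then have "F (map basis_vec (us @ a # a # ys)) = - F (map basis_vec (us @ a # a # ys))"
        by (simp only: map_append list.map)
      then have "F (map basis_vec (us @ a # a # ys)) + F (map basis_vec (us @ a # a # ys)) =
          - F (map basis_vec (us @ a # a # ys)) + F (map basis_vec (us @ a # a # ys))"
        by (rule arg_cong[where f = "\<lambda>x. x + _"])
      then have "2 * F (map basis_vec (us @ a # a # ys)) = 0" by (simp only: left_minus mult_2)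
      then show "F (map basis_vec (us @ a # a # ys)) = 0" using tf by blast
    next
      fix w :: "nat list" assume w: "length w = m" "set w \<subseteq> {..<2*\<nu>+1}" "distinct w" "sorted w"
      have odd: "odd (length w)" using 1 w by (simp add: m_def)
      have card: "card (set w) = length w" using w by (simp add: distinct_card)
      show "F (map basis_vec w) = 0"
      proof (cases "set w = {..<2*\<nu>+1}")
        case True
        then have w_eq: "w = [0..<2*\<nu>+1]"
          using w by (intro sorted_distinct_set_unique) (simp_all add: lessThan_atLeast0 del: upt_Suc)
        then have m: "m div 2 = \<nu>" using w by simp
        have "spin_trace \<nu> (map basis_vec w) = (1 :: 'a)"
          using spin_trace_full_word[of \<nu> 1, where 'a = 'a] by (simp add: w_eq)
        moreover have "det_pf_sum \<nu> (map basis_vec w) = (1 :: 'a)"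
          using shuffle_sum_all_first[of "map basis_vec w :: (nat \<Rightarrow> 'a) list"
            "\<lambda>a b. det_list (2*\<nu>+1) a * pfaffian_list (polar \<nu>) b"] det_list_standard_basis[of
                "2*\<nu>+1", where 'a = 'a]
          by (simp add: w_eq det_pf_sum_def)
        ultimately show ?thesis by (simp add: F_def m)
      next
        case False
        then have "length w < 2*\<nu>+1"
          using card w(2) psubset_card_mono[of "{..<2*\<nu>+1}" "set w"] by auto
        then have "length w < 2*\<nu>" using odd by presburger
        then have "\<not> {..<2*\<nu>} \<subseteq> set w"
          using card card_mono[of "set w" "{..<2*\<nu>}"] by auto
        then have "spin_trace \<nu> (map basis_vec w) = (0 :: 'a)"
          using w odd by (intro clifford_trace.incomplete_word_zero[OF clifford_trace_spin_trace]) auto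
        moreover have "det_pf_sum \<nu> (map basis_vec w) = (0 :: 'a)"
          using \<open>length w < 2*\<nu>+1\<close> by (simp add: det_pf_sum_def shuffle_sum_too_short)
        ultimately show ?thesis by (simp add: F_def)
      qed
    qed (use w in auto)
  qed
  then show ?case by (simp add: F_def m_def)
qed

section \<open>Polynomials in the coordinates of several vectors\<close>

abbreviation lookup :: "('a \<Rightarrow>\<^sub>0 'b::zero) \<Rightarrow> 'a \<Rightarrow> 'b" where
  "lookup \<equiv> Poly_Mapping.lookup"

abbreviation keys :: "('a \<Rightarrow>\<^sub>0 'b::zero) \<Rightarrow> 'a set" where
  "keys \<equiv> Poly_Mapping.keys"

abbreviation single :: "'a \<Rightarrow> 'b::zero \<Rightarrow> 'a \<Rightarrow>\<^sub>0 'b" where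
  "single \<equiv> Poly_Mapping.single"

lemma poly_mapping_eq_sum_single:
  "p = (\<Sum>t\<in>keys p. single t (lookup p t))"
proof (rule poly_mapping_eqI)
  fix s
  show "lookup p s =
      lookup (\<Sum>t\<in>keys p. single t (lookup p t)) s"
    by (simp add: lookup_sum lookup_single when_def in_keys_iff)
qed

definition monomial_value :: "('v \<Rightarrow> 'b::comm_ring_1) \<Rightarrow> ('v \<Rightarrow>\<^sub>0 nat) \<Rightarrow> 'b" where
  "monomial_value \<phi> t = (\<Prod>v\<in>keys t. \<phi> v ^ lookup t v)"

lemma monomial_value_superset:
  assumes "finite A" "keys t \<subseteq> A"
  shows "monomial_value \<phi> t = (\<Prod>v\<in>A. \<phi> v ^ lookup t v)"
  unfolding monomial_value_def by (rule prod.mono_neutral_left) (use assms in \<open>auto simp: in_keys_iff\<close>)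

lemma monomial_value_add: "monomial_value \<phi> (s + t) = monomial_value \<phi> s * monomial_value \<phi> t"
proof -
  let ?A = "keys s \<union> keys t"
  have "monomial_value \<phi> (s + t) = (\<Prod>v\<in>?A. \<phi> v ^ lookup (s + t) v)"
    by (rule monomial_value_superset) (auto simp: Poly_Mapping.keys_add)
  also have "\<dots> = monomial_value \<phi> s * monomial_value \<phi> t"
    by (simp add: lookup_add power_add prod.distrib monomial_value_superset[of ?A])
  finally show ?thesis .
qed

lemma monomial_value_0 [simp]: "monomial_value \<phi> 0 = 1"
  by (simp add: monomial_value_def)

lemma monomial_value_single [simp]: "monomial_value \<phi> (single v 1) = \<phi> v"
  by (simp add: monomial_value_def)

lemma eval_vpoly_eq: "eval_vpoly c \<phi> p =
    (\<Sum>t\<in>keys p. c (lookup p t) * monomial_value \<phi> t)"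
  by (simp add: eval_vpoly_def monomial_value_def)

context comm_ring_hom
begin

lemma eval_vpoly_superset:
  assumes "finite A" "keys p \<subseteq> A"
  shows "eval_vpoly hom \<phi> p = (\<Sum>t\<in>A. hom (lookup p t) * monomial_value \<phi> t)"
  unfolding eval_vpoly_eq by (rule sum.mono_neutral_left) (use assms in \<open>auto simp: in_keys_iff\<close>)

lemma eval_vpoly_add: "eval_vpoly hom \<phi> (p + q) = eval_vpoly hom \<phi> p + eval_vpoly hom \<phi> q"
proof -
  let ?A = "keys p \<union> keys q"
  have "eval_vpoly hom \<phi> (p + q) = (\<Sum>t\<in>?A. hom (lookup (p + q) t) * monomial_value \<phi> t)"
    by (rule eval_vpoly_superset) (auto simp: Poly_Mapping.keys_add)
  also have "\<dots> = eval_vpoly hom \<phi> p + eval_vpoly hom \<phi> q"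
    by (simp add: lookup_add hom_add distrib_right sum.distrib eval_vpoly_superset[of ?A])
  finally show ?thesis .
qed

lemma eval_vpoly_0: "eval_vpoly hom \<phi> 0 = 0"
  by (simp add: eval_vpoly_eq)

lemma eval_vpoly_sum: "eval_vpoly hom \<phi> (sum f A) = (\<Sum>x\<in>A. eval_vpoly hom \<phi> (f x))"
  by (induction A rule: infinite_finite_induct) (auto simp: eval_vpoly_0 eval_vpoly_add)

lemma eval_vpoly_single: "eval_vpoly hom \<phi> (single t a) = hom a * monomial_value \<phi> t"
  by (simp add: eval_vpoly_eq)

lemma eval_vpoly_mult: "eval_vpoly hom \<phi> (p * q) = eval_vpoly hom \<phi> p * eval_vpoly hom \<phi> q"
proof -
  let ?s = "\<lambda>p t. single t (lookup p t)"
  have "p * q = (\<Sum>t\<in>keys p. \<Sum>u\<in>keys q. ?s p t * ?s q u)"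
    by (subst poly_mapping_eq_sum_single[of p], subst poly_mapping_eq_sum_single[of q]) (rule sum_product)
  then have "eval_vpoly hom \<phi> (p * q) =
      (\<Sum>t\<in>keys p. \<Sum>u\<in>keys q. eval_vpoly hom \<phi> (?s p t * ?s q u))"
    by (simp add: eval_vpoly_sum)
  also have "\<dots> = (\<Sum>t\<in>keys p. \<Sum>u\<in>keys q.
      (hom (lookup p t) * monomial_value \<phi> t) * (hom (lookup q u) * monomial_value \<phi> u))"
    by (simp add: mult_single eval_vpoly_single monomial_value_add hom_mult ac_simps)
  also have "\<dots> = eval_vpoly hom \<phi> p * eval_vpoly hom \<phi> q"
    unfolding eval_vpoly_eq by (rule sum_product[symmetric])
  finally show ?thesis .
qed

lemma eval_vpoly_Const: "eval_vpoly hom \<phi> (Const a) = hom a"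
  by (simp add: Const_def eval_vpoly_single)

lemma eval_vpoly_Var: "eval_vpoly hom \<phi> (Var i r) = \<phi> (i, r)"
  unfolding Var_def eval_vpoly_single monomial_value_single by simp

lemma comm_ring_hom_eval_vpoly: "comm_ring_hom (eval_vpoly hom \<phi>)"
proof unfold_locales
  show "eval_vpoly hom \<phi> 1 = 1"
    using eval_vpoly_Const[of \<phi> 1] by (simp add: Const_def)
qed (simp_all add: eval_vpoly_0 eval_vpoly_add eval_vpoly_mult)

end

lemma comm_ring_hom_Const: "comm_ring_hom Const"
  by unfold_locales (simp_all add: Const_def single_add mult_single)

lemma comm_ring_hom_id: "comm_ring_hom (\<lambda>x :: 'a::comm_ring_1. x)"
  by unfold_locales simp_all

lemma comm_ring_hom_of_int: "comm_ring_hom (of_int :: int \<Rightarrow> 'a::comm_ring_1)"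
  by unfold_locales simp_all

lemma comm_ring_hom_comp:
  "comm_ring_hom f \<Longrightarrow> comm_ring_hom g \<Longrightarrow> comm_ring_hom (\<lambda>x. f (g x))"
proof -
  assume "comm_ring_hom f" "comm_ring_hom g"
  then interpret f: comm_ring_hom f + g: comm_ring_hom g .
  show ?thesis
    by unfold_locales (simp_all add: f.hom_add g.hom_add f.hom_mult g.hom_mult)
qed

text \<open>
  The exponent vector obtained by renaming the variables by \<open>\<sigma>\<close>, which may identify variables.
\<close>

definition monomial_image :: "('v \<Rightarrow> 'w) \<Rightarrow> ('v \<Rightarrow>\<^sub>0 nat) \<Rightarrow> ('w \<Rightarrow>\<^sub>0 nat)" where
  "monomial_image \<sigma> t = (\<Sum>v\<in>keys t. single (\<sigma> v) (lookup t v))"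

lemma single_power: "single (single v (1::nat)) c ^ k =
    single (single v k) (c ^ k :: 'a::comm_ring_1)"
  by (induction k) (simp_all add: mult_single flip: single_add)

lemma prod_single: "finite A \<Longrightarrow> (\<Prod>x\<in>A. single (f x) (c x)) =
    single (\<Sum>x\<in>A. f x :: 'v \<Rightarrow>\<^sub>0 nat) (\<Prod>x\<in>A. c x :: 'a::comm_ring_1)"
  by (induction A rule: finite_induct) (simp_all add: mult_single)

lemma monomial_value_monomial:
  "monomial_value (\<lambda>v. Const (a v) * Var (fst (\<sigma> v)) (snd (\<sigma> v))) t =
     single (monomial_image \<sigma> t) (monomial_value a t :: 'a::comm_ring_1)"
  by (simp add: monomial_value_def Const_def Var_def mult_single single_power prod_single
      monomial_image_def del: One_nat_def)

lemma eval_vpoly_map_coeff: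
  "comm_ring_hom h \<Longrightarrow> Poly_Mapping.map h p = eval_vpoly (\<lambda>c. Const (h c)) (\<lambda>(i, r). Var i r) p"
proof (rule poly_mapping_eqI)
  fix s assume "comm_ring_hom h"
  then interpret comm_ring_hom h .
  have "monomial_value (\<lambda>(i, r). Var i r) t = (single t 1 :: 'b vpoly)" for t
  proof -
    have "monomial_image id t = t"
      unfolding monomial_image_def by (simp flip: poly_mapping_eq_sum_single)
    moreover have "monomial_value (\<lambda>_. 1 :: 'b) t = 1" by (simp add: monomial_value_def)
    ultimately show ?thesis
      using monomial_value_monomial[of "\<lambda>_. 1 :: 'b" id t] by (simp add: Const_def case_prod_unfold)
  qed
  then show "lookup (Poly_Mapping.map h p) s =
      lookup (eval_vpoly (\<lambda>c. Const (h c)) (\<lambda>(i, r). Var i r) p) s"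
    by (simp add: eval_vpoly_eq Const_def mult_single lookup_sum lookup_single when_def
        Poly_Mapping.map.rep_eq in_keys_iff)
qed

text \<open>
  Multilinearity for an arbitrary index set in place of \<open>{..<m}\<close>, so that it can be built up one
      vector at a time.
\<close>

definition multilinear_in :: "nat set \<Rightarrow> nat \<Rightarrow> 'a::comm_ring_1 vpoly \<Rightarrow> bool" where
  "multilinear_in I n p \<longleftrightarrow> (\<forall>t\<in>keys p. keys t \<subseteq> I \<times> {..<n} \<and>
     (\<forall>i\<in>I. (\<Sum>r<n. lookup t (i, r)) = 1))"

lemma multilinear_eq: "multilinear n m p \<longleftrightarrow> multilinear_in {..<m} n p"
  by (auto simp: multilinear_def multilinear_in_def poly_ring_def)

lemma multilinear_in_sum:
  "(\<And>s. s \<in> A \<Longrightarrow> multilinear_in I n (f s)) \<Longrightarrow> multilinear_in I n (sum f A)"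
  using Poly_Mapping.keys_sum[of f A] unfolding multilinear_in_def by blast

lemma multilinear_in_Var_mult:
  assumes "multilinear_in I n p" "i \<notin> I" "s < n"
  shows "multilinear_in (insert i I) n (Var i s * p)"
  unfolding multilinear_in_def
proof (intro ballI conjI)
  fix t assume "t \<in> keys (Var i s * p)"
  then obtain u where u: "u \<in> keys p" and t: "t = single (i, s) 1 + u"
    using keys_mult[of "Var i s" p] by (auto simp: Var_def split: if_splits)
  have sup: "keys u \<subseteq> I \<times> {..<n}" using assms(1) u by (auto simp: multilinear_in_def)
  then show "keys t \<subseteq> insert i I \<times> {..<n}"
    using Poly_Mapping.keys_add[of "single (i, s) 1" u] assms(3) unfolding t by auto
  fix j assume j: "j \<in> insert i I"
  show "(\<Sum>r<n. lookup t (j, r)) = 1"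
  proof (cases "j = i")
    case True
    then have "lookup u (j, r) = 0" for r
      using sup assms(2) by (auto simp flip: not_in_keys_iff_lookup_eq_zero)
    then show ?thesis using True assms(3) by (simp add: t lookup_add lookup_single when_def)
  next
    case False
    then show ?thesis
      using assms(1) u j by (simp add: t lookup_add lookup_single when_def multilinear_in_def)
  qed
qed

lemma spin_trace_basis_Const:
  "spin_trace \<nu> (map basis_vec w) = Const (spin_trace \<nu> (map basis_vec w) :: 'a::comm_ring_1)"
proof -
  interpret comm_ring_hom "Const :: 'a \<Rightarrow> 'a vpoly" by (rule comm_ring_hom_Const)
  have "(\<lambda>r. Const (basis_vec s r :: 'a)) = basis_vec s" for s
    by (rule ext) (simp add: basis_vec_def)
  then show ?thesis by (simp add: hom_spin_trace o_def)
qed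

text \<open>
  The induction replaces generic vectors by basis vectors from the left; a trace of basis vectors is
      a constant.
\<close>

lemma multilinear_in_spin_trace:
  assumes "distinct is"
  shows "multilinear_in (set is) (2*\<nu>+1)
    (spin_trace \<nu> (map basis_vec w @ map Var is) :: 'a::comm_ring_1 vpoly)"
  using assms
proof (induction "is" arbitrary: w)
  case Nil
  have "keys (Const c :: 'a vpoly) \<subseteq> {0}" for c
    by (simp add: Const_def)
  then show ?case
    using spin_trace_basis_Const[of \<nu> w, where 'a = 'a] by (auto simp: multilinear_in_def)
next
  case (Cons i js)
  have "spin_trace \<nu> (map basis_vec w @ map Var (i # js)) =
      (\<Sum>s<2*\<nu>+1. Var i s * (spin_trace \<nu> (map basis_vec (w @ [s]) @ map Var js) :: 'a vpoly))"
    unfolding list.map by (subst spin_trace_expand) (simp del: sum.lessThan_Suc)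
  also have "multilinear_in (set (i # js)) (2*\<nu>+1) \<dots>"
    unfolding list.set by (intro multilinear_in_sum multilinear_in_Var_mult Cons.IH)
        (use Cons.prems in auto)
  finally show ?case .
qed

text \<open>
  The monomial that takes from each vector with index \<open>j \<in> S\<close> its coordinate \<open>\<tau> j\<close>.
\<close>

definition sqfree_monomial :: "(nat \<Rightarrow> nat) \<Rightarrow> nat set \<Rightarrow> (nat \<times> nat) \<Rightarrow>\<^sub>0 nat" where
  "sqfree_monomial \<tau> S = (\<Sum>j\<in>S. single (j, \<tau> j) 1)"

lemma lookup_sqfree_monomial:
  "finite S \<Longrightarrow> lookup (sqfree_monomial \<tau> S) (j, c) = (if j \<in> S \<and> c = \<tau> j then 1 else 0)"
proof -
  assume "finite S"
  have "lookup (sqfree_monomial \<tau> S) (j, c) = (\<Sum>i\<in>S. if j = i then if c = \<tau> j then 1 else 0 else 0)"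
    unfolding sqfree_monomial_def lookup_sum by (intro sum.cong) (auto simp: lookup_single when_def)
  then show ?thesis using \<open>finite S\<close> by (simp add: sum.delta')
qed

lemma keys_sqfree_monomial:
  "finite S \<Longrightarrow> keys (sqfree_monomial \<tau> S) = (\<lambda>j. (j, \<tau> j)) ` S"
  by (auto simp: in_keys_iff lookup_sqfree_monomial split: if_splits)

text \<open>
  At the point whose \<open>i\<close>-th vector is the basis vector \<open>e\<^bsub>\<tau> i\<^esub>\<close>, one single multilinear monomial is nonzero.
\<close>

lemma multilinear_in_coefficient:
  assumes "multilinear_in I n p" "finite I" "\<And>i. i \<in> I \<Longrightarrow> \<tau> i < n"
  shows "eval_vpoly (\<lambda>c. c) (\<lambda>(i, r). basis_vec (\<tau> i) r) p =
    lookup p (sqfree_monomial \<tau> I)"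
proof -
  let ?M = "sqfree_monomial \<tau> I" and ?\<phi> = "\<lambda>(i, r). basis_vec (\<tau> i) r :: 'a"
  have "monomial_value ?\<phi> t = (if t = ?M then 1 else 0)" if t: "t \<in> keys p" for t
  proof (cases "t = ?M")
    case True
    have "monomial_value ?\<phi> ?M = 1"
      unfolding monomial_value_def
      by (rule prod.neutral) (auto simp: keys_sqfree_monomial[OF assms(2)] basis_vec_def)
    then show ?thesis using True by simp
  next
    case False
    have "\<exists>v\<in>keys t. ?\<phi> v = 0"
    proof (rule ccontr)
      assume "\<not> (\<exists>v\<in>keys t. ?\<phi> v = 0)"
      then have supp: "(i, r) \<in> keys t \<Longrightarrow> r = \<tau> i" for i r
        by (auto simp: basis_vec_def split: if_splits)
      have "t = ?M"
      proof (rule poly_mapping_eqI, clarify)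
        fix i r
        show "lookup t (i, r) = lookup ?M (i, r)"
        proof (cases "i \<in> I \<and> r = \<tau> i")
          case True
          have "(\<Sum>r<n. lookup t (i, r)) = lookup t (i, \<tau> i)"
            using supp True assms(3)
            by (subst sum.mono_neutral_right[of _ "{\<tau> i}"]) (auto simp: in_keys_iff)
          then show ?thesis
            using True assms(1,2) t by (simp add: lookup_sqfree_monomial multilinear_in_def)
        next
          case False
          then have "(i, r) \<notin> keys t"
            using supp assms(1) t by (auto simp: multilinear_in_def)
          then show ?thesis
            using False assms(2) by (auto simp: lookup_sqfree_monomial in_keys_iff)
        qed
      qed
      then show False using False by simp
    qed
    then obtain v where "v \<in> keys t" "?\<phi> v = 0" by blast
    then have "monomial_value ?\<phi> t = 0"
      unfolding monomial_value_def
      by (intro prod_zero bexI[of _ v]) (auto simp: in_keys_iff zero_power)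
    then show ?thesis using False by simp
  qed
  then have "eval_vpoly (\<lambda>c. c) ?\<phi> p = (\<Sum>t\<in>keys p. if t = ?M then lookup p t else 0)"
    unfolding eval_vpoly_eq by (intro sum.cong) auto
  then show ?thesis by (simp add: in_keys_iff)
qed

section \<open>The two polynomials as spin traces\<close>

lemma int_vpoly_two_torsion_free: "\<forall>x :: int vpoly. 2 * x = 0 \<longrightarrow> x = 0"
proof (intro allI impI poly_mapping_eqI)
  fix x :: "int vpoly" and t
  assume "2 * x = 0"
  then have "x + x = 0" by (simp only: mult_2)
  then have "lookup (x + x) t = lookup 0 t" by (rule arg_cong)
  then show "lookup x t = lookup 0 t"
    unfolding lookup_add lookup_zero by linarith
qed

lemma Const_two_power: "Const (2 ^ e) = (2 ^ e :: 'a::comm_ring_1 vpoly)"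
proof -
  interpret comm_ring_hom "Const :: 'a \<Rightarrow> 'a vpoly" by (rule comm_ring_hom_Const)
  show ?thesis by (simp add: hom_distribs)
qed

lemma Bpoly_eq_polar: "Bpoly (2*\<nu>+1) i j = polar \<nu> (Var i) (Var j)"
  by (simp add: Bpoly_def polar_def)

lemma Pfpoly_eq_polar:
  assumes "even (length is)"
  shows "Pfpoly (2*\<nu>+1) is = pfaffian_list (polar \<nu>) (map Var is)"
  unfolding Pfpoly_eq_pfaffian_list[OF assms] pfaffian_list_map
  by (rule arg_cong[where f = "\<lambda>b. pfaffian_list b is"]) (intro ext Bpoly_eq_polar)

text \<open>
  The common factor \<open>2\<^sup>\<nu>\<close> of both Wick formulas is cancelled here.
\<close>

lemma div_pow2_eq:
  assumes "2 ^ \<mu> * T = 2 ^ \<nu> * P" "\<nu> \<le> \<mu>"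
  shows "div_pow2 (\<mu> - \<nu>) P = T"
proof (rule div_pow2_eqI)
  have "(2 :: int vpoly) ^ \<mu> = 2 ^ \<nu> * 2 ^ (\<mu> - \<nu>)" using assms(2) by (simp flip: power_add)
  then have "2 ^ \<nu> * (2 ^ (\<mu> - \<nu>) * T) = 2 ^ \<nu> * P" using assms(1) by (simp add: mult.assoc)
  from cancel_two_power[OF int_vpoly_two_torsion_free this]
  show "Const (2 ^ (\<mu> - \<nu>)) * T = P" by (simp only: Const_two_power)
qed

lemma gtilde_eq_spin_trace:
  assumes "even m" "m \<ge> 2*\<nu>+1"
  shows "gtilde (2*\<nu>+1) m = spin_trace \<nu> (map Var [0..<m])"
  unfolding gtilde_def
proof (subst Pfpoly_eq_polar)
  show "div_pow2 (m div 2 - (2*\<nu>+1) div 2) (pfaffian_list (polar \<nu>) (map Var [0..<m])) =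
      spin_trace \<nu> (map Var [0..<m])"
    using spin_trace_pfaffian_list[of "map Var [0..<m] :: (nat \<Rightarrow> int vpoly) list" \<nu>] assms
    by (subst (2) div_pow2_eq[symmetric]) auto
qed (use assms in simp)

lemma htilde_sum_eq:
  assumes "odd m" "m \<ge> 2*\<nu>+1"
  shows "(\<Sum>\<pi> | \<pi> permutes {..<m} \<and> strict_mono_on {..<2*\<nu>+1} \<pi> \<and> strict_mono_on {2*\<nu>+1..<m} \<pi>.
        of_int (sign \<pi>) * Dpoly (2*\<nu>+1) (map \<pi> [0..<2*\<nu>+1]) * Pfpoly (2*\<nu>+1) (map \<pi> [2*\<nu>+1..<m])) =
    det_pf_sum \<nu> (map Var [0..<m])"
proof -
  let ?n = "2*\<nu>+1" and ?xs = "map Var [0..<m] :: (nat \<Rightarrow> int vpoly) list"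
  have "det_pf_sum \<nu> ?xs = (\<Sum>\<pi>\<in>shuffle_perms ?n m. of_int (sign \<pi>) *
      (det_list ?n (map (\<lambda>i. ?xs ! \<pi> i) [0..<?n]) * pfaffian_list (polar \<nu>) (map
          (\<lambda>i. ?xs ! \<pi> i) [?n..<m])))"
    using sum_shuffle_perms[of ?n ?xs "\<lambda>a b. det_list ?n a * pfaffian_list (polar \<nu>) b"] assms(2)
    by (simp add: det_pf_sum_def del: upt_Suc)
  also have "\<dots> = (\<Sum>\<pi>\<in>shuffle_perms ?n m. of_int (sign \<pi>) *
      Dpoly ?n (map \<pi> [0..<?n]) * Pfpoly ?n (map \<pi> [?n..<m]))"
  proof (rule sum.cong[OF refl])
    fix \<pi> assume "\<pi> \<in> shuffle_perms ?n m"
    then have "\<pi> i < m" if "i < m" for i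
      using that permutes_in_image[of \<pi> "{0..<m}" i] by (simp add: shuffle_perms_def)
    then have nth: "map (\<lambda>i. ?xs ! \<pi> i) [a..<b] = map Var (map \<pi> [a..<b])" if "b \<le> m" for a b
      using that by simp
    have "det_list ?n (map Var (map \<pi> [0..<?n])) = Dpoly ?n (map \<pi> [0..<?n])"
      unfolding det_list_def Dpoly_def
      by (auto simp del: upt_Suc intro!: arg_cong[where f = det] eq_matI)
    moreover have "even (length (map \<pi> [?n..<m]))" using assms by simp
    ultimately show "of_int (sign \<pi>) *
        (det_list ?n (map (\<lambda>i. ?xs ! \<pi> i) [0..<?n]) * pfaffian_list (polar \<nu>) (map
            (\<lambda>i. ?xs ! \<pi> i) [?n..<m])) =
        of_int (sign \<pi>) * Dpoly ?n (map \<pi> [0..<?n]) * Pfpoly ?n (map \<pi> [?n..<m])"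
      using nth[of ?n 0] nth[of m ?n] assms(2) by (simp only: Pfpoly_eq_polar mult.assoc)
  qed
  finally show ?thesis by (simp only: shuffle_perms_def lessThan_atLeast0)
qed

lemma htilde_eq_spin_trace:
  assumes "odd m" "m \<ge> 2*\<nu>+1"
  shows "htilde (2*\<nu>+1) m = spin_trace \<nu> (map Var [0..<m])"
  unfolding htilde_def htilde_sum_eq[OF assms]
  using spin_trace_det_pf_sum[OF int_vpoly_two_torsion_free, of "map Var [0..<m]" \<nu>] assms
  by (subst (2) div_pow2_eq[symmetric]) auto

lemma map_of_int_spin_trace:
  "Poly_Mapping.map of_int (spin_trace \<nu> (map Var is)) =
     (spin_trace \<nu> (map Var is) :: 'a::comm_ring_1 vpoly)"
proof -
  have h: "comm_ring_hom (\<lambda>c :: int. Const (of_int c :: 'a))"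
    by (rule comm_ring_hom_comp[OF comm_ring_hom_Const comm_ring_hom_of_int])
  interpret c: comm_ring_hom "\<lambda>c :: int. Const (of_int c :: 'a)" by (rule h)
  interpret e: comm_ring_hom "eval_vpoly (\<lambda>c :: int. Const (of_int c :: 'a)) (\<lambda>(i, r). Var i r)"
    by (rule c.comm_ring_hom_eval_vpoly)
  show ?thesis
    by (simp add: eval_vpoly_map_coeff[OF comm_ring_hom_of_int] e.hom_spin_trace o_def
        c.eval_vpoly_Var)
qed

lemma gpoly_eq_spin_trace:
  assumes "even m" "m \<ge> 2*\<nu>+1"
  shows "gpoly (2*\<nu>+1) m = spin_trace \<nu> (map Var [0..<m])"
  unfolding gpoly_def gtilde_eq_spin_trace[OF assms] by (rule map_of_int_spin_trace)

lemma hpoly_eq_spin_trace: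
  assumes "odd m" "m \<ge> 2*\<nu>+1"
  shows "hpoly (2*\<nu>+1) m = spin_trace \<nu> (map Var [0..<m])"
  unfolding hpoly_def htilde_eq_spin_trace[OF assms] by (rule map_of_int_spin_trace)

section \<open>Invariance under the orthogonal group\<close>

lemma quad_add: "quad \<nu> (\<lambda>r. v r + w r) = quad \<nu> v + quad \<nu> w + polar \<nu> v w"
  by (simp add: quad_def polar_def sum.distrib power2_eq_square algebra_simps)

lemma quad_cong: "(\<And>r. r \<le> 2*\<nu> \<Longrightarrow> v r = w r) \<Longrightarrow> quad \<nu> v = quad \<nu> w"
  by (simp add: quad_def)

lemma polar_cong:
  "(\<And>r. r \<le> 2*\<nu> \<Longrightarrow> v r = v' r) \<Longrightarrow> (\<And>r. r \<le> 2*\<nu> \<Longrightarrow> w r = w' r) \<Longrightarrow> polar \<nu> v w = polar \<nu> v' w'"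
  by (simp add: polar_def)

lemma spin_block_cong: "(\<And>r. r < 2*k \<Longrightarrow> v r = w r) \<Longrightarrow> spin_block z k v = spin_block z k w"
  by (induction k) auto

lemma spin_trace_cong:
  assumes "\<And>x r. x \<in> set xs \<Longrightarrow> r \<le> 2*\<nu> \<Longrightarrow> f x r = g x r"
  shows "spin_trace \<nu> (map f xs) = spin_trace \<nu> (map g xs)"
proof -
  have "spin_prod \<nu> (map f xs) = spin_prod \<nu> (map g xs)"
    using assms
  proof (induction xs)
    case (Cons x xs)
    have "spin \<nu> (f x) = spin \<nu> (g x)"
      using Cons.prems[of x] unfolding spin_def by (auto intro: spin_block_cong)
    then show ?case using Cons by simp
  qed simp
  then show ?thesis by (simp add: spin_trace_def)
qed

text \<open>
  The action of a matrix on coordinate functions. It is linear over the coefficients of the vectors, so an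
  orthogonal matrix over a field can act on generic vectors.
\<close>

definition lin_act :: "nat \<Rightarrow> (nat \<Rightarrow> nat \<Rightarrow> 'a::comm_ring_1) \<Rightarrow> (nat \<Rightarrow> 'a) \<Rightarrow> nat \<Rightarrow> 'a" where
  "lin_act n a v = (\<lambda>r. \<Sum>s<n. a r s * v s)"

lemma lin_act_basis: "s < n \<Longrightarrow> lin_act n a (basis_vec s) r = a r s"
  by (simp add: lin_act_def basis_vec_def if_distrib[where f = "\<lambda>x. _ * x"] cong: if_cong)

lemma lin_act_add: "lin_act n a (\<lambda>r. v r + w r) = (\<lambda>r. lin_act n a v r + lin_act n a w r)"
  by (simp add: lin_act_def distrib_left sum.distrib)

lemma spin_trace_lin_act_expands:
  "expands (2*\<nu>+1) m (\<lambda>vs. spin_trace \<nu> (map (lin_act (2*\<nu>+1) a) vs))"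
  unfolding expands_def
proof (intro allI impI)
  fix us v and ys :: "(nat \<Rightarrow> 'a) list"
  let ?n = "2*\<nu>+1"
  let ?g = "lin_act ?n a"
  let ?F = "\<lambda>r. spin_trace \<nu> (map ?g us @ basis_vec r # map ?g ys)"
  have e: "spin_trace \<nu> (map ?g (us @ u # ys)) = (\<Sum>r<?n. ?g u r * ?F r)" for u
    unfolding map_append list.map by (rule spin_trace_expand)
  have "spin_trace \<nu> (map ?g (us @ v # ys)) = (\<Sum>r<?n. \<Sum>s<?n. a r s * v s * ?F r)"
    unfolding e lin_act_def sum_distrib_right ..
  also have "\<dots> = (\<Sum>s<?n. \<Sum>r<?n. a r s * v s * ?F r)" by (rule sum.swap)
  also have "\<dots> = (\<Sum>s<?n. v s * spin_trace \<nu> (map ?g (us @ basis_vec s # ys)))"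
    unfolding e sum_distrib_left by (intro sum.cong refl) (simp add: lin_act_basis ac_simps)
  finally show "spin_trace \<nu> (map ?g (us @ v # ys)) =
      (\<Sum>s<?n. v s * spin_trace \<nu> (map ?g (us @ basis_vec s # ys)))" .
qed

lemma expands_diff:
  assumes "expands n m F" "expands n m G"
  shows "expands n m (\<lambda>vs. F vs - c * G vs)"
  unfolding expands_def
proof (intro allI impI)
  fix us v and ys :: "(nat \<Rightarrow> 'a) list"
  assume l: "length (us @ v # ys) = m"
  have "F (us @ v # ys) = (\<Sum>s<n. v s * F (us @ basis_vec s # ys))"
    "G (us @ v # ys) = (\<Sum>s<n. v s * G (us @ basis_vec s # ys))"
    using assms l unfolding expands_def by blast+
  then show "F (us @ v # ys) - c * G (us @ v # ys) =
      (\<Sum>s<n. v s * (F (us @ basis_vec s # ys) - c * G (us @ basis_vec s # ys)))"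
    by (simp only: sum_distrib_left sum_subtractf right_diff_distrib mult.left_commute)
qed

lemma clifford_trace_diff:
  assumes "clifford_trace \<nu> F" "clifford_trace \<nu> G"
  shows "clifford_trace \<nu> (\<lambda>w. F w - c * G w)"
proof -
  interpret F: clifford_trace \<nu> F by (rule assms)
  interpret G: clifford_trace \<nu> G by (rule assms)
  show ?thesis
  proof
    fix us ys :: "nat list" and a b
    assume s: "set (us @ a # b # ys) \<subseteq> {..2*\<nu>}"
    have "F (us @ a # b # ys) - c * G (us @ a # b # ys) + (F (us @ b # a # ys) - c * G (us @ b # a # ys)) =
      (F (us @ a # b # ys) + F (us @ b # a # ys)) - c * (G (us @ a # b # ys) + G (us @ b # a # ys))"
      by (simp add: algebra_simps)
    then show "F (us @ a # b # ys) - c * G (us @ a # b # ys) + (F (us @ b # a # ys) - c * G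
        (us @ b # a # ys)) =
      polar \<nu> (basis_vec a) (basis_vec b) * (F (us @ ys) - c * G (us @ ys))"
      unfolding F.swap[OF s] G.swap[OF s] by (simp add: algebra_simps)
  next
    fix us ys :: "nat list" and a
    assume s: "set (us @ a # a # ys) \<subseteq> {..2*\<nu>}"
    show "F (us @ a # a # ys) - c * G (us @ a # a # ys) =
      quad \<nu> (basis_vec a) * (F (us @ ys) - c * G (us @ ys))"
      unfolding F.square[OF s] G.square[OF s] by (simp add: algebra_simps)
  next
    fix us ys
    show "F (us @ ys) - c * G (us @ ys) = F (ys @ us) - c * G (ys @ us)"
      using F.rotate[of us ys] G.rotate[of us ys] by simp
  qed
qed

lemma qform_vec: "qform (2*\<nu>+1) (vec (2*\<nu>+1) v) = quad \<nu> v"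
  by (simp add: qform_def quad_def)

lemma mult_mat_vec_eq_lin_act:
  assumes "A \<in> carrier_mat n n"
  shows "A *\<^sub>v vec n v = vec n (lin_act n (\<lambda>r s. A $$ (r, s)) v)"
  using assms by (intro eq_vecI) (auto simp: scalar_prod_def lin_act_def atLeast0LessThan intro!: sum.cong)

lemma orthogonal_quad:
  assumes "A \<in> orthogonal_group (2*\<nu>+1)"
  shows "quad \<nu> (lin_act (2*\<nu>+1) (\<lambda>r s. A $$ (r, s)) v) = quad \<nu> v"
proof -
  let ?n = "2*\<nu>+1"
  have A: "A \<in> carrier_mat ?n ?n" and q: "qform ?n (A *\<^sub>v vec ?n v) = qform ?n (vec ?n v)"
    using assms by (auto simp: orthogonal_group_def)
  show ?thesis using q unfolding mult_mat_vec_eq_lin_act[OF A] qform_vec .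
qed

lemma orthogonal_polar:
  assumes "A \<in> orthogonal_group (2*\<nu>+1)"
  defines "g \<equiv> lin_act (2*\<nu>+1) (\<lambda>r s. A $$ (r, s))"
  shows "polar \<nu> (g v) (g w) = polar \<nu> v w"
proof -
  have "quad \<nu> (g v) + quad \<nu> (g w) + polar \<nu> (g v) (g w) = quad \<nu> v + quad \<nu> w + polar \<nu> v w"
    using orthogonal_quad[OF assms(1), of "\<lambda>r. v r + w r"]
    unfolding g_def[symmetric] quad_add[symmetric] by (simp add: g_def lin_act_add)
  then show ?thesis by (simp add: g_def orthogonal_quad[OF assms(1)] del: One_nat_def)
qed

lemma orthogonal_inverse:
  assumes "A \<in> orthogonal_group n"
  obtains B where "B \<in> orthogonal_group n" "A * B = 1\<^sub>m n" "B * A = 1\<^sub>m n"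
proof -
  have A: "A \<in> carrier_mat n n" and inv: "invertible_mat A"
    and q: "\<And>v. v \<in> carrier_vec n \<Longrightarrow> qform n (A *\<^sub>v v) = qform n v"
    using assms by (auto simp: orthogonal_group_def)
  obtain B where B: "A * B = 1\<^sub>m n" "B * A = 1\<^sub>m (dim_row B)"
    using inv A by (auto simp: invertible_mat_def inverts_mat_def)
  have c: "B \<in> carrier_mat n n"
  proof
    show "dim_col B = n" using arg_cong[OF B(1), of dim_col] by simp
    show "dim_row B = n" using arg_cong[OF B(2), of dim_col] A by simp
  qed
  have "qform n (B *\<^sub>v v) = qform n v" if v: "v \<in> carrier_vec n" for v
  proof -
    have "A *\<^sub>v (B *\<^sub>v v) = v"
      using assoc_mult_mat_vec[OF A c v] B(1) v by simp
    then show ?thesis using q[of "B *\<^sub>v v"] c v by simp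
  qed
  moreover have "invertible_mat B"
    unfolding invertible_mat_def inverts_mat_def using A B c by auto
  ultimately have "B \<in> orthogonal_group n" using c by (simp add: orthogonal_group_def)
  then show ?thesis using that B c by simp
qed

lemma lin_act_inverse:
  assumes "A \<in> carrier_mat n n" "B \<in> carrier_mat n n" "A * B = 1\<^sub>m n" "r < n"
  shows "lin_act n (\<lambda>r s. A $$ (r, s)) (lin_act n (\<lambda>r s. B $$ (r, s)) v) r = v r"
proof -
  have "vec n (lin_act n (\<lambda>r s. A $$ (r, s)) (lin_act n (\<lambda>r s. B $$ (r, s)) v)) = A *\<^sub>v (B *\<^sub>v vec n v)"
    by (simp only: mult_mat_vec_eq_lin_act[OF assms(1)] mult_mat_vec_eq_lin_act[OF assms(2)])
  also have "\<dots> = vec n v"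
    using assoc_mult_mat_vec[OF assms(1,2), of "vec n v"] assms(3) by simp
  finally show ?thesis using assms(4) by (metis index_vec)
qed

text \<open>
  In characteristic 2 the last basis vector is orthogonal to everything. So is its image under \<open>A\<close>,
      as \<open>A\<close> is
  surjective; hence the image is a multiple \<open>c e\<^sub>z\<close> and \<open>c\<^sup>2 = q(c e\<^sub>z) = 1\<close>.
\<close>

lemma orthogonal_fixes_radical:
  fixes A :: "'a::field mat"
  assumes two: "(1 :: 'a) + 1 = 0" and A: "A \<in> orthogonal_group (2*\<nu>+1)" and r: "r \<le> 2*\<nu>"
  shows "lin_act (2*\<nu>+1) (\<lambda>r s. A $$ (r, s)) (basis_vec (2*\<nu>)) r = basis_vec (2*\<nu>) r"
proof -
  let ?n = "2*\<nu>+1" and ?z = "basis_vec (2*\<nu>) :: nat \<Rightarrow> 'a"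
  define g where "g = lin_act ?n (\<lambda>r s. A $$ (r, s))"
  obtain B where B: "B \<in> orthogonal_group ?n" "A * B = 1\<^sub>m ?n"
    using orthogonal_inverse[OF A] by metis
  define h where "h = lin_act ?n (\<lambda>r s. B $$ (r, s))"
  have two': "(2 :: 'a) = 0" using two by simp
  have carr: "A \<in> carrier_mat ?n ?n" "B \<in> carrier_mat ?n ?n"
    using A B(1) by (auto simp: orthogonal_group_def)
  have orth: "polar \<nu> w (g ?z) = 0" for w
  proof -
    have "polar \<nu> w (g ?z) = polar \<nu> (g (h w)) (g ?z)"
      by (rule polar_cong) (simp_all add: g_def h_def lin_act_inverse[OF carr B(2)] del: One_nat_def)
    also have "\<dots> = polar \<nu> ?z (h w)"
      unfolding g_def orthogonal_polar[OF A] by (rule polar_commute)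
    also have "\<dots> = 0" by (simp add: polar_basis_last two')
    finally show ?thesis .
  qed
  have zero: "g ?z s = 0" if "s < 2*\<nu>" for s
  proof -
    have "s div 2 < \<nu>" using that by auto
    then show ?thesis
      using orth[of "basis_vec (2*(s div 2)+1)"] orth[of "basis_vec (2*(s div 2))"]
        polar_basis_left[of "s div 2" \<nu> "g ?z"] by (cases "even s") auto
  qed
  have "quad \<nu> (g ?z) = quad \<nu> ?z" unfolding g_def by (rule orthogonal_quad[OF A])
  then have "(g ?z (2*\<nu>))\<^sup>2 = 1"
    using zero by (simp add: quad_def basis_vec_def)
  then have "g ?z (2*\<nu>) = 1 \<or> g ?z (2*\<nu>) = - 1" by (rule power2_eq_1_iff[THEN iffD1])
  moreover have "(- 1 :: 'a) = 1" using two by (simp add: eq_neg_iff_add_eq_0 minus_equation_iff)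
  ultimately have "g ?z (2*\<nu>) = 1" by auto
  then have "g ?z r = ?z r"
    using zero[of r] r by (cases "r = 2*\<nu>") (simp_all add: basis_vec_def)
  then show ?thesis by (simp only: g_def)
qed

text \<open>
  The transformed trace satisfies the same rules on words, so it differs from the trace by a scalar, which
  is read off at the complete word of length \<open>2 * \<nu>\<close>.
\<close>

lemma orthogonal_scales_spin_trace:
  fixes A :: "'a::field mat"
  assumes two: "(1 :: 'a) + 1 = 0" and A: "A \<in> orthogonal_group (2*\<nu>+1)"
  defines "g \<equiv> lin_act (2*\<nu>+1) (\<lambda>r s. A $$ (r, s))"
  defines "c \<equiv> spin_trace \<nu> (map g (map basis_vec [0..<2*\<nu>]))"
  shows "spin_trace \<nu> (map g vs) = c * spin_trace \<nu> vs"
proof -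
  let ?F = "\<lambda>w. spin_trace \<nu> (map g (map basis_vec w))"
  let ?G = "\<lambda>w. spin_trace \<nu> (map basis_vec w) :: 'a"
  have "clifford_trace \<nu> ?F"
  proof
    fix us ys a b
    show "?F (us @ a # b # ys) + ?F (us @ b # a # ys) = polar \<nu> (basis_vec a) (basis_vec b) * ?F (us @ ys)"
      by (simp add: spin_trace_swap g_def orthogonal_polar[OF A] del: One_nat_def)
    show "?F (us @ a # a # ys) = quad \<nu> (basis_vec a) * ?F (us @ ys)"
      by (simp add: spin_trace_square g_def orthogonal_quad[OF A] del: One_nat_def)
    show "?F (us @ ys) = ?F (ys @ us)"
      unfolding map_append by (rule spin_trace_rotate)
  qed
  then have trace: "clifford_trace \<nu> (\<lambda>w. ?F w - c * ?G w)"
    by (intro clifford_trace_diff clifford_trace_spin_trace)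
  have words: "?F w - c * ?G w = 0" if "set w \<subseteq> {..2*\<nu>}" for w
  proof (rule clifford_trace.char2_vanish[OF trace two _ _ that])
    fix us ys
    have "?F (us @ (2*\<nu>) # ys) = spin_trace \<nu> (map (\<lambda>s. if s =
        2*\<nu> then basis_vec s else g (basis_vec s)) (us @ (2*\<nu>) # ys))"
      unfolding map_map o_def
      by (rule spin_trace_cong) (simp add: g_def orthogonal_fixes_radical[OF two A] del: One_nat_def)
    also have "\<dots> = spin_trace \<nu> (map (\<lambda>s. if s = 2*\<nu> then basis_vec s else g (basis_vec s)) (us @ ys))"
      by (simp add: spin_trace_drop_z[OF two])
    also have "\<dots> = ?F (us @ ys)"
      unfolding map_map o_def
      by (rule spin_trace_cong) (simp add: g_def orthogonal_fixes_radical[OF two A] del: One_nat_def)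
    finally show "?F (us @ (2*\<nu>) # ys) - c * ?G (us @ (2*\<nu>) # ys) = ?F (us @ ys) - c * ?G (us @ ys)"
      by (simp add: spin_trace_drop_z[OF two])
  next
    have "?G [0..<2*\<nu>] = 1" using spin_trace_full_word[of \<nu> 0, where 'a = 'a] by simp
    then show "?F [0..<2*\<nu>] - c * ?G [0..<2*\<nu>] = 0" by (simp add: c_def)
  qed
  have "spin_trace \<nu> (map g vs) - c * spin_trace \<nu> vs = 0"
  proof (rule expands_vanish[where m = "length vs"])
    show "expands (2*\<nu>+1) (length vs) (\<lambda>vs. spin_trace \<nu> (map g vs) - c * spin_trace \<nu> vs)"
      unfolding g_def by (intro expands_diff spin_trace_lin_act_expands spin_trace_expands)
    show "spin_trace \<nu> (map g (map basis_vec w)) - c * spin_trace \<nu> (map basis_vec w) = 0"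
      if "set w \<subseteq> {..<2*\<nu>+1}" for w
      by (rule words) (use that in auto)
  qed simp
  then show ?thesis by simp
qed

text \<open>
  The scalar of \<open>orthogonal_scales_spin_trace\<close> is invertible, because the scalars of \<open>A\<close>
      and its inverse have
  product 1, and idempotent, because the complete word repeated twice has trace \<open>1\<^sup>2\<close> before and \<open>c\<^sup>2\<close> after
  the transformation.
\<close>

lemma orthogonal_preserves_spin_trace:
  fixes A :: "'a::field mat"
  assumes two: "(1 :: 'a) + 1 = 0" and A: "A \<in> orthogonal_group (2*\<nu>+1)"
  shows "spin_trace \<nu> (map (lin_act (2*\<nu>+1) (\<lambda>r s. A $$ (r, s))) vs) = spin_trace \<nu> vs"
proof -
  let ?n = "2*\<nu>+1" and ?full = "map basis_vec [0..<2*\<nu>] :: (nat \<Rightarrow> 'a) list"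
  define g where "g A = lin_act ?n (\<lambda>r s. A $$ (r, s))" for A :: "'a mat"
  define c where "c A = spin_trace \<nu> (map (g A) ?full)" for A
  have scale: "spin_trace \<nu> (map (g M) vs) = c M * spin_trace \<nu> vs" if "M \<in> orthogonal_group ?n" for M vs
    unfolding g_def c_def by (rule orthogonal_scales_spin_trace[OF two that])
  have full: "spin_trace \<nu> ?full = 1" using spin_trace_full_word[of \<nu> 0, where 'a = 'a] by simp
  have idem: "c A * c A = c A"
  proof -
    have "spin_trace \<nu> (map (g A) (?full @ ?full)) = (c A)\<^sup>2"
      unfolding map_append spin_trace_double[OF two] c_def ..
    then show ?thesis
      using scale[OF A, of "?full @ ?full"] full
      by (simp only: spin_trace_double[OF two]) (simp add: power2_eq_square)
  qed
  obtain B where B: "B \<in> orthogonal_group ?n" "B * A = 1\<^sub>m ?n"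
    using orthogonal_inverse[OF A] by metis
  have carr: "B \<in> carrier_mat ?n ?n" "A \<in> carrier_mat ?n ?n"
    using A B(1) by (auto simp: orthogonal_group_def)
  have "c B * c A = spin_trace \<nu> (map (g B) (map (g A) ?full))"
    by (simp only: scale[OF A] scale[OF B(1)] full mult_1_right)
  also have "\<dots> = spin_trace \<nu> (map basis_vec [0..<2*\<nu>])"
    unfolding map_map o_def
    by (rule spin_trace_cong) (simp add: g_def lin_act_inverse[OF carr B(2)] del: One_nat_def)
  finally have "c B * c A = 1" using full by simp
  then have "c A = 1" using idem by (metis mult.assoc mult_1_left)
  then show ?thesis using scale[OF A, of vs] by (simp add: g_def)
qed

text \<open>
  Both sides are multilinear in the generic vectors, so it suffices to compare them on basis vectors, where
  all values are constants.
\<close>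

lemma act_spin_trace:
  fixes A :: "'a::field mat"
  assumes two: "(1 :: 'a) + 1 = 0" and A: "A \<in> orthogonal_group (2*\<nu>+1)"
  shows "act (2*\<nu>+1) A (spin_trace \<nu> (map Var is)) = spin_trace \<nu> (map Var is)"
proof -
  let ?n = "2*\<nu>+1"
  let ?a = "\<lambda>r s. A $$ (r, s)" and ?b = "\<lambda>r s. Const (A $$ (r, s))"
  interpret C: comm_ring_hom "Const :: 'a \<Rightarrow> 'a vpoly" by (rule comm_ring_hom_Const)
  interpret E: comm_ring_hom "eval_vpoly (Const :: 'a \<Rightarrow> _) (\<lambda>(i, r). \<Sum>s<?n. Const (A $$ (r, s)) * Var i s)"
    by (rule C.comm_ring_hom_eval_vpoly)
  have "act ?n A (spin_trace \<nu> (map Var is)) = spin_trace \<nu> (map (lin_act ?n ?b) (map Var is))"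
    by (simp add: act_def E.hom_spin_trace o_def C.eval_vpoly_Var lin_act_def del: sum.lessThan_Suc
        One_nat_def)
  moreover have "spin_trace \<nu> (map (lin_act ?n ?b) vs) - 1 * spin_trace \<nu> vs = 0"
      for vs :: "(nat \<Rightarrow> 'a vpoly) list"
  proof (rule expands_vanish[where m = "length vs"])
    show "expands ?n (length vs) (\<lambda>vs. spin_trace \<nu> (map (lin_act ?n ?b) vs) - 1 * spin_trace \<nu> vs)"
      by (intro expands_diff spin_trace_lin_act_expands spin_trace_expands)
    fix w assume w: "set w \<subseteq> {..<?n}"
    have "spin_trace \<nu> (map (\<lambda>s. lin_act ?n ?b (basis_vec s)) w) =
        spin_trace \<nu> (map (\<lambda>s r. Const (lin_act ?n ?a (basis_vec s) r)) w)"
      by (rule spin_trace_cong) (use w in \<open>auto simp: lin_act_basis\<close>)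
    also have "\<dots> = Const (spin_trace \<nu> (map (lin_act ?n ?a) (map basis_vec w)))"
      by (simp add: C.hom_spin_trace o_def)
    also have "\<dots> = spin_trace \<nu> (map basis_vec w)"
      unfolding orthogonal_preserves_spin_trace[OF two A] by (rule spin_trace_basis_Const[symmetric])
    finally show "spin_trace \<nu> (map (lin_act ?n ?b) (map basis_vec w)) - 1 * spin_trace \<nu>
        (map basis_vec w) = 0"
      by (simp add: o_def)
  qed simp
  ultimately show ?thesis by (simp only: mult_1_left right_minus_eq)
qed

section \<open>Root elements of the special orthogonal group\<close>

lemma infinite_UNIV_alg_closed: "infinite (UNIV :: 'a::alg_closed_field set)"
proof
  assume fin: "finite (UNIV :: 'a set)"
  define P where "P = (\<Prod>a\<in>(UNIV :: 'a set). [:- a, 1:])"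
  have "degree P = card (UNIV :: 'a set)"
    unfolding P_def by (subst degree_prod_sum_eq) auto
  then have "degree P > 0" using fin by (simp add: card_gt_0_iff)
  then have "degree (P + 1) > 0" by (subst degree_add_eq_left) auto
  then obtain x where "poly (P + 1) x = 0" by (metis alg_closed_imp_poly_has_root)
  moreover have "poly P x = 0"
    unfolding P_def poly_prod using fin by (intro prod_zero bexI[of _ x]) auto
  ultimately show False by simp
qed

definition polynomial_function :: "('a::comm_ring_1 \<Rightarrow> 'a) \<Rightarrow> bool" where
  "polynomial_function f \<longleftrightarrow> (\<exists>P. \<forall>t. f t = poly P t)"

lemma polynomial_function_intros:
  fixes f g :: "'a::comm_ring_1 \<Rightarrow> 'a"
  shows "polynomial_function (\<lambda>t :: 'a. c)" "polynomial_function (\<lambda>t :: 'a. t)"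
  "polynomial_function f \<Longrightarrow> polynomial_function g \<Longrightarrow> polynomial_function (\<lambda>t. f t + g t)"
  "polynomial_function f \<Longrightarrow> polynomial_function g \<Longrightarrow> polynomial_function (\<lambda>t. f t * g t)"
  "polynomial_function f \<Longrightarrow> polynomial_function (\<lambda>t. f t ^ k)"
  unfolding polynomial_function_def
proof -
  show "\<exists>P. \<forall>t :: 'a. c = poly P t" by (intro exI[of _ "[:c:]"]) simp
  show "\<exists>P. \<forall>t :: 'a. t = poly P t" by (intro exI[of _ "[:0, 1:]"]) simp
qed (metis poly_add, metis poly_mult, metis poly_power)

lemma polynomial_function_sum:
  "(\<And>x. x \<in> A \<Longrightarrow> polynomial_function (f x)) \<Longrightarrow> polynomial_function (\<lambda>t. \<Sum>x\<in>A. f x t)"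
  by (induction A rule: infinite_finite_induct) (simp_all add: polynomial_function_intros)

lemma polynomial_function_prod:
  "(\<And>x. x \<in> A \<Longrightarrow> polynomial_function (f x)) \<Longrightarrow> polynomial_function (\<lambda>t. \<Prod>x\<in>A. f x t)"
  by (induction A rule: infinite_finite_induct) (simp_all add: polynomial_function_intros)

text \<open>
  A polynomial that does not vanish at one point of the curve vanishes at only finitely many of its points.
\<close>

lemma zariski_open_curve_cofinite:
  fixes M :: "'a::field \<Rightarrow> 'a mat"
  assumes entries: "\<And>i j. i < n \<Longrightarrow> j < n \<Longrightarrow> polynomial_function (\<lambda>t. M t $$ (i, j))"
    and carr: "\<And>t. M t \<in> carrier_mat n n"
    and W: "openin (zariski_mat n) W" "M t0 \<in> W"
  shows "finite {t. M t \<notin> W}"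
proof -
  let ?B = "{{A \<in> carrier_mat n n. eval_vpoly (\<lambda>c. c) (\<lambda>ij. A $$ ij) p \<noteq> 0} | p. p \<in> poly_ring n n}"
  have "generate_topology_on ?B W"
    using W(1) unfolding zariski_mat_def by (rule openin_topology_generated_by)
  then show ?thesis using W(2)
  proof (induction arbitrary: t0 rule: generate_topology_on.induct)
    case (Int a b)
    have "{t. M t \<notin> a \<inter> b} = {t. M t \<notin> a} \<union> {t. M t \<notin> b}" by auto
    then show ?case using Int by auto
  next
    case (UN K)
    then obtain k where "k \<in> K" "M t0 \<in> k" by auto
    then have "finite {t. M t \<notin> k}" using UN.IH by blast
    then show ?case by (rule finite_subset[rotated]) (use \<open>k \<in> K\<close> in auto)
  next
    case (Basis s)
    then obtain p where p: "p \<in> poly_ring n n"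
      and s: "s = {A \<in> carrier_mat n n. eval_vpoly (\<lambda>c. c) (\<lambda>ij. A $$ ij) p \<noteq> 0}" by auto
    have "polynomial_function (\<lambda>t. eval_vpoly (\<lambda>c. c) (\<lambda>ij. M t $$ ij) p)"
      unfolding eval_vpoly_def
    proof (intro polynomial_function_sum polynomial_function_intros polynomial_function_prod)
      fix u v assume "u \<in> keys p" "v \<in> keys u"
      then have "v \<in> {..<n} \<times> {..<n}" using p by (auto simp: poly_ring_def)
      then show "polynomial_function (\<lambda>t. M t $$ v)" using entries by auto
    qed
    then obtain P where P: "\<And>t. eval_vpoly (\<lambda>c. c) (\<lambda>ij. M t $$ ij) p = poly P t"
      by (auto simp: polynomial_function_def)
    have "poly P t0 \<noteq> 0" using Basis s P by auto
    then have "P \<noteq> 0" by auto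
    then have "finite {t. poly P t = 0}" by (rule poly_roots_finite)
    moreover have "{t. M t \<notin> s} = {t. poly P t = 0}" using carr P s by auto
    ultimately show ?case by simp
  qed simp
qed

text \<open>
  Over an infinite field two nonempty cofinite sets of parameters meet, so the curve cannot be separated by
  Zariski open sets.
\<close>

lemma polynomial_curve_in_special_orthogonal_group:
  fixes M :: "'a::field \<Rightarrow> 'a mat"
  assumes inf: "infinite (UNIV :: 'a set)"
    and entries: "\<And>i j. i < n \<Longrightarrow> j < n \<Longrightarrow> polynomial_function (\<lambda>t. M t $$ (i, j))"
    and orth: "\<And>t. M t \<in> orthogonal_group n" and one: "M 0 = 1\<^sub>m n"
  shows "M t \<in> special_orthogonal_group n"
proof -
  have carr: "M t \<in> carrier_mat n n" for t using orth by (auto simp: orthogonal_group_def)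
  have "connectedin (zariski_mat n) (range M)"
    unfolding connectedin
  proof (intro conjI notI)
    have "openin (zariski_mat n) {A \<in> carrier_mat n n. eval_vpoly (\<lambda>c. c) (\<lambda>ij. A $$ ij)
        (Const 1 :: 'a vpoly) \<noteq> 0}"
      unfolding zariski_mat_def openin_topology_generated_by_iff
      by (rule generate_topology_on.Basis) (auto simp: poly_ring_def Const_def)
    moreover have "eval_vpoly (\<lambda>c. c) \<phi> (Const 1 :: 'a vpoly) = 1" for \<phi>
      by (simp add: comm_ring_hom.eval_vpoly_Const[OF comm_ring_hom_id])
    ultimately have "carrier_mat n n \<subseteq> topspace (zariski_mat n :: 'a mat topology)"
      by (auto dest!: openin_subset)
    then show "range M \<subseteq> topspace (zariski_mat n)" using carr by auto
  next
    assume "\<exists>E1 E2. openin (zariski_mat n) E1 \<and> openin (zariski_mat n) E2 \<and> range M \<subseteq> E1 \<union> E2 \<and>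
        E1 \<inter> E2 \<inter> range M = {} \<and> E1 \<inter> range M \<noteq> {} \<and> E2 \<inter> range M \<noteq> {}"
    then obtain E1 E2 s t where E: "openin (zariski_mat n) E1" "openin (zariski_mat n) E2"
      "E1 \<inter> E2 \<inter> range M = {}" "M s \<in> E1" "M t \<in> E2" by blast
    have "finite ({t. M t \<notin> E1} \<union> {t. M t \<notin> E2})"
      using zariski_open_curve_cofinite[OF entries carr E(1,4)]
        zariski_open_curve_cofinite[OF entries carr E(2,5)] by simp
    moreover have "{t. M t \<notin> E1} \<union> {t. M t \<notin> E2} = UNIV" using E(3) by auto
    ultimately show False using inf by simp
  qed
  then have "connectedin (subtopology (zariski_mat n) (orthogonal_group n)) (range M)"
    using orth by (auto simp: connectedin_subtopology)
  then show ?thesis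
    unfolding special_orthogonal_group_def connected_component_of_def using one
    by (auto intro!: exI[of _ "range M"]) (metis rangeI)
qed

text \<open>
  The transformation \<open>e\<^sub>b \<mapsto> e\<^sub>b + t e\<^sub>z + t\<^sup>2 e\<^sub>a\<close>, where \<open>a\<close>
      and \<open>b\<close> are the two coordinates of one hyperbolic plane.
\<close>

definition root_matrix :: "nat \<Rightarrow> nat \<Rightarrow> nat \<Rightarrow> 'a::comm_ring_1 \<Rightarrow> 'a mat" where
  "root_matrix \<nu> a b t = mat (2*\<nu>+1) (2*\<nu>+1) (\<lambda>(r, s). (if r = s then 1 else 0) +
     (if s = b then (if r = 2*\<nu> then t else 0) + (if r = a then t\<^sup>2 else 0) else 0))"

lemma lin_act_root_matrix:
  assumes "b < 2*\<nu>+1" "r < 2*\<nu>+1"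
  shows "lin_act (2*\<nu>+1) (\<lambda>r s. root_matrix \<nu> a b t $$ (r, s)) v r =
    v r + (t * v b * basis_vec (2*\<nu>) r + t\<^sup>2 * v b * basis_vec a r)"
proof -
  have "lin_act (2*\<nu>+1) (\<lambda>r s. root_matrix \<nu> a b t $$ (r, s)) v r =
    (\<Sum>s<2*\<nu>+1. (if s = r then v s else 0) +
      (if s = b then ((if r = 2*\<nu> then t else 0) + (if r = a then t\<^sup>2 else 0)) * v b else 0))"
    unfolding lin_act_def using assms(2)
    by (intro sum.cong) (auto simp: root_matrix_def algebra_simps)
  also have "\<dots> = v r + (t * v b * basis_vec (2*\<nu>) r + t\<^sup>2 * v b * basis_vec a r)"
    unfolding sum.distrib using assms by (simp add: basis_vec_def distrib_right del: sum.lessThan_Suc)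
  finally show ?thesis .
qed

lemma polar_add_left: "polar \<nu> (\<lambda>r. u r + v r) w = polar \<nu> u w + polar \<nu> v w"
  by (simp add: polar_def sum.distrib algebra_simps)

lemma polar_scale_left: "polar \<nu> (\<lambda>r. c * u r) w = c * polar \<nu> u w"
  by (simp add: polar_def sum_distrib_left algebra_simps)

lemma quad_scale: "quad \<nu> (\<lambda>r. c * v r) = c\<^sup>2 * quad \<nu> v"
  by (simp add: quad_def sum_distrib_left power2_eq_square algebra_simps)

lemma root_matrix_orthogonal:
  assumes two: "(1 :: 'a::field) + 1 = 0" and r: "r < \<nu>"
    and ab: "(a = 2*r \<and> b = 2*r+1) \<or> (a = 2*r+1 \<and> b = 2*r)"
  shows "root_matrix \<nu> a b (t :: 'a) \<in> orthogonal_group (2*\<nu>+1)"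
proof -
  let ?n = "2*\<nu>+1" and ?M = "root_matrix \<nu> a b t"
  let ?g = "lin_act ?n (\<lambda>r s. ?M $$ (r, s))"
  have two': "(2 :: 'a) = 0" using two by simp
  have dup: "x + x = 0" for x :: 'a using two' by (simp flip: mult_2)
  have carr: "?M \<in> carrier_mat ?n ?n" by (simp add: root_matrix_def)
  have b: "b < 2*\<nu>" "a < 2*\<nu>" "a \<noteq> b" using ab r by auto
  have g: "?g v s = v s + (t * v b * basis_vec (2*\<nu>) s + t\<^sup>2 * v b * basis_vec a s)"
    if "s < ?n" for v s
    using b that by (intro lin_act_root_matrix) auto
  have pol_a: "polar \<nu> (basis_vec a) v = v b" for v :: "nat \<Rightarrow> 'a"
    using ab polar_basis_left[OF r, of v] by auto
  have quad_g: "quad \<nu> (?g v) = quad \<nu> v" for v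
  proof -
    let ?z = "\<lambda>r. t * v b * basis_vec (2*\<nu>) r" and ?x = "\<lambda>r. t\<^sup>2 * v b * basis_vec a r"
    have "quad \<nu> (?g v) = quad \<nu> (\<lambda>s. v s + (?z s + ?x s))"
      using g by (intro quad_cong) simp
    also have "\<dots> = quad \<nu> v + (quad \<nu> ?z + quad \<nu> ?x + polar \<nu> ?z ?x) + polar \<nu> (\<lambda>s. ?z s + ?x s) v"
      unfolding quad_add[of \<nu> v] quad_add[of \<nu> ?z] polar_commute[of \<nu> v] ..
    also have "quad \<nu> ?z = (t * v b)\<^sup>2"
      unfolding quad_scale by (simp add: quad_def basis_vec_def)
    also have "quad \<nu> ?x = 0"
      unfolding quad_scale using b by (simp add: quad_basis)
    also have "polar \<nu> ?z ?x = 0"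
      unfolding polar_scale_left polar_basis_last by (simp add: two')
    also have "polar \<nu> (\<lambda>s. ?z s + ?x s) v = t\<^sup>2 * v b * v b"
      unfolding polar_add_left polar_scale_left polar_basis_last pol_a by (simp add: two')
    also have "quad \<nu> v + ((t * v b)\<^sup>2 + 0 + 0) + t\<^sup>2 * v b * v b = quad \<nu> v"
      using dup[of "(t * v b)\<^sup>2"] by (simp add: power2_eq_square ac_simps)
    finally show ?thesis .
  qed
  have "qform ?n (?M *\<^sub>v v) = qform ?n v" if "v \<in> carrier_vec ?n" for v
  proof -
    have "v = vec ?n (\<lambda>s. v $ s)" using that by auto
    then show ?thesis
      using quad_g[of "\<lambda>s. v $ s"] by (metis mult_mat_vec_eq_lin_act[OF carr] qform_vec)
  qed
  moreover have "?M * ?M = 1\<^sub>m ?n"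
  proof (rule eq_matI)
    fix i j assume "i < dim_row (1\<^sub>m ?n)" "j < dim_col (1\<^sub>m ?n)"
    then have ij: "i < ?n" "j < ?n" by auto
    have "(?M * ?M) $$ (i, j) = (\<Sum>k<?n. ?M $$ (i, k) * ?M $$ (k, j))"
      using ij carr by (auto simp: scalar_prod_def atLeast0LessThan intro!: sum.cong)
    also have "\<dots> = ?g (?g (basis_vec j)) i"
      unfolding lin_act_def[of _ _ "?g (basis_vec j)"]
      by (rule sum.cong) (simp_all add: lin_act_basis[OF ij(2)] del: One_nat_def)
    also have "\<dots> = basis_vec j i"
    proof -
      have "?g (basis_vec j) b = (basis_vec j b :: 'a)"
        using b by (simp add: g basis_vec_def del: One_nat_def)
      then show ?thesis
        using dup[of "t * basis_vec j b * basis_vec (2*\<nu>) i + t\<^sup>2 * basis_vec j b * basis_vec a i"]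
        by (simp add: g[OF ij(1)] add.assoc del: One_nat_def)
    qed
    also have "\<dots> = 1\<^sub>m ?n $$ (i, j)" using ij by (simp add: basis_vec_def)
    finally show "(?M * ?M) $$ (i, j) = 1\<^sub>m ?n $$ (i, j)" .
  qed (use carr in auto)
  then have "invertible_mat ?M"
    unfolding invertible_mat_def inverts_mat_def using carr by auto
  ultimately show ?thesis using carr by (simp add: orthogonal_group_def)
qed

lemma root_matrix_special_orthogonal:
  fixes t :: "'a::alg_closed_field"
  assumes "(1 :: 'a) + 1 = 0" "r < \<nu>" "(a = 2*r \<and> b = 2*r+1) \<or> (a = 2*r+1 \<and> b = 2*r)"
  shows "root_matrix \<nu> a b t \<in> special_orthogonal_group (2*\<nu>+1)"
proof (rule polynomial_curve_in_special_orthogonal_group[OF infinite_UNIV_alg_closed])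
  fix i j assume "i < 2*\<nu>+1" "j < 2*\<nu>+1"
  then have "(\<lambda>t. root_matrix \<nu> a b t $$ (i, j)) = (\<lambda>t :: 'a. (if i = j then 1 else 0) +
     (if j = b then (if i = 2*\<nu> then t else 0) + (if i = a then t\<^sup>2 else 0) else 0))"
    by (simp add: root_matrix_def)
  then show "polynomial_function (\<lambda>t :: 'a. root_matrix \<nu> a b t $$ (i, j))"
    by (cases "i = j"; cases "j = b"; cases "i = 2*\<nu>"; cases "i = a")
      (simp_all add: polynomial_function_intros)
next
  show "root_matrix \<nu> a b t \<in> orthogonal_group (2*\<nu>+1)" for t :: 'a
    by (rule root_matrix_orthogonal[OF assms])
  show "root_matrix \<nu> a b (0 :: 'a) = 1\<^sub>m (2*\<nu>+1)"
    by (rule eq_matI) (auto simp: root_matrix_def)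
qed

section \<open>Indecomposability\<close>

lemma lookup_monomial_image:
  "lookup (monomial_image \<sigma> t) w = (\<Sum>v | v \<in> keys t \<and> \<sigma> v = w. lookup t v)"
proof -
  have "lookup (monomial_image \<sigma> t) w =
      (\<Sum>v\<in>keys t. if \<sigma> v = w then lookup t v else 0)"
    unfolding monomial_image_def lookup_sum by (simp add: lookup_single when_def)
  also have "\<dots> = (\<Sum>v | v \<in> keys t \<and> \<sigma> v = w. lookup t v)"
    by (rule sum.inter_filter[symmetric]) simp
  finally show ?thesis .
qed

lemma monomial_image_squarefree:
  assumes "finite S"
  shows "monomial_image (\<lambda>v. (fst v, 0)) (sqfree_monomial \<tau> S) = sqfree_monomial (\<lambda>_. 0) S"
proof -
  have "inj_on (\<lambda>j. (j, \<tau> j)) S" by (rule inj_onI) simp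
  then show ?thesis
    unfolding monomial_image_def keys_sqfree_monomial[OF assms]
    by (simp add: sum.reindex lookup_sqfree_monomial[OF assms] sqfree_monomial_def[of "\<lambda>_. 0"])
qed

text \<open>
  The value on the vectors \<open>w j\<close> of that part of \<open>f\<close> which is multilinear in the vectors with
      indices in \<open>S\<close> and
  free of the others. It is the coefficient of \<open>\<Prod>\<^sub>j s\<^sub>j\<close> after substituting \<open>s\<^sub>j w\<^sub>j\<close> for the \<open>j\<close>-th vector;
  the variable \<open>Var j 0\<close> plays the role of \<open>s\<^sub>j\<close>.
\<close>

definition polarized :: "'a::comm_ring_1 vpoly \<Rightarrow> nat set \<Rightarrow> (nat \<Rightarrow> nat \<Rightarrow> 'a) \<Rightarrow> 'a" where
  "polarized f S w = lookup
     (eval_vpoly Const (\<lambda>(j, r). if j \<in> S then Const (w j r) * Var j 0 else 0) f)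
     (sqfree_monomial (\<lambda>_. 0) S)"

lemma polarized_sum:
  fixes f :: "'a::comm_ring_1 vpoly"
  shows "polarized f S w = (\<Sum>t\<in>keys f.
     if monomial_image (\<lambda>v. (fst v, 0)) t = sqfree_monomial (\<lambda>_. 0) S
     then lookup f t * monomial_value (\<lambda>(j, r). if j \<in> S then w j r else 0) t else 0)"
proof -
  let ?a = "\<lambda>v. if fst v \<in> S then w (fst v) (snd v) else 0" and ?\<sigma> = "\<lambda>v :: nat \<times> nat. (fst v, 0 :: nat)"
  have "(\<lambda>(j, r). if j \<in> S then Const (w j r) * Var j 0 else 0) =
      (\<lambda>v. Const (?a v) * Var (fst (?\<sigma> v)) (snd (?\<sigma> v)) :: 'a vpoly)"
    by (auto simp: Const_def)
  moreover have "(\<lambda>(j, r). if j \<in> S then w j r else 0) = ?a" by auto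
  ultimately show ?thesis
    unfolding polarized_def eval_vpoly_eq
    by (simp only: monomial_value_monomial)
      (simp add: Const_def mult_single lookup_sum lookup_single when_def)
qed

lemma polarized_expand:
  fixes f :: "'a::field vpoly"
  assumes f: "f \<in> poly_ring n m" and S: "finite S" "i \<in> S"
    and \<tau>: "\<And>j. j \<in> S - {i} \<Longrightarrow> \<tau> j < n"
    and w: "\<And>j r. j \<in> S - {i} \<Longrightarrow> r < n \<Longrightarrow> w j r = basis_vec (\<tau> j) r"
  shows "polarized f S w = (\<Sum>c<n. w i c * lookup f (sqfree_monomial (\<tau>(i := c)) S))"
proof -
  let ?a = "\<lambda>(j, r). if j \<in> S then w j r else 0" and ?\<sigma> = "\<lambda>v :: nat \<times> nat. (fst v, 0 :: nat)"
  let ?M = "\<lambda>c. sqfree_monomial (\<tau>(i := c)) S" and ?MS = "sqfree_monomial (\<lambda>_. 0) S"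
  define g where "g t = (if monomial_image ?\<sigma> t = ?MS
    then lookup f t * monomial_value ?a t else 0)" for t
  have inj: "inj_on ?M {..<n}"
  proof (rule inj_onI)
    fix c d assume "?M c = ?M d"
    then have "lookup (?M c) (i, c) = lookup (?M d) (i, c)" by simp
    then show "c = d" using S by (simp add: lookup_sqfree_monomial split: if_splits)
  qed
  have gM: "g (?M c) = w i c * lookup f (?M c)" if "c < n" for c
  proof -
    have "monomial_value ?a (?M c) = (\<Prod>j\<in>S. ?a (j, (\<tau>(i := c)) j))"
    proof -
      have "inj_on (\<lambda>j. (j, (\<tau>(i := c)) j)) S" by (rule inj_onI) simp
      then show ?thesis
        unfolding monomial_value_def keys_sqfree_monomial[OF S(1)]
        by (simp add: prod.reindex lookup_sqfree_monomial[OF S(1)])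
    qed
    also have "\<dots> = ?a (i, c) * (\<Prod>j\<in>S - {i}. ?a (j, (\<tau>(i := c)) j))"
      using S by (subst prod.remove[of S i]) auto
    also have "(\<Prod>j\<in>S - {i}. ?a (j, (\<tau>(i := c)) j)) = 1"
      using w \<tau> by (intro prod.neutral) (auto simp: basis_vec_def)
    also have "?a (i, c) * 1 = w i c" using S by simp
    finally have mv: "monomial_value ?a (?M c) = w i c" .
    show ?thesis
      unfolding g_def monomial_image_squarefree[OF S(1)] mv by (simp only: if_True simp_thms mult.commute)
  qed
  have supp: "t \<in> ?M ` {..<n}" if t: "t \<in> keys f" "g t \<noteq> 0" for t
  proof -
    have im: "monomial_image ?\<sigma> t = ?MS" and mv: "monomial_value ?a t \<noteq> 0"
      using t(2) by (auto simp: g_def split: if_splits)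
    have a: "?a v \<noteq> 0" if "v \<in> keys t" for v
    proof
      assume "?a v = 0"
      then have "monomial_value ?a t = 0"
        unfolding monomial_value_def using that
        by (intro prod_zero bexI[of _ v]) (auto simp: in_keys_iff zero_power)
      then show False using mv by simp
    qed
    have range: "r < n" if "(j, r) \<in> keys t" for j r
      using f t(1) that by (auto simp: poly_ring_def)
    have fibre: "\<exists>c. (j, c) \<in> keys t \<and> lookup t (j, c) = 1 \<and>
        (\<forall>d. d \<noteq> c \<longrightarrow> lookup t (j, d) = 0)" if "j \<in> S" for j
    proof -
      have "(\<Sum>v | v \<in> keys t \<and> (fst v, 0) = (j, 0 :: nat). lookup t v) = Suc 0"
        using arg_cong[OF im, of "\<lambda>u. lookup u (j, 0)"] S that
        by (simp add: lookup_monomial_image lookup_sqfree_monomial)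
      then obtain v where v: "v \<in> keys t" "fst v = j" "lookup t v = 1"
        and others: "\<And>u. u \<in> keys t \<Longrightarrow> fst u = j \<Longrightarrow> v \<noteq> u \<Longrightarrow> lookup t u = 0"
        by (subst (asm) sum_eq_Suc0_iff) auto
      have "lookup t (j, d) = 0" if "d \<noteq> snd v" for d
        using others[of "(j, d)"] that by (cases "v =
            (j, d)"; cases "(j, d) \<in> keys t") (auto simp: in_keys_iff)
      then show ?thesis using v by (intro exI[of _ "snd v"]) auto
    qed
    obtain c where c: "(i, c) \<in> keys t" "lookup t (i, c) = 1"
      "\<And>d. d \<noteq> c \<Longrightarrow> lookup t (i, d) = 0" using fibre[OF S(2)] by blast
    have "t = ?M c"
    proof (rule poly_mapping_eqI, clarify)
      fix j d
      show "lookup t (j, d) = lookup (?M c) (j, d)"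
      proof (cases "j \<in> S")
        case False
        then have "(j, d) \<notin> keys t" using a[of "(j, d)"] by auto
        then show ?thesis using False S by (simp add: lookup_sqfree_monomial in_keys_iff)
      next
        case True
        show ?thesis
        proof (cases "j = i")
          case True
          then show ?thesis using c S by (auto simp: lookup_sqfree_monomial)
        next
          case False
          obtain e where e: "(j, e) \<in> keys t" "lookup t (j, e) = 1"
            "\<And>d. d \<noteq> e \<Longrightarrow> lookup t (j, d) = 0" using fibre[OF \<open>j \<in> S\<close>] by blast
          have "w j e \<noteq> 0" using a[OF e(1)] \<open>j \<in> S\<close> by simp
          then have "e = \<tau> j"
            using w[of j e] range[OF e(1)] False \<open>j \<in> S\<close> by (simp add: basis_vec_def split: if_splits)
          then show ?thesis using e False \<open>j \<in> S\<close> S by (auto simp: lookup_sqfree_monomial)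
        qed
      qed
    qed
    then show ?thesis using range[OF c(1)] by auto
  qed
  have "polarized f S w = (\<Sum>t\<in>keys f. g t)"
    unfolding polarized_sum g_def ..
  also have "\<dots> = (\<Sum>t\<in>keys f \<union> ?M ` {..<n}. g t)"
    by (rule sum.mono_neutral_left) (auto simp: g_def in_keys_iff)
  also have "\<dots> = (\<Sum>t\<in>?M ` {..<n}. g t)"
    by (rule sum.mono_neutral_right) (use supp in auto)
  also have "\<dots> = (\<Sum>c<n. g (?M c))" by (simp add: sum.reindex[OF inj])
  also have "\<dots> = (\<Sum>c<n. w i c * lookup f (?M c))"
    by (intro sum.cong refl gM) simp
  finally show ?thesis .
qed

lemma eval_vpoly_comp:
  assumes "comm_ring_hom (c :: 'a::comm_ring_1 \<Rightarrow> 'b::comm_ring_1)"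
    and "comm_ring_hom (H :: 'b \<Rightarrow> 'c::comm_ring_1)"
  shows "H (eval_vpoly c \<phi> f) = eval_vpoly (\<lambda>x. H (c x)) (\<lambda>v. H (\<phi> v)) f"
proof -
  interpret H: comm_ring_hom H by (rule assms)
  show ?thesis by (simp add: eval_vpoly_def H.hom_sum H.hom_mult H.hom_prod H.hom_power)
qed

lemma polarized_act:
  fixes f :: "'a::field vpoly"
  shows "polarized (act n A f) S w = polarized f S (\<lambda>j. lin_act n (\<lambda>r s. A $$ (r, s)) (w j))"
proof -
  interpret C: comm_ring_hom "Const :: 'a \<Rightarrow> 'a vpoly" by (rule comm_ring_hom_Const)
  let ?\<psi> = "\<lambda>(j, r). if j \<in> S then Const (w j r) * Var j 0 else (0 :: 'a vpoly)"
  have H: "comm_ring_hom (eval_vpoly Const ?\<psi>)" by (rule C.comm_ring_hom_eval_vpoly)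
  interpret H: comm_ring_hom "eval_vpoly Const ?\<psi>" by (rule H)
  have v: "eval_vpoly Const ?\<psi> (\<Sum>s<n. Const (A $$ (r, s)) * Var j s) =
      (if j \<in> S then Const (lin_act n (\<lambda>r s. A $$ (r, s)) (w j) r) * Var j 0 else 0)" for j r
    by (simp add: H.hom_sum H.hom_mult C.eval_vpoly_Const C.eval_vpoly_Var lin_act_def
        C.hom_sum C.hom_mult sum_distrib_right mult.assoc)
  show ?thesis
    unfolding polarized_def act_def eval_vpoly_comp[OF comm_ring_hom_Const H] C.eval_vpoly_Const
    by (simp add: case_prod_unfold v[unfolded case_prod_unfold])
qed

text \<open>
  Put \<open>e\<^sub>b\<close> at place \<open>i\<close>. The root transformation fixes the other basis vectors that occur, so
      invariance says
  that \<open>t\<close> times the coefficient with \<open>e\<^sub>z\<close> at place \<open>i\<close> plus \<open>t\<^sup>2\<close> times the one with \<open>e\<^sub>a\<close> is 0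
      for all \<open>t\<close>.
  Two nonzero values of \<open>t\<close> suffice to conclude that both vanish.
\<close>

lemma invariant_coefficient_zero:
  fixes f :: "'a::field vpoly"
  assumes inf: "infinite (UNIV :: 'a set)"
    and inv: "f \<in> invariants (2*\<nu>+1) m G" and G: "\<And>t. root_matrix \<nu> a b t \<in> G"
    and ab: "a < 2*\<nu>" "b < 2*\<nu>" "a \<noteq> b"
    and S: "finite S" "i \<in> S" and \<tau>: "\<And>j. j \<in> S \<Longrightarrow> \<tau> j < 2*\<nu>+1"
    and free: "\<And>j. j \<in> S - {i} \<Longrightarrow> \<tau> j \<noteq> b" and i: "\<tau> i = a \<or> \<tau> i = 2*\<nu>"
  shows "lookup f (sqfree_monomial \<tau> S) = 0"
proof -
  let ?n = "2*\<nu>+1" and ?c = "\<lambda>c. lookup f (sqfree_monomial (\<tau>(i := c)) S)"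
  let ?w = "\<lambda>j. basis_vec ((\<tau>(i := b)) j)"
  have f: "f \<in> poly_ring ?n m" using inv by (simp add: invariants_def)
  have eq: "t * ?c (2*\<nu>) + t\<^sup>2 * ?c a = 0" for t
  proof -
    let ?g = "lin_act ?n (\<lambda>r s. root_matrix \<nu> a b t $$ (r, s))"
    have g: "?g v r = v r + (t * v b * basis_vec (2*\<nu>) r + t\<^sup>2 * v b * basis_vec a r)" if "r < ?n" for v r
      using ab that by (intro lin_act_root_matrix) auto
    have "(\<Sum>c<?n. ?w i c * ?c c) = polarized f S ?w"
      using f S \<tau> by (intro polarized_expand[symmetric]) auto
    also have "\<dots> = polarized (act ?n (root_matrix \<nu> a b t) f) S ?w"
      using inv G[of t] by (simp add: invariants_def)
    also have "\<dots> = polarized f S (\<lambda>j. ?g (?w j))" by (rule polarized_act)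
    also have "\<dots> = (\<Sum>c<?n. ?g (?w i) c * ?c c)"
    proof (rule polarized_expand[OF f S])
      show "\<tau> j < ?n" if "j \<in> S - {i}" for j using that \<tau> by auto
      show "?g (?w j) r = basis_vec (\<tau> j) r" if "j \<in> S - {i}" "r < ?n" for j r
        using that free[of j] by (simp add: g basis_vec_def del: One_nat_def)
    qed
    also have "\<dots> = (\<Sum>c<?n. ?w i c * ?c c + (t * basis_vec (2*\<nu>) c * ?c c + t\<^sup>2 * basis_vec a c * ?c c))"
      by (intro sum.cong refl) (simp add: g basis_vec_def distrib_right del: One_nat_def)
    finally have "(\<Sum>c<?n. t * basis_vec (2*\<nu>) c * ?c c) + (\<Sum>c<?n. t\<^sup>2 * basis_vec a c * ?c c) = 0"
      unfolding sum.distrib by (simp only: add_cancel_right_right)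
    moreover have "(\<Sum>c<?n. x * basis_vec s c * ?c c) = x * ?c s" if "s < ?n" for x s
      using that by (simp add: basis_vec_def if_distrib[where f = "\<lambda>x. x * _"]
          if_distrib[where f = "\<lambda>y. x * y"] cong: if_cong del: sum.lessThan_Suc)
    ultimately show ?thesis using ab by simp
  qed
  have sum1: "?c (2*\<nu>) + ?c a = 0" using eq[of 1] by simp
  \<comment> \<open>the value 1 is already used in \<open>sum1\<close>, so a further nonzero value is needed\<close>
  obtain t :: 'a where t: "t \<notin> {0, 1}"
    using inf by (metis finite.emptyI finite.insertI ex_new_if_finite)
  have "t * (?c (2*\<nu>) + t * ?c a) = 0"
    using eq[of t] by (simp add: power2_eq_square algebra_simps)
  then have "?c (2*\<nu>) + t * ?c a = 0" using t by simp
  moreover have "(t - 1) * ?c a = (?c (2*\<nu>) + t * ?c a) - (?c (2*\<nu>) + ?c a)"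
    by (simp add: algebra_simps)
  ultimately have "(t - 1) * ?c a = 0" by (simp only: sum1 diff_self)
  then have "?c a = 0" using t by simp
  moreover from this have "?c (2*\<nu>) = 0" using sum1 by simp
  ultimately show ?thesis using i by (metis fun_upd_triv)
qed

text \<open>
  The coordinate that the distinguished monomial takes from the \<open>j\<close>-th vector: \<open>x\<^sub>1, y\<^sub>1, \<dots>, x\<^sub>\<nu>,
      y\<^sub>\<nu>\<close> and then \<open>z\<close>.
\<close>

definition standard_word :: "nat \<Rightarrow> nat \<Rightarrow> nat" where
  "standard_word \<nu> j = (if j < 2*\<nu> then j else 2*\<nu>)"

text \<open>
  The sets of indices for which an invariant may contain the corresponding part of the distinguished
      monomial.
\<close>

definition admissible :: "nat \<Rightarrow> nat set \<Rightarrow> bool" where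
  "admissible \<nu> S \<longleftrightarrow> {..<2*\<nu>} \<subseteq> S \<or> (S \<subseteq> {..<2*\<nu>} \<and> (\<forall>r<\<nu>. 2*r \<in> S \<longleftrightarrow> 2*r+1 \<in> S))"

text \<open>
  If a letter \<open>b\<close> of a pair is absent while its partner or some \<open>z\<close> is present, \<open>invariant_coefficient_zero\<close>
  applies. A set of indices without such a configuration is admissible.
\<close>

lemma invariant_coefficient_not_admissible:
  fixes f :: "'a::alg_closed_field vpoly"
  assumes two: "(1 :: 'a) + 1 = 0"
    and f: "f \<in> invariants (2*\<nu>+1) m (special_orthogonal_group (2*\<nu>+1))"
    and S: "finite S" "\<not> admissible \<nu> S"
  shows "lookup f (sqfree_monomial (standard_word \<nu>) S) = 0"
proof -
  have zero: "lookup f (sqfree_monomial (standard_word \<nu>) S) = 0"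
    if "r < \<nu>" "(a = 2*r \<and> b = 2*r+1) \<or> (a = 2*r+1 \<and> b = 2*r)" "b \<notin> S" "i \<in> S" "i = a \<or> i \<ge> 2*\<nu>" for r a b i
  proof (rule invariant_coefficient_zero[OF infinite_UNIV_alg_closed f _ _ _ _ S(1) that(4)])
    show "root_matrix \<nu> a b t \<in> special_orthogonal_group (2*\<nu>+1)" for t :: 'a
      by (rule root_matrix_special_orthogonal[OF two that(1,2)])
    have "b < 2*\<nu>" using that(1,2) by auto
    then show "standard_word \<nu> j \<noteq> b" if "j \<in> S - {i}" for j
      using that \<open>b \<notin> S\<close> \<open>r < \<nu>\<close> \<open>(a = 2*r \<and> b = 2*r+1) \<or> (a = 2*r+1 \<and> b = 2*r)\<close>
      by (auto simp: standard_word_def)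
  qed (use that in \<open>auto simp: standard_word_def\<close>)
  obtain s where s: "s < 2*\<nu>" "s \<notin> S" using S(2) by (auto simp: admissible_def)
  show ?thesis
  proof (cases "S \<subseteq> {..<2*\<nu>}")
    case True
    then obtain r where "r < \<nu>" "(2*r \<in> S) \<noteq> (2*r+1 \<in> S)" using S(2) by (auto simp: admissible_def)
    then show ?thesis
      using zero[of r "2*r" "2*r+1" "2*r"] zero[of r "2*r+1" "2*r" "2*r+1"] by blast
  next
    case False
    then obtain i where "i \<in> S" "i \<notin> {..<2*\<nu>}" by blast
    then have i: "i \<in> S" "i \<ge> 2*\<nu>" by simp_all
    show ?thesis
    proof (cases "even s")
      case True
      then show ?thesis using zero[of "s div 2" "s + 1" s i] s i by auto
    next
      case False
      then show ?thesis using zero[of "s div 2" "s - 1" s i] s i by (auto elim!: oddE)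
    qed
  qed
qed

lemma sqfree_monomial_split:
  assumes "finite S" "u + v = sqfree_monomial \<tau> S"
  obtains T where "T \<subseteq> S" "u = sqfree_monomial \<tau> T" "v = sqfree_monomial \<tau> (S - T)"
proof -
  define T where "T = {j \<in> S. lookup u (j, \<tau> j) = 1}"
  have l: "lookup u x + lookup v x = lookup (sqfree_monomial \<tau> S) x" for x
    by (simp flip: assms(2) add: lookup_add)
  have fin: "finite T" "finite (S - T)" using assms(1) by (simp_all add: T_def)
  have "u = sqfree_monomial \<tau> T"
  proof (rule poly_mapping_eqI, clarify)
    fix j c
    show "lookup u (j, c) = lookup (sqfree_monomial \<tau> T) (j, c)"
      using l[of "(j, c)"] assms(1) fin
      by (auto simp: lookup_sqfree_monomial T_def split: if_splits)
  qed
  moreover have "v = sqfree_monomial \<tau> (S - T)"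
  proof (rule poly_mapping_eqI, clarify)
    fix j c
    show "lookup v (j, c) = lookup (sqfree_monomial \<tau> (S - T)) (j, c)"
      using l[of "(j, c)"] assms(1) fin
      by (auto simp: lookup_sqfree_monomial T_def split: if_splits)
  qed
  moreover have "T \<subseteq> S" by (auto simp: T_def)
  ultimately show ?thesis by (intro that[of T])
qed

lemma lookup_mult_squarefree_nonzero:
  fixes f g :: "'a::comm_ring_1 vpoly"
  assumes "finite S" "lookup (f * g) (sqfree_monomial \<tau> S) \<noteq> 0"
  obtains T where "T \<subseteq> S" "lookup f (sqfree_monomial \<tau> T) \<noteq> 0"
    "lookup g (sqfree_monomial \<tau> (S - T)) \<noteq> 0"
proof -
  have "sqfree_monomial \<tau> S \<in> keys (f * g)" using assms(2) by (simp add: in_keys_iff)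
  then obtain u v where uv: "u \<in> keys f" "v \<in> keys g" "u + v = sqfree_monomial \<tau> S"
    using keys_mult[of f g] by auto
  from sqfree_monomial_split[OF assms(1) uv(3)] obtain T
    where "T \<subseteq> S" "u = sqfree_monomial \<tau> T" "v = sqfree_monomial \<tau> (S - T)" .
  with uv(1,2) show ?thesis by (intro that[of T]) (simp_all add: in_keys_iff)
qed

lemma admissible_split:
  assumes "T \<subseteq> S" "admissible \<nu> T" "admissible \<nu> (S - T)"
  shows "admissible \<nu> S"
proof (cases "{..<2*\<nu>} \<subseteq> S")
  case False
  then have T: "T \<subseteq> {..<2*\<nu>}" "\<forall>r<\<nu>. 2*r \<in> T \<longleftrightarrow> 2*r+1 \<in> T"
    and ST: "S - T \<subseteq> {..<2*\<nu>}" "\<forall>r<\<nu>. 2*r \<in> S - T \<longleftrightarrow> 2*r+1 \<in> S - T"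
    using assms unfolding admissible_def by blast+
  have "2*r \<in> S \<longleftrightarrow> 2*r+1 \<in> S" if "r < \<nu>" for r
    using T(2)[rule_format, OF that] ST(2)[rule_format, OF that] assms(1) by blast
  then show ?thesis using T(1) ST(1) unfolding admissible_def by blast
qed (simp add: admissible_def)

text \<open>
  The part that contains the index \<open>2 * \<nu>\<close> contains a \<open>z\<close> and hence all pairs; the other part then
  contains neither all pairs nor any single pair.
\<close>

lemma admissible_split_full:
  assumes "\<nu> > 0" "2*\<nu> < m" "T \<subseteq> {..<m}" "admissible \<nu> T" "admissible \<nu> ({..<m} - T)"
  shows "T = {..<m} \<or> {..<m} - T = {..<m}"
proof -
  have key: "U = {}" if "{..<2*\<nu>} \<inter> U = {}" "admissible \<nu> U" for U
  proof -
    have "0 \<in> {..<2*\<nu>}" using assms(1) by simp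
    with that show ?thesis unfolding admissible_def by blast
  qed
  have top: "2*\<nu> \<in> T \<or> 2*\<nu> \<in> {..<m} - T" using assms(2) by simp
  have contains: "{..<2*\<nu>} \<subseteq> U" if "2*\<nu> \<in> U" "admissible \<nu> U" for U
  proof -
    have "\<not> U \<subseteq> {..<2*\<nu>}" using that(1) by (metis lessThan_iff less_irrefl subsetD)
    with that(2) show ?thesis unfolding admissible_def by blast
  qed
  show ?thesis
  proof (cases "2*\<nu> \<in> T")
    case True
    then have "{..<m} - T = {}" using contains[OF True assms(4)] assms(5) key[of "{..<m} - T"] by blast
    then show ?thesis using assms(3) by blast
  next
    case False
    then have "{..<2*\<nu>} \<subseteq> {..<m} - T" using contains[OF _ assms(5)] top by blast
    then have "T = {}" using assms(4) key[of T] by blast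
    then show ?thesis by blast
  qed
qed

text \<open>
  The condition at the inadmissible sets is carried along to make the induction work for products.
\<close>

lemma generated_subalgebra_coefficients:
  fixes A :: "'a::comm_ring_1 vpoly set"
  assumes \<nu>: "\<nu> > 0" "2*\<nu> < m"
    and gen: "\<And>p S. p \<in> A \<Longrightarrow> finite S \<Longrightarrow> \<not> admissible \<nu> S \<or> S = {..<m} \<Longrightarrow>
      lookup p (sqfree_monomial (standard_word \<nu>) S) = 0"
    and p: "p \<in> generated_subalgebra A" and S: "finite S" "\<not> admissible \<nu> S \<or> S = {..<m}"
  shows "lookup p (sqfree_monomial (standard_word \<nu>) S) = 0"
  using p S
proof (induction arbitrary: S rule: generated_subalgebra.induct)
  case (const c)
  have "S \<noteq> {}" using const \<nu> by (auto simp: admissible_def)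
  then obtain j where "j \<in> S" by auto
  then have "lookup (sqfree_monomial (standard_word \<nu>) S) (j, standard_word \<nu> j) \<noteq> 0"
    using const by (simp add: lookup_sqfree_monomial)
  then have "sqfree_monomial (standard_word \<nu>) S \<noteq> 0" by auto
  then show ?case by (simp add: Const_def lookup_single when_def)
next
  case (gen f)
  then show ?case using assms(3) by blast
next
  case (add f g)
  then show ?case by (simp add: lookup_add)
next
  case (mult f g)
  show ?case
  proof (rule ccontr)
    assume "lookup (f * g) (sqfree_monomial (standard_word \<nu>) S) \<noteq> 0"
    from lookup_mult_squarefree_nonzero[OF mult.prems(1) this] obtain T where T: "T \<subseteq> S"
      "lookup f (sqfree_monomial (standard_word \<nu>) T) \<noteq> 0"
      "lookup g (sqfree_monomial (standard_word \<nu>) (S - T)) \<noteq> 0" .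
    have "finite T" using T(1) mult.prems(1) by (rule finite_subset)
    then have adm: "admissible \<nu> T" "T \<noteq> {..<m}" using mult.IH(1) T(2) by blast+
    have "finite (S - T)" using mult.prems(1) by simp
    then have adm': "admissible \<nu> (S - T)" "S - T \<noteq> {..<m}" using mult.IH(2) T(3) by blast+
    show False
    proof (cases "S = {..<m}")
      case True
      then show False using admissible_split_full[OF \<nu>, of T] T(1) adm adm' by blast
    next
      case False
      then show False using admissible_split[OF T(1) adm(1) adm'(1)] mult.prems(2) by simp
    qed
  qed
qed

lemma degree_le_total_degree:
  assumes "t \<in> keys p"
  shows "(\<Sum>v\<in>keys t. lookup t v) \<le> total_degree p"
  unfolding total_degree_def using assms by (intro Max_ge) auto

lemma total_degree_multilinear:
  assumes "multilinear n m p"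
  shows "total_degree p \<le> m"
proof -
  have "(\<Sum>v\<in>keys t. lookup t v) \<le> m" if t: "t \<in> keys p" for t
  proof -
    have "keys t \<subseteq> {..<m} \<times> {..<n}" "\<forall>i<m. (\<Sum>r<n. lookup t (i, r)) = 1"
      using assms t by (auto simp: multilinear_def poly_ring_def)
    then have "(\<Sum>v\<in>keys t. lookup t v) =
        (\<Sum>v\<in>{..<m} \<times> {..<n}. lookup t v)"
      by (intro sum.mono_neutral_left) (auto simp: in_keys_iff)
    also have "\<dots> = (\<Sum>i<m. \<Sum>r<n. lookup t (i, r))"
      by (simp add: sum.cartesian_product)
    finally show ?thesis using \<open>\<forall>i<m. _\<close> by simp
  qed
  then show ?thesis by (simp add: total_degree_def)
qed

lemma multilinear_spin_trace:
  "multilinear (2*\<nu>+1) m (spin_trace \<nu> (map Var [0..<m]) :: 'a::comm_ring_1 vpoly)"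
  using multilinear_in_spin_trace[of "[0..<m]" \<nu> "[]", where 'a = 'a]
  by (simp add: multilinear_eq atLeast0LessThan del: One_nat_def)

text \<open>
  The coefficient is the trace of the word \<open>x\<^sub>1 y\<^sub>1 \<dots> x\<^sub>\<nu> y\<^sub>\<nu> z \<dots> z\<close>.
\<close>

lemma spin_trace_leading_coefficient:
  assumes "2*\<nu> \<le> m"
  shows "lookup (spin_trace \<nu> (map Var [0..<m]) :: 'a::comm_ring_1 vpoly)
    (sqfree_monomial (standard_word \<nu>) {..<m}) = 1"
proof -
  let ?T = "spin_trace \<nu> (map Var [0..<m]) :: 'a vpoly"
  interpret I: comm_ring_hom "\<lambda>x :: 'a. x" by (rule comm_ring_hom_id)
  interpret E: comm_ring_hom "eval_vpoly (\<lambda>x :: 'a. x) (\<lambda>(i, r). basis_vec (standard_word \<nu> i) r)"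
    by (rule I.comm_ring_hom_eval_vpoly)
  have "lookup ?T (sqfree_monomial (standard_word \<nu>) {..<m}) =
      eval_vpoly (\<lambda>x. x) (\<lambda>(i, r). basis_vec (standard_word \<nu> i) r) ?T"
    using multilinear_spin_trace[of \<nu> m, where 'a = 'a] unfolding multilinear_eq
    by (intro multilinear_in_coefficient[symmetric]) (auto simp: standard_word_def)
  also have "\<dots> = spin_trace \<nu> (map (\<lambda>i. basis_vec (standard_word \<nu> i)) [0..<m])"
    by (simp add: E.hom_spin_trace o_def I.eval_vpoly_Var)
  also have "map (\<lambda>i. basis_vec (standard_word \<nu> i)) [0..<m] =
      map basis_vec [0..<2*\<nu>] @ replicate (m - 2*\<nu>) (basis_vec (2*\<nu>) :: nat \<Rightarrow> 'a)"
    using assms by (intro nth_equalityI) (auto simp: nth_append standard_word_def)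
  finally show ?thesis by (simp only: spin_trace_full_word)
qed

lemma special_orthogonal_subset: "special_orthogonal_group n \<subseteq> orthogonal_group n"
proof
  fix A :: "'a mat" assume "A \<in> special_orthogonal_group n"
  then obtain T where "connectedin (subtopology (zariski_mat n) (orthogonal_group n)) T" "A \<in> T"
    by (auto simp: special_orthogonal_group_def connected_component_of_def)
  then show "A \<in> orthogonal_group n"
    by (auto simp: connectedin_def)
qed

lemma spin_trace_indecomposable:
  assumes two: "(1 :: 'a::alg_closed_field) + 1 = 0" and \<nu>: "\<nu> > 0" "2*\<nu> < m"
  shows "indecomposable (invariants (2*\<nu>+1) m (special_orthogonal_group (2*\<nu>+1)))
    (spin_trace \<nu> (map Var [0..<m]) :: 'a vpoly)"
  unfolding indecomposable_def
proof
  let ?n = "2*\<nu>+1" and ?T = "spin_trace \<nu> (map Var [0..<m]) :: 'a vpoly"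
  let ?inv = "invariants ?n m (special_orthogonal_group ?n) :: 'a vpoly set"
  have "act ?n A ?T = ?T" if "A \<in> special_orthogonal_group ?n" for A
    by (rule act_spin_trace[OF two subsetD[OF special_orthogonal_subset that]])
  then show "?T \<in> ?inv"
    using multilinear_spin_trace[of \<nu> m, where 'a = 'a]
    by (simp add: invariants_def multilinear_def)
  have coeff: "lookup p (sqfree_monomial (standard_word \<nu>) S) = 0"
    if p: "p \<in> {p \<in> ?inv. total_degree p < total_degree ?T}" and S: "finite S" "\<not> admissible \<nu> S \<or> S =
        {..<m}" for p S
    using S(2)
  proof
    assume "\<not> admissible \<nu> S"
    then show ?thesis using invariant_coefficient_not_admissible[OF two _ S(1)] p by blast
  next
    assume S_eq: "S = {..<m}"
    let ?M = "sqfree_monomial (standard_word \<nu>) S"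
    have "(\<Sum>v\<in>keys ?M. lookup ?M v) = m"
    proof -
      have "inj_on (\<lambda>j. (j, standard_word \<nu> j)) S" by (rule inj_onI) simp
      then show ?thesis
        unfolding keys_sqfree_monomial[OF S(1)]
        by (simp add: sum.reindex lookup_sqfree_monomial S_eq)
    qed
    moreover have "total_degree p < m"
      using p total_degree_multilinear[OF multilinear_spin_trace[of \<nu> m, where 'a = 'a]] by simp
    ultimately have "?M \<notin> keys p" using degree_le_total_degree[of ?M p] by auto
    then show ?thesis by (simp add: in_keys_iff)
  qed
  show "?T \<notin> generated_subalgebra {p \<in> ?inv. total_degree p < total_degree ?T}"
  proof
    assume "?T \<in> generated_subalgebra {p \<in> ?inv. total_degree p < total_degree ?T}"
    from generated_subalgebra_coefficients[OF \<nu> coeff this, of "{..<m}"]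
    show False using spin_trace_leading_coefficient[of \<nu> m, where 'a = 'a] \<nu> by simp
  qed
qed

theorem theorem4:
  fixes n m :: nat
  assumes "CHAR('k::alg_closed_field) = 2"
    and "odd n" and "n \<ge> 3" and "m \<ge> n"
  shows "(even m \<longrightarrow>
            multilinear n m (gpoly n m :: 'k vpoly) \<and>
            indecomposable (invariants n m (special_orthogonal_group n)) (gpoly n m :: 'k vpoly)) \<and>
         (odd m \<longrightarrow>
            multilinear n m (hpoly n m :: 'k vpoly) \<and>
            indecomposable (invariants n m (special_orthogonal_group n)) (hpoly n m :: 'k vpoly))"
proof -
  obtain \<nu> where n: "n = 2*\<nu>+1" using assms(2) by (elim oddE)
  have \<nu>: "\<nu> > 0" "2*\<nu> < m" "m \<ge> 2*\<nu>+1" using assms n by auto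
  have "(1 :: 'k) + 1 = 0"
    using of_nat_CHAR[where 'a = 'k] assms(1) by simp
  then have "multilinear n m (spin_trace \<nu> (map Var [0..<m]) :: 'k vpoly) \<and>
      indecomposable (invariants n m (special_orthogonal_group n)) (spin_trace \<nu>
          (map Var [0..<m]) :: 'k vpoly)"
    unfolding n using multilinear_spin_trace spin_trace_indecomposable \<nu> by blast
  then show ?thesis
    using gpoly_eq_spin_trace[OF _ \<nu>(3), where 'a = 'k] hpoly_eq_spin_trace[OF _ \<nu>(3), where 'a = 'k]
    unfolding n by simp
qed

end
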